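(* Let $t_0=\infty$, and let $(t_j)_{j=1}^k$ be the scaled Zolotarev points $$t_j=\lambda_n\operatorname{dn}\Bigl(\tfrac{2(k-j)+1}{2k}K(\delta'),\delta'\Bigr),\qquad \delta'=\sqrt{1-\delta^2},\qquad \delta=\frac{\lambda_1}{\lambda_n},\qquad j=1,\dots,k.$$ Let $\mathbf u=L^{-s}\mathbf b$, and let $\mathbf u^{\mathrm{RB}}_{k+1}=V f(V^TLV)V^T\mathbf b$ with $f(z)=z^{-s}$ be the reduced basis approximation with snapshots $(t_j)_{j=0}^k$. Let $C$ be the constant of the quasi-optimality bound for rational Krylov approximations recalled in the context ($C\le 11.08$, and $C=1$ if $L$ is self-adjoint). Then for all $s\in(0,1)$ $$\|\mathbf u-\mathbf u^{\mathrm{RB}}_{k+1}\|\le 4C\lambda_1^{-s}e^{-C^*k}\|\mathbf b\|,$$ where $$C^*=\frac{\pi K(\mu_1)}{4K(\mu)},\qquad \mu=\left(\frac{1-\sqrt\delta}{1+\sqrt\delta}\right)^2,\qquad \mu_1=\sqrt{1-\mu^2},\qquad \delta=\frac{\lambda_1}{\lambda_n}.$$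
   Context: $L=M^{-1}S\in\mathbb{R}^{n\times n}$, where $S$ and $M$ are the symmetric positive definite stiffness and mass matrices of a finite-dimensional discretization of a self-adjoint elliptic diffusion operator with homogeneous Dirichlet conditions; $\lambda_1$ and $\lambda_n$ are the smallest and largest eigenvalues of $L$, and $\mathbf b\in\mathbb{R}^n$. $\|\cdot\|$ is the Euclidean vector norm, the superscript $T$ is the ordinary transpose, and orthonormality is Euclidean. $K(\cdot)$ denotes the (complete) elliptic integral of the first kind as a function of the modulus, and $\operatorname{dn}(\cdot,m)$ the Jacobi elliptic function with modulus $m$. For $t\in[0,\infty)$ put $\mathbf w(t)=(tI+L)^{-1}\mathbf b$, and $\mathbf w(\infty):=\mathbf b$. The reduced space with snapshots $(t_j)_{j=0}^k$ is $\mathcal V_{k+1}(L,\mathbf b)=\operatorname{span}\{\mathbf w(t_0),\dots,\mathbf w(t_k)\}$, and $V\in\mathbb{R}^{n\times(k+1)}$ is a matrix whose columns form an orthonormal basis of it. The constant $C$: for poles $(d_j)_{j=0}^k\subset(-\infty,0]\cup\{-\infty\}$ put $q_k(z)=\prod_{0\le j\le k,\ d_j\ne-\infty}(z-d_j)$ and let $W$ be an orthonormal basis of $\mathcal Q_{k+1}(L,\mathbf b)=q_k(L)^{-1}\operatorname{span}\{\mathbf b,L\mathbf b,\dots,L^k\mathbf b\}$. The quasi-optimality bound says that for every function $g$ analytic in a neighbourhood of the numerical range $\mathbb W(L)$ and every set $\Sigma\supseteq\mathbb W(L)$, $$\|g(L)\mathbf b-W g(W^TLW)W^T\mathbf b\|\le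 2C\|\mathbf b\|\min_{p\in\mathcal P_k}\|g-p/q_k\|_{L_\infty(\Sigma)}$$ with a constant $C\le 11.08$, and with $C=1$ if $L$ is self-adjoint; $\mathcal P_k$ is the space of polynomials of degree at most $k$.
   Formalization: If L is not symmetric, the quasi-optimality bound with constant C is assumed also with the spectral interval [λ₁,λₙ] in place of the numerical range, since the claim can fail otherwise; for symmetric L it is proved with C=1 and without assuming any quasi-optimality bound. *)

theory Defs
  imports "HOL-Analysis.Analysis" "HOL-Computational_Algebra.Polynomial"
begin

text \<open>The second argument is always the modulus \<open>m\<close>, not the parameter \<open>m\<^sup>2\<close>;
  the definitions are meant for \<open>0 \<le> m < 1\<close>. The integral is oriented, so
  \<open>ellF\<close> is an odd function of the amplitude.\<close>

definition ellF :: "real \<Rightarrow> real \<Rightarrow> real" where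
  "ellF \<phi> m = (LBINT \<theta>=0..\<phi>. 1 / sqrt (1 - m\<^sup>2 * (sin \<theta>)\<^sup>2))"

definition ellK :: "real \<Rightarrow> real" where
  "ellK m = ellF (pi / 2) m"

definition jacobi_am :: "real \<Rightarrow> real \<Rightarrow> real" where
  "jacobi_am x m = (THE \<phi>. ellF \<phi> m = x)"

definition jacobi_dn :: "real \<Rightarrow> real \<Rightarrow> real" where
  "jacobi_dn x m = sqrt (1 - m\<^sup>2 * (sin (jacobi_am x m))\<^sup>2)"

definition spd :: "real^'n^'n \<Rightarrow> bool" where
  "spd A \<longleftrightarrow> transpose A = A \<and> (\<forall>x. x \<noteq> 0 \<longrightarrow> x \<bullet> (A *v x) > 0)"

definition eigenvalues :: "'a::field^'n^'n \<Rightarrow> 'a set" where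
  "eigenvalues A = {z. \<exists>v. v \<noteq> 0 \<and> A *v v = z *s v}"

definition cvec :: "real^'n \<Rightarrow> complex^'n" where
  "cvec x = (\<chi> i. complex_of_real (x $ i))"

definition cmat :: "real^'n^'m \<Rightarrow> complex^'n^'m" where
  "cmat = map_matrix complex_of_real"

text \<open>The library's \<open>*\<close> on \<open>_^_\<close> is componentwise, so \<open>A ^ i\<close> would not be the matrix power.\<close>

definition matpow :: "'a::comm_ring_1^'n^'n \<Rightarrow> nat \<Rightarrow> 'a^'n^'n" where
  "matpow A i = (((**) A) ^^ i) (mat 1)"

definition poly_mat :: "'a::comm_ring_1 poly \<Rightarrow> 'a^'n^'n \<Rightarrow> 'a^'n^'n" where
  "poly_mat p A = (\<Sum>i\<le>degree p. mat (coeff p i) ** matpow A i)"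

text \<open>The primary matrix function: \<open>g(A) = p(A)\<close> for any polynomial \<open>p\<close> that
  Hermite-interpolates \<open>g\<close> on the spectrum of \<open>A\<close>. Matching the derivatives of order below
  the matrix size is at least what the index of each eigenvalue requires; the value \<open>p(A)\<close>
  does not depend on the choice. For diagonalizable \<open>A\<close> this is \<open>X diag(g(z\<^sub>i)) X\<^sup>-\<^sup>1\<close>.\<close>

definition mat_fun :: "(complex \<Rightarrow> complex) \<Rightarrow> complex^'n^'n \<Rightarrow> complex^'n^'n" where
  "mat_fun g A = (THE B. \<exists>p. B = poly_mat p A \<and>
     (\<forall>z\<in>eigenvalues A. \<forall>i<CARD('n). poly ((pderiv ^^ i) p) z = (deriv ^^ i) g z))"

definition numerical_range :: "real^'n^'n \<Rightarrow> complex set" where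
  "numerical_range A =
     {\<Sum>i\<in>UNIV. cnj (x $ i) * (cmat A *v x) $ i | x :: complex^'n. norm x = 1}"

definition orthonormal_basis_of :: "real^'m^'n \<Rightarrow> (real^'n) set \<Rightarrow> bool" where
  "orthonormal_basis_of V X \<longleftrightarrow> transpose V ** V = mat 1 \<and> span (columns V) = X"

definition galerkin_fun ::
    "(complex \<Rightarrow> complex) \<Rightarrow> real^'m^'n \<Rightarrow> real^'n^'n \<Rightarrow> real^'n \<Rightarrow> complex^'n" where
  "galerkin_fun g V L b =
     cmat V *v (mat_fun g (cmat (transpose V ** L ** V)) *v cvec (transpose V *v b))"

definition snapshot :: "real^'n^'n \<Rightarrow> real^'n \<Rightarrow> ereal \<Rightarrow> real^'n" where
  "snapshot L b t = (if t = \<infinity> then b else matrix_inv (mat (real_of_ereal t) + L) *v b)"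

definition reduced_space ::
    "real^'n^'n \<Rightarrow> real^'n \<Rightarrow> (nat \<Rightarrow> ereal) \<Rightarrow> nat \<Rightarrow> (real^'n) set" where
  "reduced_space L b t k = span ((\<lambda>j. snapshot L b (t j)) ` {0..k})"

definition pole_poly :: "(nat \<Rightarrow> ereal) \<Rightarrow> nat \<Rightarrow> real poly" where
  "pole_poly d k = (\<Prod>j\<in>{j. j \<le> k \<and> d j \<noteq> -\<infinity>}. [:- real_of_ereal (d j), 1:])"

definition krylov_space ::
    "real^'n^'n \<Rightarrow> real^'n \<Rightarrow> (nat \<Rightarrow> ereal) \<Rightarrow> nat \<Rightarrow> (real^'n) set" where
  "krylov_space L b d k =
     (\<lambda>x. matrix_inv (poly_mat (pole_poly d k) L) *v x) ` span ((\<lambda>i. matpow L i *v b) ` {0..k})"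

definition sup_norm :: "complex set \<Rightarrow> (complex \<Rightarrow> complex) \<Rightarrow> ennreal" where
  "sup_norm \<Sigma> h = (SUP z\<in>\<Sigma>. ennreal (norm (h z)))"

text \<open>\<open>quasi_optimal TYPE('m) L b k E C\<close>: the quasi-optimality bound with constant \<open>C\<close>, for
  functions analytic in a neighbourhood of \<open>E\<close> and for all \<open>\<Sigma> \<supseteq> E\<close>; the standard case is
  \<open>E = numerical_range L\<close>. The hull of the spectrum, which lies in \<open>numerical_range L\<close> when the
  eigenvalues are real, gives a stronger condition on \<open>C\<close>; the two sets coincide when \<open>L\<close> is
  symmetric, but \<open>L = M\<^sup>-\<^sup>1 S\<close> in general is not.
  The index type \<open>'m\<close> of the columns of \<open>W\<close> is meant to have \<open>k + 1\<close> elements.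
  Sets \<open>\<Sigma>\<close> containing a pole are left out: there the right-hand side is infinite, whereas
  division by zero would make it finite.\<close>

definition quasi_optimal ::
    "'m::finite itself \<Rightarrow> real^'n^'n \<Rightarrow> real^'n \<Rightarrow> nat \<Rightarrow> complex set \<Rightarrow> real \<Rightarrow> bool" where
  "quasi_optimal _ L b k E C \<longleftrightarrow> 0 \<le> C \<and>
     (\<forall>(d :: nat \<Rightarrow> ereal) (W :: real^'m^'n) g \<Sigma>.
        (\<forall>j\<le>k. d j \<le> 0) \<longrightarrow>
        orthonormal_basis_of W (krylov_space L b d k) \<longrightarrow>
        g analytic_on E \<longrightarrow> E \<subseteq> \<Sigma> \<longrightarrow>
        (\<forall>z\<in>\<Sigma>. poly (map_poly complex_of_real (pole_poly d k)) z \<noteq> 0) \<longrightarrow>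
        ennreal (norm (mat_fun g (cmat L) *v cvec b - galerkin_fun g W L b))
          \<le> ennreal (2 * C * norm b) *
            (INF p\<in>{p. degree p \<le> k}. sup_norm \<Sigma>
               (\<lambda>z. g z - poly p z / poly (map_poly complex_of_real (pole_poly d k)) z)))"

end

theory Submission
  imports Defs
begin

text \<open>
  Write \<open>h(z) = \<Prod>\<^sub>j (z - t\<^sub>j) / (z + t\<^sub>j)\<close>. The identity
  \<open>(1 - h(z) h(t)) / (t + z) = \<Sum>\<^sub>j 2 t\<^sub>j h\<^sub>j\<^sub>-\<^sub>1(z) h\<^sub>j\<^sub>-\<^sub>1(t) / ((z + t\<^sub>j) (t + t\<^sub>j))\<close>, integrated against
  \<open>t\<^sup>-\<^sup>s\<close>, yields a combination of the \<open>1 / (z + t\<^sub>j)\<close> that differs from \<open>z\<^sup>-\<^sup>s\<close> by at most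
  \<open>z\<^sup>-\<^sup>s |h(z)|\<close> for \<open>z > 0\<close>; quasi-optimality then reduces the claim to
  \<open>|h| \<le> 2 exp (- \<pi> k K(\<delta>) / K(\<delta>'))\<close> on the spectral interval, where
  \<open>K(\<mu>\<^sub>1) / K(\<mu>) = 4 K(\<delta>) / K(\<delta>')\<close> by Landen transformations.

  For the bound on \<open>h\<close> put \<open>F = \<delta>' sn / (1 + dn)\<close>. An addition theorem gives
  \<open>(dn u - dn v) / (dn u + dn v) = - F(u + v) F(u - v)\<close>, so \<open>h \<circ> dn\<close> is a product of equispaced shifts
  of \<open>F\<close>; hence \<open>|h \<circ> dn|\<close> is periodic and its maximum \<open>M\<^sub>k\<close> is attained at \<open>0\<close>. Comparing the rational
  functions of degree \<open>k\<close> and \<open>2 k\<close> gives \<open>M\<^sub>k\<^sup>2 \<le> 2 M\<^sub>2\<^sub>k\<close>, so \<open>(M\<^sub>k / 2)\<^sup>1\<^sup>/\<^sup>k\<close> is bounded by its limit along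
  doubling of \<open>k\<close>. As \<open>ln M\<^sub>k\<close> is a Riemann sum, the limit is governed by
  \<open>\<integral>\<^sub>0\<^sup>K ln ((1 + dn u) / (1 - dn u)) du = \<pi> K(\<delta>)\<close>, \<open>K = K(\<delta>')\<close>, which follows by writing the logarithm as an
  integral and exchanging the order of integration.
\<close>

subsection \<open>Jacobi elliptic functions\<close>

text \<open>The final constant is \<open>4 * C = 2 * C * 2\<close>: the factor \<open>2 * C\<close>
  is that of quasi-optimality, the last 2 that of the bound on \<open>h\<close>. Written as
  \<open>(M\<^sub>k / 2)\<^sup>2 \<le> M\<^sub>2\<^sub>k / 2\<close>, the doubling inequality loses
  nothing under iteration, so a crude Riemann sum estimate suffices: its error does not depend on
  the number of nodes and is divided by \<open>2 ^ n\<close>. This argument replaces theta function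
  products. The logarithm is singular where \<open>dn = 1\<close>. Multiplying \<open>dn\<close> by
  \<open>sin \<alpha>\<close> with \<open>\<alpha> < pi / 2\<close> keeps all integrands continuous
  and monotone; \<open>\<alpha>\<close> tends to \<open>pi / 2\<close> only after \<open>n\<close>
  tends to infinity. On the matrix side, \<open>L\<close> is self-adjoint for the inner product of
  \<open>M\<close> but in general not symmetric, so values on its spectrum do not control functions
  of \<open>L\<close> in the Euclidean norm. If \<open>L\<close> is symmetric, then
  \<open>C = 1\<close> and the error estimate is derived from the spectral theorem. Otherwise
  quasi-optimality is applied on the real interval spanned by the spectrum, because this is where
  the rational approximation is controlled.\<close>

lemma ell_arg_pos:
  fixes m :: real
  assumes "\<bar>m\<bar> < 1"
  shows "0 < 1 - m\<^sup>2 * (sin \<phi>)\<^sup>2"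
proof -
  have "m\<^sup>2 * (sin \<phi>)\<^sup>2 \<le> m\<^sup>2 * 1"
    by (intro mult_left_mono) (auto simp: abs_square_le_1)
  also have "m\<^sup>2 < 1" using assms by (simp add: abs_square_less_1)
  finally show ?thesis by simp
qed

lemma ell_integrand_continuous:
  fixes m :: real
  assumes "\<bar>m\<bar> < 1"
  shows "continuous_on X (\<lambda>\<theta>. 1 / sqrt (1 - m\<^sup>2 * (sin \<theta>)\<^sup>2))"
  using ell_arg_pos[OF assms] by (intro continuous_intros) (auto simp: less_imp_neq[symmetric])

lemma ellF_0 [simp]: "ellF 0 m = 0"
  by (simp add: ellF_def zero_ereal_def)

lemma ellF_deriv:
  assumes "\<bar>m\<bar> < 1"
  shows "((\<lambda>\<phi>. ellF \<phi> m) has_real_derivative 1 / sqrt (1 - m\<^sup>2 * (sin \<phi>)\<^sup>2)) (at \<phi>)"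
proof -
  let ?a = "- \<bar>\<phi>\<bar> - 1" and ?b = "\<bar>\<phi>\<bar> + 1"
  have "((\<lambda>u. LBINT y=(0::real)..u. 1 / sqrt (1 - m\<^sup>2 * (sin y)\<^sup>2))
      has_vector_derivative 1 / sqrt (1 - m\<^sup>2 * (sin \<phi>)\<^sup>2)) (at \<phi> within {?a..?b})"
    by (rule interval_integral_FTC2) (auto intro: ell_integrand_continuous assms)
  moreover have "at \<phi> within {?a..?b} = at \<phi>"
    by (rule at_within_interior) auto
  ultimately show ?thesis
    by (simp add: ellF_def zero_ereal_def has_real_derivative_iff_has_vector_derivative)
qed

lemmas ellF_deriv_comp [derivative_intros] = DERIV_chain'[OF _ ellF_deriv]

text \<open>The functional equations of \<open>ellF\<close>, the addition theorem and Landen's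
  substitution are all proved by a vanishing derivative and evaluation at one point.\<close>

lemma const_of_zero_deriv:
  fixes f :: "real \<Rightarrow> real"
  assumes "\<And>x. (f has_real_derivative 0) (at x)"
  shows "f x = f y"
  using DERIV_isconst_all[of f x y] assms by blast

lemma ellF_minus:
  assumes "\<bar>m\<bar> < 1"
  shows "ellF (- \<phi>) m = - ellF \<phi> m"
proof -
  have "((\<lambda>x. ellF (- x) m + ellF x m) has_real_derivative 0) (at x)" for x
    by (rule derivative_eq_intros ellF_deriv assms refl | simp add: assms)+
  from const_of_zero_deriv[of "\<lambda>x. ellF (- x) m + ellF x m", OF this, of \<phi> 0]
  show ?thesis by simp
qed

lemma ellF_add_pi:
  assumes "\<bar>m\<bar> < 1"
  shows "ellF (\<phi> + pi) m = ellF \<phi> m + 2 * ellK m"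
proof -
  have "((\<lambda>x. ellF (x + pi) m - ellF x m) has_real_derivative 0) (at x)" for x
    by (rule derivative_eq_intros ellF_deriv assms refl | simp add: assms)+
  from const_of_zero_deriv[of "\<lambda>x. ellF (x + pi) m - ellF x m", OF this]
  have c: "ellF (x + pi) m - ellF x m = ellF (y + pi) m - ellF y m" for x y .
  \<comment> \<open>At \<open>- pi / 2\<close> the constant difference is
    \<open>ellF (pi / 2) m - ellF (- pi / 2) m\<close>, twice the complete integral because
    \<open>ellF\<close> is odd.\<close>
  from c[of \<phi> "- (pi / 2)"] show ?thesis
    using ellF_minus[OF assms, of "pi/2"] by (simp add: ellK_def)
qed

lemma ellF_strict_mono:
  assumes "\<bar>m\<bar> < 1"
  shows "strict_mono (\<lambda>\<phi>. ellF \<phi> m)"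
proof (rule strict_monoI)
  fix x y :: real assume "x < y"
  then show "ellF x m < ellF y m"
    by (rule DERIV_pos_imp_increasing)
       (use ellF_deriv[OF assms] ell_arg_pos[OF assms] in \<open>auto intro!: exI\<close>)
qed

lemma ellK_pos: "\<bar>m\<bar> < 1 \<Longrightarrow> 0 < ellK m"
  using strict_monoD[OF ellF_strict_mono, of m 0 "pi/2"] by (simp add: ellK_def)

lemma ellF_multiple:
  assumes "\<bar>m\<bar> < 1"
  shows "ellF (real n * pi) m = 2 * real n * ellK m"
proof (induction n)
  case (Suc n)
  have "real (Suc n) * pi = real n * pi + pi" by (simp add: algebra_simps)
  then show ?case using Suc ellF_add_pi[OF assms, of "real n * pi"] by (simp add: algebra_simps)
qed simp

lemma ellF_continuous: "\<bar>m\<bar> < 1 \<Longrightarrow> isCont (\<lambda>\<phi>. ellF \<phi> m) x"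
  using ellF_deriv DERIV_isCont by blast

text \<open>Quasi-periodicity makes \<open>ellF\<close> unbounded in both directions, so every
  \<open>x\<close> has a preimage; strict monotonicity makes it the one chosen by
  \<open>THE\<close>.\<close>

lemma ellF_jacobi_am:
  assumes "\<bar>m\<bar> < 1"
  shows "ellF (jacobi_am x m) m = x"
proof -
  obtain n where n: "\<bar>x\<bar> < real n * ellK m"
    using reals_Archimedean3[OF ellK_pos[OF assms]] by blast
  have le: "\<bar>x\<bar> \<le> 2 * real n * ellK m" using n by linarith
  have "\<exists>\<phi>\<ge>- (real n * pi). \<phi> \<le> real n * pi \<and> ellF \<phi> m = x"
    by (rule IVT) (use le ellF_multiple[OF assms, of n] ellF_minus[OF assms, of "real n * pi"]
        ellF_continuous[OF assms] in \<open>auto simp: abs_le_iff\<close>)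
  then obtain \<phi> where \<phi>: "ellF \<phi> m = x" by blast
  have "jacobi_am x m = \<phi>"
    unfolding jacobi_am_def
    using \<phi> strict_mono_eq[OF ellF_strict_mono[OF assms]] by blast
  with \<phi> show ?thesis by simp
qed

lemma jacobi_am_ellF:
  assumes "\<bar>m\<bar> < 1"
  shows "jacobi_am (ellF \<phi> m) m = \<phi>"
  using ellF_jacobi_am[OF assms, of "ellF \<phi> m"]
    strict_mono_eq[OF ellF_strict_mono[OF assms]] by blast

lemma jacobi_am_deriv:
  assumes "\<bar>m\<bar> < 1"
  shows "((\<lambda>x. jacobi_am x m) has_real_derivative jacobi_dn x m) (at x)"
proof -
  have "isCont (\<lambda>x. jacobi_am x m) (ellF (jacobi_am x m) m)"
    by (rule isCont_inverse_function[where d = 1])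
       (use jacobi_am_ellF ellF_continuous assms in auto)
  then have ct: "isCont (\<lambda>x. jacobi_am x m) x" by (simp add: ellF_jacobi_am assms)
  have "((\<lambda>x. jacobi_am x m) has_real_derivative
      inverse (1 / sqrt (1 - m\<^sup>2 * (sin (jacobi_am x m))\<^sup>2))) (at x)"
    by (rule DERIV_inverse_function[where f = "\<lambda>\<phi>. ellF \<phi> m" and a = "x - 1" and b = "x + 1"])
       (use ellF_deriv[OF assms] ell_arg_pos[OF assms, of "jacobi_am x m"] ellF_jacobi_am[OF assms] ct in auto)
  then show ?thesis by (simp add: jacobi_dn_def)
qed

lemma jacobi_am_add:
  assumes "\<bar>m\<bar> < 1"
  shows "jacobi_am (x + 2 * ellK m) m = jacobi_am x m + pi"
  using jacobi_am_ellF[OF assms, of "jacobi_am x m + pi"] ellF_add_pi[OF assms, of "jacobi_am x m"]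
  by (simp add: ellF_jacobi_am assms)

lemma jacobi_am_minus:
  assumes "\<bar>m\<bar> < 1"
  shows "jacobi_am (- x) m = - jacobi_am x m"
  using jacobi_am_ellF[OF assms, of "- jacobi_am x m"] ellF_minus[OF assms, of "jacobi_am x m"]
  by (simp add: ellF_jacobi_am assms)

lemma jacobi_am_mono:
  assumes "\<bar>m\<bar> < 1"
  shows "jacobi_am x m < jacobi_am y m \<longleftrightarrow> x < y"
  using strict_mono_less[OF ellF_strict_mono[OF assms], of "jacobi_am x m" "jacobi_am y m"]
  by (simp add: ellF_jacobi_am assms)

lemma jacobi_am_0 [simp]: "\<bar>m\<bar> < 1 \<Longrightarrow> jacobi_am 0 m = 0"
  using jacobi_am_ellF[of m 0] by simp

lemma jacobi_am_ellK: "\<bar>m\<bar> < 1 \<Longrightarrow> jacobi_am (ellK m) m = pi / 2"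
  unfolding ellK_def by (rule jacobi_am_ellF)

lemma jacobi_dn_pos: "\<bar>m\<bar> < 1 \<Longrightarrow> 0 < jacobi_dn x m"
  unfolding jacobi_dn_def using ell_arg_pos by simp

lemma jacobi_dn_le_1: "jacobi_dn x m \<le> 1"
  unfolding jacobi_dn_def by simp

lemma jacobi_dn_sq:
  "\<bar>m\<bar> < 1 \<Longrightarrow> (jacobi_dn x m)\<^sup>2 = 1 - m\<^sup>2 * (sin (jacobi_am x m))\<^sup>2"
  unfolding jacobi_dn_def using ell_arg_pos[of m "jacobi_am x m"] by simp

lemma jacobi_dn_deriv:
  assumes "\<bar>m\<bar> < 1"
  shows "((\<lambda>x. jacobi_dn x m) has_real_derivative
    - m\<^sup>2 * sin (jacobi_am x m) * cos (jacobi_am x m)) (at x)"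
proof -
  have p: "0 < 1 - m\<^sup>2 * (sin (jacobi_am x m))\<^sup>2" using ell_arg_pos[OF assms] .
  have n: "jacobi_dn x m \<noteq> 0" using jacobi_dn_pos[OF assms, of x] by simp
  have "((\<lambda>x. 1 - m\<^sup>2 * (sin (jacobi_am x m))\<^sup>2) has_real_derivative
    - m\<^sup>2 * (2 * sin (jacobi_am x m) * (cos (jacobi_am x m) * jacobi_dn x m))) (at x)"
    by (rule derivative_eq_intros refl jacobi_am_deriv[OF assms])+ (simp add: algebra_simps)
  from DERIV_chain'[OF this DERIV_real_sqrt[OF p]]
  have "((\<lambda>x. jacobi_dn x m) has_real_derivative
    inverse (jacobi_dn x m) / 2 *
      (- m\<^sup>2 * (2 * sin (jacobi_am x m) * (cos (jacobi_am x m) * jacobi_dn x m)))) (at x)"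
    by (simp add: jacobi_dn_def mult.commute)
  then show ?thesis using n by (simp add: field_simps)
qed

text \<open>For \<open>0 < m < 1\<close> and \<open>\<kappa> = (1 - sqrt (1 - m\<^sup>2)) / (1 +
  sqrt (1 - m\<^sup>2))\<close> this is \<open>sqrt \<kappa> * sn (x / (1 + \<kappa>))\<close> with
  modulus \<open>\<kappa>\<close>, a Landen transform. The factor \<open>sqrt \<kappa>\<close> makes
  the outer coefficients of the quartic differential equation equal and removes the modulus from the
  denominator of the addition theorem.\<close>

definition landen_fun :: "real \<Rightarrow> real \<Rightarrow> real" where
  "landen_fun m x = m * sin (jacobi_am x m) / (1 + jacobi_dn x m)"

definition landen_fun' :: "real \<Rightarrow> real \<Rightarrow> real" where
  "landen_fun' m x = m * cos (jacobi_am x m) / (1 + jacobi_dn x m)"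

lemma landen_fun_sq:
  assumes "\<bar>m\<bar> < 1"
  shows "(landen_fun m x)\<^sup>2 = (1 - jacobi_dn x m) / (1 + jacobi_dn x m)"
proof -
  let ?d = "jacobi_dn x m"
  have d: "0 < 1 + ?d" using jacobi_dn_pos[OF assms, of x] by simp
  have "(landen_fun m x)\<^sup>2 = (1 - ?d) * (1 + ?d) / (1 + ?d)\<^sup>2"
    using jacobi_dn_sq[OF assms, of x]
    by (simp add: landen_fun_def power_divide power_mult_distrib algebra_simps power2_eq_square)
  then show ?thesis using d by (simp add: power2_eq_square)
qed

lemma landen_fun_deriv:
  assumes "\<bar>m\<bar> < 1"
  shows "(landen_fun m has_real_derivative landen_fun' m x) (at x)"
proof -
  let ?a = "\<lambda>x. jacobi_am x m" and ?d = "\<lambda>x. jacobi_dn x m"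
  have n: "1 + ?d x \<noteq> 0" using jacobi_dn_pos[OF assms, of x] by simp
  have "((\<lambda>x. m * sin (?a x) / (1 + ?d x)) has_real_derivative
     (m * (cos (?a x) * ?d x) * (1 + ?d x) - m * sin (?a x) * (- m\<^sup>2 * sin (?a x) * cos (?a x)))
       / (1 + ?d x)\<^sup>2) (at x)"
    by (rule derivative_eq_intros refl jacobi_am_deriv[OF assms] jacobi_dn_deriv[OF assms] n)+
       (simp add: power2_eq_square)
  also have "(m * (cos (?a x) * ?d x) * (1 + ?d x) - m * sin (?a x) * (- m\<^sup>2 * sin (?a x) * cos (?a x)))
     = m * cos (?a x) * (?d x + (?d x)\<^sup>2 + m\<^sup>2 * (sin (?a x))\<^sup>2)"
    by (simp add: algebra_simps power2_eq_square)
  also have "?d x + (?d x)\<^sup>2 + m\<^sup>2 * (sin (?a x))\<^sup>2 = 1 + ?d x"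
    using jacobi_dn_sq[OF assms, of x] by simp
  finally show ?thesis using n
    by (simp add: landen_fun_def[abs_def] landen_fun'_def power2_eq_square)
qed

lemma landen_fun_deriv_sq:
  assumes "\<bar>m\<bar> < 1"
  shows "(landen_fun' m x)\<^sup>2 =
    m\<^sup>2 / 4 - (2 - m\<^sup>2) / 2 * (landen_fun m x)\<^sup>2 + m\<^sup>2 / 4 * (landen_fun m x) ^ 4"
proof -
  define d where "d = jacobi_dn x m"
  have n: "1 + d \<noteq> 0" using jacobi_dn_pos[OF assms, of x] by (simp add: d_def)
  have y: "(landen_fun m x)\<^sup>2 = (1 - d) / (1 + d)"
    using landen_fun_sq[OF assms] by (simp add: d_def)
  have "(landen_fun m x) ^ 4 = ((landen_fun m x)\<^sup>2)\<^sup>2" by simp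
  then have y4: "(landen_fun m x) ^ 4 = ((1 - d) / (1 + d))\<^sup>2" by (simp only: y)
  have "m\<^sup>2 * (cos (jacobi_am x m))\<^sup>2 = m\<^sup>2 - 1 + d\<^sup>2"
    using jacobi_dn_sq[OF assms, of x] by (simp add: d_def cos_squared_eq algebra_simps)
  then have "(landen_fun' m x)\<^sup>2 = (m\<^sup>2 - 1 + d\<^sup>2) / (1 + d)\<^sup>2"
    by (simp add: landen_fun'_def power_divide power_mult_distrib d_def)
  also have "\<dots> = m\<^sup>2 / 4 - (2 - m\<^sup>2) / 2 * ((1 - d) / (1 + d)) + m\<^sup>2 / 4 * ((1 - d) / (1 + d))\<^sup>2"
    using n by (simp add: divide_simps power2_eq_square) algebra
  finally show ?thesis by (simp only: y y4)
qed

lemma landen_fun'_deriv: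
  assumes "\<bar>m\<bar> < 1"
  shows "(landen_fun' m has_real_derivative
    - ((2 - m\<^sup>2) / 2) * landen_fun m x + 2 * (m\<^sup>2 / 4) * (landen_fun m x) ^ 3) (at x)"
proof -
  define d S C where "d = jacobi_dn x m" and "S = sin (jacobi_am x m)" and "C = cos (jacobi_am x m)"
  have n: "1 + d \<noteq> 0" using jacobi_dn_pos[OF assms, of x] by (simp add: d_def)
  have "((\<lambda>x. m * cos (jacobi_am x m) / (1 + jacobi_dn x m)) has_real_derivative
     (m * (- S * d) * (1 + d) - m * C * (- m\<^sup>2 * S * C)) / (1 + d)\<^sup>2) (at x)"
    by (rule derivative_eq_intros refl jacobi_am_deriv[OF assms] jacobi_dn_deriv[OF assms])+
       (use n in \<open>simp_all add: power2_eq_square d_def S_def C_def\<close>)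
  moreover have "(m * (- S * d) * (1 + d) - m * C * (- m\<^sup>2 * S * C)) / (1 + d)\<^sup>2 =
    - ((2 - m\<^sup>2) / 2) * landen_fun m x + 2 * (m\<^sup>2 / 4) * (landen_fun m x) ^ 3"
  proof -
    have "(landen_fun m x) ^ 3 = landen_fun m x * (landen_fun m x)\<^sup>2" by (simp add: power3_eq_cube power2_eq_square)
    also have "\<dots> = m * S / (1 + d) * ((1 - d) / (1 + d))"
      using landen_fun_sq[OF assms, of x] by (simp add: landen_fun_def d_def S_def)
    finally have 3: "(landen_fun m x) ^ 3 = m * S / (1 + d) * ((1 - d) / (1 + d))" .
    have 1: "landen_fun m x = m * S / (1 + d)" by (simp add: landen_fun_def d_def S_def)
    have d2: "d\<^sup>2 = 1 - m\<^sup>2 * S\<^sup>2" using jacobi_dn_sq[OF assms, of x] by (simp add: d_def S_def)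
    have c2: "C\<^sup>2 = 1 - S\<^sup>2" by (simp add: C_def S_def cos_squared_eq)
    have "m * (- S * d) * (1 + d) - m * C * (- m\<^sup>2 * S * C) = m * S * (- d - d\<^sup>2 + m\<^sup>2 * C\<^sup>2)"
      by (simp add: algebra_simps power2_eq_square)
    also have "\<dots> = m * S * (- d - 1 + m\<^sup>2)"
      by (simp only: d2 c2) (simp add: algebra_simps)
    finally have "(m * (- S * d) * (1 + d) - m * C * (- m\<^sup>2 * S * C)) / (1 + d)\<^sup>2
      = m * S * (- d - 1 + m\<^sup>2) / (1 + d)\<^sup>2" by simp
    also have "\<dots> = - ((2 - m\<^sup>2) / 2) * (m * S / (1 + d)) + 2 * (m\<^sup>2 / 4) * (m * S / (1 + d) * ((1 - d) / (1 + d)))"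
      using n by (simp add: divide_simps power2_eq_square) algebra
    finally show ?thesis by (simp only: 3) (simp only: 1)
  qed
  ultimately show ?thesis by (simp add: landen_fun'_def[abs_def])
qed

section \<open>Symmetries and addition theorem of \<open>landen_fun\<close>\<close>

lemma landen_fun_minus: "\<bar>m\<bar> < 1 \<Longrightarrow> landen_fun m (- x) = - landen_fun m x"
  by (simp add: landen_fun_def jacobi_am_minus jacobi_dn_def)

lemma landen_fun_add: "\<bar>m\<bar> < 1 \<Longrightarrow> landen_fun m (x + 2 * ellK m) = - landen_fun m x"
  by (simp add: landen_fun_def jacobi_am_add jacobi_dn_def)

lemma landen_fun_sq_less_1:
  assumes "\<bar>m\<bar> < 1"
  shows "(landen_fun m x)\<^sup>2 < 1"
  using jacobi_dn_pos[OF assms, of x] by (simp add: landen_fun_sq[OF assms] field_simps)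

text \<open>Euler's argument: on the line \<open>u + v = a\<close> the quotient
  \<open>(F u F' v + F' u F v) / (1 - F\<^sup>2 u F\<^sup>2 v)\<close> has derivative zero.\<close>

lemma quartic_ode_addition:
  fixes F F1 :: "real \<Rightarrow> real"
  assumes dF: "\<And>x. (F has_real_derivative F1 x) (at x)"
    and dF1: "\<And>x. (F1 has_real_derivative - B * F x + 2 * A * F x ^ 3) (at x)"
    and sq: "\<And>x. (F1 x)\<^sup>2 = A - B * (F x)\<^sup>2 + A * F x ^ 4"
    and F0: "F 0 = 0"
    and less1: "\<And>x. (F x)\<^sup>2 < 1"
  shows "F (u + v) * F1 0 * (1 - (F u)\<^sup>2 * (F v)\<^sup>2) = F u * F1 v + F1 u * F v"
proof -
  define a where "a = u + v"
  define N where "N = (\<lambda>w. F w * F1 (a - w) + F1 w * F (a - w))"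
  define D where "D = (\<lambda>w. 1 - (F w)\<^sup>2 * (F (a - w))\<^sup>2)"
  have D0: "D w \<noteq> 0" for w
  proof -
    have "(F w)\<^sup>2 * (F (a - w))\<^sup>2 < 1 * 1"
      by (rule mult_strict_mono') (use less1 in auto)
    then show ?thesis by (simp add: D_def)
  qed
  have dN: "(N has_real_derivative 2 * A * (F w * F (a - w)) * ((F w)\<^sup>2 - (F (a - w))\<^sup>2)) (at w)" for w
    unfolding N_def
    by (rule derivative_eq_intros refl DERIV_chain'[OF _ dF] DERIV_chain'[OF _ dF1])+
       (simp add: algebra_simps power2_eq_square power3_eq_cube)
  have dD: "(D has_real_derivative 2 * (F w * F (a - w)) * (F w * F1 (a - w) - F1 w * F (a - w))) (at w)" for w
    unfolding D_def
    by (rule derivative_eq_intros refl DERIV_chain'[OF _ dF] DERIV_chain'[OF _ dF1])+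
       (simp add: algebra_simps power2_eq_square)
  \<comment> \<open>The derivative of \<open>D\<close> contains the conjugate of \<open>N\<close>.
    Their product is a difference of squares, from which the differential equation eliminates
    \<open>F1\<close>.\<close>
  have key: "N w * (F w * F1 (a - w) - F1 w * F (a - w)) = A * ((F w)\<^sup>2 - (F (a - w))\<^sup>2) * D w" for w
  proof -
    have "N w * (F w * F1 (a - w) - F1 w * F (a - w)) =
        (F w)\<^sup>2 * (F1 (a - w))\<^sup>2 - (F1 w)\<^sup>2 * (F (a - w))\<^sup>2"
      by (simp add: N_def algebra_simps power2_eq_square)
    also have "\<dots> = A * ((F w)\<^sup>2 - (F (a - w))\<^sup>2) * D w"
      by (simp only: sq D_def) algebra
    finally show ?thesis .
  qed
  have "((\<lambda>w. N w / D w) has_real_derivative 0) (at w)" for w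
  proof -
    have "(2 * A * (F w * F (a - w)) * ((F w)\<^sup>2 - (F (a - w))\<^sup>2)) * D w
        - N w * (2 * (F w * F (a - w)) * (F w * F1 (a - w) - F1 w * F (a - w)))
      = 2 * (F w * F (a - w)) * (A * ((F w)\<^sup>2 - (F (a - w))\<^sup>2) * D w
        - N w * (F w * F1 (a - w) - F1 w * F (a - w)))"
      by (simp only: algebra_simps)
    also have "\<dots> = 0" by (simp add: key)
    finally have "(2 * A * (F w * F (a - w)) * ((F w)\<^sup>2 - (F (a - w))\<^sup>2)) * D w
        - N w * (2 * (F w * F (a - w)) * (F w * F1 (a - w) - F1 w * F (a - w))) = 0" .
    from DERIV_divide[OF dN dD D0, of w, unfolded this] show ?thesis by simp
  qed
  from const_of_zero_deriv[of "\<lambda>w. N w / D w", OF this, of u a]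
  have "N u / D u = F a * F1 0" by (simp add: N_def D_def F0)
  then have "N u = F a * F1 0 * D u" using D0[of u] by (simp add: field_simps)
  then show ?thesis by (simp add: N_def D_def a_def)
qed

text \<open>Multiplying the addition formulas for \<open>u + v\<close> and \<open>u - v\<close>
  again gives a difference of squares; eliminating \<open>F1\<close> leaves the factor
  \<open>A * D\<close>, which cancels.\<close>

lemma quartic_ode_product:
  fixes F F1 :: "real \<Rightarrow> real"
  assumes dF: "\<And>x. (F has_real_derivative F1 x) (at x)"
    and dF1: "\<And>x. (F1 has_real_derivative - B * F x + 2 * A * F x ^ 3) (at x)"
    and sq: "\<And>x. (F1 x)\<^sup>2 = A - B * (F x)\<^sup>2 + A * F x ^ 4"
    and F0: "F 0 = 0"
    and less1: "\<And>x. (F x)\<^sup>2 < 1"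
    and odd: "\<And>x. F (- x) = - F x" and even: "\<And>x. F1 (- x) = F1 x"
    and A: "A \<noteq> 0"
  shows "F (u + v) * F (u - v) * (1 - (F u)\<^sup>2 * (F v)\<^sup>2) = (F u)\<^sup>2 - (F v)\<^sup>2"
proof -
  note add = quartic_ode_addition[OF dF dF1 sq F0 less1]
  define D where "D = 1 - (F u)\<^sup>2 * (F v)\<^sup>2"
  have D0: "D \<noteq> 0"
  proof -
    have "(F u)\<^sup>2 * (F v)\<^sup>2 < 1 * 1"
      by (rule mult_strict_mono') (use less1 in auto)
    then show ?thesis by (simp add: D_def)
  qed
  have A': "(F1 0)\<^sup>2 = A" by (simp add: sq F0)
  have "A * D * (F (u + v) * F (u - v) * D) = (F (u + v) * F1 0 * D) * (F (u - v) * F1 0 * D)"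
    by (simp add: A'[symmetric] power2_eq_square algebra_simps)
  also have "\<dots> = (F u * F1 v + F1 u * F v) * (F u * F1 v - F1 u * F v)"
    using add[of u v] add[of u "- v"] by (simp add: D_def odd even)
  also have "\<dots> = (F u)\<^sup>2 * (F1 v)\<^sup>2 - (F1 u)\<^sup>2 * (F v)\<^sup>2"
    by (simp add: algebra_simps power2_eq_square)
  also have "\<dots> = A * D * ((F u)\<^sup>2 - (F v)\<^sup>2)"
    by (simp only: sq D_def) algebra
  finally show ?thesis using A D0 by (simp add: D_def)
qed

lemma landen_fun_product:
  assumes "\<bar>m\<bar> < 1" "m \<noteq> 0"
  shows "landen_fun m (u + v) * landen_fun m (u - v) * (1 - (landen_fun m u)\<^sup>2 * (landen_fun m v)\<^sup>2)
    = (landen_fun m u)\<^sup>2 - (landen_fun m v)\<^sup>2"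
proof (rule quartic_ode_product[where F = "landen_fun m" and ?F1.0 = "landen_fun' m"
      and A = "m\<^sup>2 / 4" and B = "(2 - m\<^sup>2) / 2"])
  show "landen_fun' m (- x) = landen_fun' m x" for x
    using assms by (simp add: landen_fun'_def jacobi_am_minus jacobi_dn_def)
  show "landen_fun m 0 = 0" "m\<^sup>2 / 4 \<noteq> 0"
    using assms by (simp_all add: landen_fun_def)
qed (fact landen_fun_deriv[OF assms(1)] landen_fun'_deriv[OF assms(1)] landen_fun_deriv_sq[OF assms(1)]
      landen_fun_minus[OF assms(1)] landen_fun_sq_less_1[OF assms(1)])+

text \<open>\<open>F\<^sup>2\<close> is the Cayley transform \<open>(1 - dn) / (1 + dn)\<close>, and
  for Cayley transforms \<open>y\<close>, \<open>z\<close> of \<open>d\<close>, \<open>e\<close> the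
  quotient \<open>(y - z) / (1 - y * z)\<close> equals \<open>(e - d) / (e + d)\<close>.\<close>

lemma dn_quotient:
  assumes "\<bar>m\<bar> < 1" "m \<noteq> 0"
  shows "(jacobi_dn u m - jacobi_dn v m) / (jacobi_dn u m + jacobi_dn v m)
    = - landen_fun m (u + v) * landen_fun m (u - v)"
proof -
  define d e where "d = jacobi_dn u m" and "e = jacobi_dn v m"
  have d: "0 < d" and e: "0 < e" using jacobi_dn_pos[OF assms(1)] by (auto simp: d_def e_def)
  define p where "p = landen_fun m (u + v) * landen_fun m (u - v)"
  have "p * (1 - (1 - d) / (1 + d) * ((1 - e) / (1 + e))) = (1 - d) / (1 + d) - (1 - e) / (1 + e)"
    using landen_fun_product[OF assms, of u v] by (simp add: p_def landen_fun_sq assms d_def e_def)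
  moreover have "1 - (1 - d) / (1 + d) * ((1 - e) / (1 + e)) = 2 * (d + e) / ((1 + d) * (1 + e))"
    using d e by (simp add: divide_simps) (simp add: algebra_simps)
  moreover have "(1 - d) / (1 + d) - (1 - e) / (1 + e) = 2 * (e - d) / ((1 + d) * (1 + e))"
    using d e by (simp add: divide_simps) (simp add: algebra_simps)
  ultimately have "p * (2 * (d + e) / ((1 + d) * (1 + e))) = 2 * (e - d) / ((1 + d) * (1 + e))"
    by simp
  then have "p * (2 * (d + e)) = 2 * (e - d)" using d e by (simp add: divide_simps)
  then have "p * (d + e) = e - d" by (simp add: algebra_simps)
  then have "(d - e) / (d + e) = - p" using d e by (simp add: field_simps)
  then show ?thesis by (simp add: p_def d_def e_def)
qed

subsection \<open>Zolotarev functions at equispaced nodes\<close>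

lemma jacobi_am_bounds:
  assumes "\<bar>m\<bar> < 1" "0 \<le> u" "u \<le> ellK m"
  shows "0 \<le> jacobi_am u m" "jacobi_am u m \<le> pi / 2"
  using jacobi_am_mono[OF assms(1), of u 0] jacobi_am_mono[OF assms(1), of "ellK m" u] assms
  by (auto simp: jacobi_am_ellK not_less[symmetric])

lemma jacobi_dn_strict_antimono:
  assumes m: "\<bar>m\<bar> < 1" "m \<noteq> 0" and uv: "0 \<le> u" "u < v" "v \<le> ellK m"
  shows "jacobi_dn v m < jacobi_dn u m"
proof -
  have a: "0 \<le> jacobi_am u m" "jacobi_am u m < jacobi_am v m" "jacobi_am v m \<le> pi / 2"
    using jacobi_am_bounds[of m] jacobi_am_mono[OF m(1)] assms by auto
  have "sin (jacobi_am u m) < sin (jacobi_am v m)"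
    using a by (subst sin_mono_less_eq) auto
  moreover have "0 \<le> sin (jacobi_am u m)" using a by (intro sin_ge_zero) auto
  ultimately have "(sin (jacobi_am u m))\<^sup>2 < (sin (jacobi_am v m))\<^sup>2"
    by (intro power_strict_mono) auto
  then show ?thesis using m by (simp add: jacobi_dn_def)
qed

lemma jacobi_dn_antimono:
  assumes "\<bar>m\<bar> < 1" "m \<noteq> 0" "0 \<le> u" "u \<le> v" "v \<le> ellK m"
  shows "jacobi_dn v m \<le> jacobi_dn u m"
  using jacobi_dn_strict_antimono[of m u v] assms by (cases "u = v") auto

lemma jacobi_dn_minus: "\<bar>m\<bar> < 1 \<Longrightarrow> jacobi_dn (- u) m = jacobi_dn u m"
  by (simp add: jacobi_dn_def jacobi_am_minus)

lemma jacobi_dn_0: "\<bar>m\<bar> < 1 \<Longrightarrow> jacobi_dn 0 m = 1"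
  by (simp add: jacobi_dn_def)

definition node :: "real \<Rightarrow> nat \<Rightarrow> nat \<Rightarrow> real" where
  "node m k i = (2 * real i + 1) / (2 * real k) * ellK m"

definition zolotarev :: "real \<Rightarrow> nat \<Rightarrow> real \<Rightarrow> real" where
  "zolotarev m k x = (\<Prod>i<k. (x - jacobi_dn (node m k i) m) / (x + jacobi_dn (node m k i) m))"

text \<open>The shifts are the nodes and their negatives. Together they form one equispaced grid of
  step \<open>ellK m / k\<close>, symmetric about 0, that fills one antiperiod
  \<open>2 * ellK m\<close> of \<open>landen_fun\<close>.\<close>

definition shift_prod :: "real \<Rightarrow> nat \<Rightarrow> real \<Rightarrow> real" where
  "shift_prod m k u =
     (\<Prod>i<2 * k. landen_fun m (u + (2 * real i + 1 - 2 * real k) / (2 * real k) * ellK m))"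

section \<open>Products of equispaced shifts\<close>

lemma prod_lessThan_add:
  fixes g :: "nat \<Rightarrow> 'a::comm_monoid_mult"
  shows "(\<Prod>i<k + l. g i) = (\<Prod>i<k. g i) * (\<Prod>i<l. g (k + i))"
  by (induction l) (auto simp: mult.assoc)

lemma prod_lessThan_double:
  fixes g :: "nat \<Rightarrow> 'a::comm_monoid_mult"
  shows "(\<Prod>i<2 * n. g i) = (\<Prod>i<n. g (2 * i) * g (2 * i + 1))"
  by (induction n) (auto simp: mult.assoc)

lemma shift_prod_eq:
  assumes "0 < k"
  shows "shift_prod m k u = (\<Prod>i<k. landen_fun m (u + node m k i) * landen_fun m (u - node m k i))"
proof -
  let ?g = "\<lambda>i. landen_fun m (u + (2 * real i + 1 - 2 * real k) / (2 * real k) * ellK m)"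
  have "shift_prod m k u = (\<Prod>i<k + k. ?g i)" by (simp only: shift_prod_def mult_2[of k])
  also have "\<dots> = (\<Prod>i<k. ?g (k - Suc i)) * (\<Prod>i<k. ?g (k + i))"
    by (simp only: prod_lessThan_add prod.nat_diff_reindex[of ?g k])
  also have "(\<Prod>i<k. ?g (k - Suc i)) = (\<Prod>i<k. landen_fun m (u - node m k i))"
  proof (rule prod.cong[OF refl])
    fix i assume "i \<in> {..<k}"
    then have r: "real (k - Suc i) = real k - real i - 1" by (auto simp: of_nat_diff)
    show "?g (k - Suc i) = landen_fun m (u - node m k i)"
      unfolding r node_def using assms by (simp add: field_simps)
  qed
  also have "(\<Prod>i<k. ?g (k + i)) = (\<Prod>i<k. landen_fun m (u + node m k i))"
    by (rule prod.cong) (auto simp: node_def)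
  finally show ?thesis by (simp add: prod.distrib mult.commute)
qed

lemma zolotarev_dn:
  assumes m: "\<bar>m\<bar> < 1" "m \<noteq> 0" and k: "0 < k"
  shows "\<bar>zolotarev m k (jacobi_dn u m)\<bar> = \<bar>shift_prod m k u\<bar>"
  unfolding zolotarev_def shift_prod_eq[OF k] abs_prod dn_quotient[OF m]
  by (simp add: abs_mult)

text \<open>A translation by one grid step drops the first factor and appends one at distance
  \<open>2 * ellK m\<close> from it, which is its negative.\<close>

lemma shift_prod_period:
  assumes m: "\<bar>m\<bar> < 1" and k: "0 < k"
  shows "\<bar>shift_prod m k (u + ellK m / real k)\<bar> = \<bar>shift_prod m k u\<bar>"
proof -
  let ?g = "\<lambda>i. landen_fun m (u + (2 * real i + 1 - 2 * real k) / (2 * real k) * ellK m)"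
  obtain n where n: "2 * k = Suc n" using k by (cases "2 * k") auto
  have last: "?g (Suc n) = - ?g 0"
  proof -
    have "u + (2 * real (2 * k) + 1 - 2 * real k) / (2 * real k) * ellK m =
       u + (2 * real 0 + 1 - 2 * real k) / (2 * real k) * ellK m + 2 * ellK m"
      using k by (simp add: field_simps)
    then show ?thesis by (simp only: n[symmetric] landen_fun_add[OF m])
  qed
  have "shift_prod m k (u + ellK m / real k) = (\<Prod>i<Suc n. ?g (Suc i))"
    unfolding shift_prod_def n
    by (rule prod.cong[OF refl], rule arg_cong[where f = "landen_fun m"]) (use k in \<open>simp add: field_simps\<close>)
  also have "\<dots> = - (\<Prod>i<Suc n. ?g i)"
    by (simp only: prod.lessThan_Suc[of "\<lambda>i. ?g (Suc i)"] prod.lessThan_Suc_shift[of ?g] last)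
       (simp only: mult_minus_right mult.commute)
  also have "(\<Prod>i<Suc n. ?g i) = shift_prod m k u" by (simp only: shift_prod_def n)
  finally show ?thesis by simp
qed

lemma shift_prod_periods:
  assumes "\<bar>m\<bar> < 1" "0 < k"
  shows "\<bar>shift_prod m k (u + real n * (ellK m / real k))\<bar> = \<bar>shift_prod m k u\<bar>"
proof (induction n)
  case (Suc n)
  have "u + real (Suc n) * (ellK m / real k) = u + real n * (ellK m / real k) + ellK m / real k"
    by (simp add: algebra_simps add_divide_distrib)
  then show ?case using Suc shift_prod_period[OF assms] by metis
qed simp

text \<open>In the variable \<open>F\<^sup>2\<close> each node contributes a Blaschke factor of the
  unit disk. Evenness, the position of the maximum and the value at 0 are read off from this
  form.\<close>

lemma abs_shift_prod:
  assumes m: "\<bar>m\<bar> < 1" "m \<noteq> 0" and k: "0 < k"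
  shows "\<bar>shift_prod m k u\<bar> = (\<Prod>i<k. \<bar>(landen_fun m u)\<^sup>2 - (landen_fun m (node m k i))\<^sup>2\<bar> /
    (1 - (landen_fun m u)\<^sup>2 * (landen_fun m (node m k i))\<^sup>2))"
  unfolding shift_prod_eq[OF k] abs_prod
proof (rule prod.cong[OF refl])
  fix i
  let ?v = "node m k i"
  have d: "0 < 1 - (landen_fun m u)\<^sup>2 * (landen_fun m ?v)\<^sup>2"
    using mult_strict_mono'[OF landen_fun_sq_less_1[OF m(1), of u] landen_fun_sq_less_1[OF m(1), of ?v]]
    by simp
  have "\<bar>landen_fun m (u + ?v) * landen_fun m (u - ?v)\<bar> * (1 - (landen_fun m u)\<^sup>2 * (landen_fun m ?v)\<^sup>2)
     = \<bar>landen_fun m (u + ?v) * landen_fun m (u - ?v) * (1 - (landen_fun m u)\<^sup>2 * (landen_fun m ?v)\<^sup>2)\<bar>"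
    using d by (simp add: abs_mult)
  then show "\<bar>landen_fun m (u + ?v) * landen_fun m (u - ?v)\<bar> =
    \<bar>(landen_fun m u)\<^sup>2 - (landen_fun m ?v)\<^sup>2\<bar> / (1 - (landen_fun m u)\<^sup>2 * (landen_fun m ?v)\<^sup>2)"
    using d landen_fun_product[OF m, of u ?v] by (simp add: eq_divide_eq)
qed

lemma shift_prod_minus:
  assumes "\<bar>m\<bar> < 1" "m \<noteq> 0" "0 < k"
  shows "\<bar>shift_prod m k (- u)\<bar> = \<bar>shift_prod m k u\<bar>"
  by (simp add: abs_shift_prod[OF assms] landen_fun_minus[OF assms(1)])

lemma node_bounds:
  assumes "\<bar>m\<bar> < 1" "i < k"
  shows "ellK m / (2 * real k) \<le> node m k i" "node m k i < ellK m" "0 < node m k i"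
proof -
  have K: "0 < ellK m" using ellK_pos assms by blast
  have k: "0 < real k" using assms by simp
  have i: "2 * real i + 1 < 2 * real k" using assms(2) by linarith
  have "1 / (2 * real k) * ellK m \<le> node m k i"
    unfolding node_def using K k by (intro mult_right_mono divide_right_mono) auto
  then show "ellK m / (2 * real k) \<le> node m k i" by simp
  have "node m k i < 1 * ellK m"
    unfolding node_def using K k i by (intro mult_strict_right_mono) (auto simp: field_simps)
  then show "node m k i < ellK m" by simp
  show "0 < node m k i" unfolding node_def using K k by (intro mult_pos_pos divide_pos_pos add_nonneg_pos) auto
qed

lemma landen_fun_sq_mono:
  assumes m: "\<bar>m\<bar> < 1" "m \<noteq> 0" and u: "\<bar>u\<bar> \<le> v" "v \<le> ellK m"
  shows "(landen_fun m u)\<^sup>2 \<le> (landen_fun m v)\<^sup>2"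
proof -
  have "jacobi_dn v m \<le> jacobi_dn \<bar>u\<bar> m" using jacobi_dn_antimono[OF m, of "\<bar>u\<bar>" v] u by simp
  moreover have "jacobi_dn \<bar>u\<bar> m = jacobi_dn u m" by (cases "0 \<le> u") (auto simp: jacobi_dn_minus m)
  ultimately have *: "jacobi_dn v m \<le> jacobi_dn u m" by simp
  show ?thesis
    unfolding landen_fun_sq[OF m(1)]
    using * jacobi_dn_pos[OF m(1), of v] jacobi_dn_le_1[of u m]
    by (intro frac_le) auto
qed

text \<open>As \<open>y\<close> grows from 0 to \<open>z\<close>, the left-hand side falls from
  \<open>z\<close> to 0.\<close>

lemma blaschke_factor_le:
  fixes y z :: real
  assumes "0 \<le> y" "y \<le> z" "z < 1"
  shows "\<bar>y - z\<bar> / (1 - y * z) \<le> z"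
proof -
  have "y * z \<le> y * 1" using assms by (intro mult_left_mono) auto
  then have d: "0 < 1 - y * z" using assms by simp
  have "z * (y * z) \<le> 1 * y" using \<open>y * z \<le> y * 1\<close> assms by (intro mult_mono) auto
  then have "z - y \<le> z * (1 - y * z)" by (simp add: algebra_simps)
  then show ?thesis using d assms by (simp add: divide_le_eq)
qed

text \<open>Rounding \<open>u\<close> to the nearest multiple of the period leaves a remainder
  \<open>v\<close> with \<open>\<bar>v\<bar>\<close> at most the first node. There
  \<open>F\<^sup>2\<close> is below its values at all nodes, so every Blaschke factor is at most
  what it is at 0.\<close>

lemma shift_prod_max:
  assumes m: "\<bar>m\<bar> < 1" "m \<noteq> 0" and k: "0 < k" and u: "0 \<le> u"
  shows "\<bar>shift_prod m k u\<bar> \<le> \<bar>shift_prod m k 0\<bar>"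
proof -
  define w where "w = ellK m / real k"
  have w: "0 < w" using ellK_pos[OF m(1)] k by (simp add: w_def)
  define n where "n = nat \<lfloor>u / w + 1 / 2\<rfloor>"
  define v where "v = u - real n * w"
  have "0 \<le> u / w" using u w by simp
  then have "real n = of_int \<lfloor>u / w + 1 / 2\<rfloor>" unfolding n_def by (subst of_nat_nat) auto
  then have "\<bar>u / w - real n\<bar> \<le> 1 / 2" by linarith
  then have "\<bar>u / w - real n\<bar> * w \<le> 1 / 2 * w" using w by (intro mult_right_mono) auto
  moreover have "\<bar>u / w - real n\<bar> * w = \<bar>v\<bar>"
    using w by (simp add: v_def abs_mult[symmetric] abs_mult_pos left_diff_distrib)
  ultimately have v: "\<bar>v\<bar> \<le> ellK m / (2 * real k)" by (simp add: w_def)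
  have "\<bar>shift_prod m k u\<bar> = \<bar>shift_prod m k (v + real n * w)\<bar>" by (simp add: v_def)
  also have "\<dots> = \<bar>shift_prod m k v\<bar>" unfolding w_def by (rule shift_prod_periods[OF m(1) k])
  also have "\<dots> \<le> (\<Prod>i<k. (landen_fun m (node m k i))\<^sup>2)"
    unfolding abs_shift_prod[OF m k]
  proof (rule prod_mono, intro conjI)
    fix i assume "i \<in> {..<k}"
    then have i: "i < k" by simp
    have le: "(landen_fun m v)\<^sup>2 \<le> (landen_fun m (node m k i))\<^sup>2"
      using v node_bounds[OF m(1) i] by (intro landen_fun_sq_mono m) auto
    show "\<bar>(landen_fun m v)\<^sup>2 - (landen_fun m (node m k i))\<^sup>2\<bar> /
        (1 - (landen_fun m v)\<^sup>2 * (landen_fun m (node m k i))\<^sup>2) \<le> (landen_fun m (node m k i))\<^sup>2"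
      by (rule blaschke_factor_le) (use le landen_fun_sq_less_1[OF m(1)] in auto)
    have "(landen_fun m v)\<^sup>2 * (landen_fun m (node m k i))\<^sup>2 \<le> 1 * 1"
      by (intro mult_mono) (use landen_fun_sq_less_1[OF m(1)] in \<open>auto intro: less_imp_le\<close>)
    then show "0 \<le> \<bar>(landen_fun m v)\<^sup>2 - (landen_fun m (node m k i))\<^sup>2\<bar> /
        (1 - (landen_fun m v)\<^sup>2 * (landen_fun m (node m k i))\<^sup>2)" by simp
  qed
  also have "\<dots> = \<bar>shift_prod m k 0\<bar>"
    unfolding abs_shift_prod[OF m k] by (simp add: landen_fun_def[of m 0] m)
  finally show ?thesis .
qed

section \<open>Doubling the degree\<close>

lemma shift_prod_double:
  assumes k: "0 < k"
  shows "shift_prod m (2 * k) u =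
    shift_prod m k (u - ellK m / (4 * real k)) * shift_prod m k (u + ellK m / (4 * real k))"
proof -
  have "shift_prod m (2 * k) u = (\<Prod>i<2 * k.
      landen_fun m (u + (2 * real (2 * i) + 1 - 2 * real (2 * k)) / (2 * real (2 * k)) * ellK m) *
      landen_fun m (u + (2 * real (2 * i + 1) + 1 - 2 * real (2 * k)) / (2 * real (2 * k)) * ellK m))"
    unfolding shift_prod_def by (rule prod_lessThan_double)
  also have "\<dots> = (\<Prod>i<2 * k.
      landen_fun m (u - ellK m / (4 * real k) + (2 * real i + 1 - 2 * real k) / (2 * real k) * ellK m) *
      landen_fun m (u + ellK m / (4 * real k) + (2 * real i + 1 - 2 * real k) / (2 * real k) * ellK m))"
  proof (rule prod.cong[OF refl])
    fix i
    have 1: "u + (2 * real (2 * i) + 1 - 2 * real (2 * k)) / (2 * real (2 * k)) * ellK m =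
      u - ellK m / (4 * real k) + (2 * real i + 1 - 2 * real k) / (2 * real k) * ellK m"
      using k by (simp add: field_simps)
    have 2: "u + (2 * real (2 * i + 1) + 1 - 2 * real (2 * k)) / (2 * real (2 * k)) * ellK m =
      u + ellK m / (4 * real k) + (2 * real i + 1 - 2 * real k) / (2 * real k) * ellK m"
      using k by (simp add: field_simps)
    show "landen_fun m (u + (2 * real (2 * i) + 1 - 2 * real (2 * k)) / (2 * real (2 * k)) * ellK m) *
      landen_fun m (u + (2 * real (2 * i + 1) + 1 - 2 * real (2 * k)) / (2 * real (2 * k)) * ellK m) =
      landen_fun m (u - ellK m / (4 * real k) + (2 * real i + 1 - 2 * real k) / (2 * real k) * ellK m) *
      landen_fun m (u + ellK m / (4 * real k) + (2 * real i + 1 - 2 * real k) / (2 * real k) * ellK m)"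
      by (simp only: 1 2)
  qed
  also have "\<dots> = shift_prod m k (u - ellK m / (4 * real k)) * shift_prod m k (u + ellK m / (4 * real k))"
    by (simp add: shift_prod_def prod.distrib)
  finally show ?thesis .
qed

text \<open>Modulo the period \<open>ellK m / k\<close>, every node of degree \<open>2 * k\<close>
  is a quarter period to the right or to the left of 0, according to the parity of \<open>j\<close>.
  At 0 the doubling identity multiplies the values at these two points.\<close>

lemma shift_prod_double_node:
  assumes m: "\<bar>m\<bar> < 1" "m \<noteq> 0" and k: "0 < k"
  shows "(shift_prod m k (node m (2 * k) j))\<^sup>2 = \<bar>shift_prod m (2 * k) 0\<bar>"
proof -
  let ?q = "ellK m / (4 * real k)"
  have H: "\<bar>shift_prod m (2 * k) 0\<bar> = (shift_prod m k ?q)\<^sup>2"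
    using shift_prod_double[OF k, of m 0] shift_prod_minus[OF m k, of ?q]
    by (simp add: abs_mult power2_eq_square)
  have "\<bar>shift_prod m k (node m (2 * k) j)\<bar> = \<bar>shift_prod m k ?q\<bar>"
  proof (cases "even j")
    case True
    then obtain l where "j = 2 * l" by blast
    then have "node m (2 * k) j = ?q + real l * (ellK m / real k)"
      using k by (simp add: node_def field_simps)
    then show ?thesis using shift_prod_periods[OF m(1) k] by simp
  next
    case False
    then obtain l where "j = 2 * l + 1" using oddE by blast
    then have "node m (2 * k) j = - ?q + real (Suc l) * (ellK m / real k)"
      using k by (simp add: node_def field_simps)
    then show ?thesis by (simp only: shift_prod_periods[OF m(1) k] shift_prod_minus[OF m k])
  qed
  then show ?thesis using H by (metis power2_abs)
qed

lemma dn_node_inj: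
  assumes m: "\<bar>m\<bar> < 1" "m \<noteq> 0"
  shows "inj_on (\<lambda>i. jacobi_dn (node m k i) m) {..<k}"
proof (rule linorder_inj_onI')
  fix i j assume ij: "i \<in> {..<k}" "j \<in> {..<k}" "i < j"
  have "node m k i < node m k j"
    unfolding node_def using ij ellK_pos[OF m(1)]
    by (intro mult_strict_right_mono divide_strict_right_mono) auto
  then have "jacobi_dn (node m k j) m < jacobi_dn (node m k i) m"
    using node_bounds[OF m(1)] ij by (intro jacobi_dn_strict_antimono m) (auto intro: less_imp_le)
  then show "jacobi_dn (node m k i) m \<noteq> jacobi_dn (node m k j) m" by simp
qed

lemma degree_prod_linear:
  fixes f :: "nat \<Rightarrow> 'a::idom"
  shows "degree (\<Prod>i<n. [:f i, 1:]) = n" "lead_coeff (\<Prod>i<n. [:f i, 1:]) = 1"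
  by (simp add: degree_prod_sum_eq) (simp add: lead_coeff_prod)

lemma shift_prod_0_pos_less_1:
  assumes m: "\<bar>m\<bar> < 1" "m \<noteq> 0" and k: "0 < k"
  shows "0 < \<bar>shift_prod m k 0\<bar>" "\<bar>shift_prod m k 0\<bar> < 1"
proof -
  have eq: "\<bar>shift_prod m k 0\<bar> = (\<Prod>i<k. (landen_fun m (node m k i))\<^sup>2)"
    unfolding abs_shift_prod[OF m k] by (simp add: landen_fun_def[of m 0] m)
  have pos: "0 < (landen_fun m (node m k i))\<^sup>2" if "i < k" for i
    using jacobi_dn_strict_antimono[OF m, of 0 "node m k i"] node_bounds[OF m(1) that]
      jacobi_dn_0[OF m(1)] jacobi_dn_pos[OF m(1), of "node m k i"]
    by (simp add: landen_fun_sq[OF m(1)] del: zero_less_power2)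
  show "0 < \<bar>shift_prod m k 0\<bar>" unfolding eq by (rule prod_pos) (use pos in auto)
  have "(\<Prod>i<k. (landen_fun m (node m k i))\<^sup>2) < (\<Prod>i<k. 1)"
    by (rule prod_mono_strict[of 0]) (use k landen_fun_sq_less_1[OF m(1)] pos in \<open>auto intro: less_imp_le\<close>)
  then show "\<bar>shift_prod m k 0\<bar> < 1" by (simp add: eq)
qed

text \<open>With \<open>h\<close> the Zolotarev function of degree \<open>k\<close> and \<open>H\<close> the common value of \<open>h\<^sup>2\<close> at the nodes of
  degree \<open>2 k\<close>, the Zolotarev function of degree \<open>2 k\<close> is \<open>(h\<^sup>2 - H) / (1 - H h\<^sup>2)\<close>, and both have
  supremum \<open>H\<close>; evaluating at \<open>1\<close> gives \<open>M\<^sup>2 (1 + H\<^sup>2) = 2 H\<close> for the maximum \<open>M\<close> of \<open>h\<close>.\<close>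

lemma shift_prod_sq_le_double:
  assumes m: "\<bar>m\<bar> < 1" "m \<noteq> 0" and k: "0 < k"
  shows "(shift_prod m k 0)\<^sup>2 \<le> 2 * \<bar>shift_prod m (2 * k) 0\<bar>"
proof -
  define d where "d = (\<lambda>k i. jacobi_dn (node m k i) m)"
  define H where "H = \<bar>shift_prod m (2 * k) 0\<bar>"
  have H: "0 < H" "H < 1" using shift_prod_0_pos_less_1[OF m, of "2 * k"] k by (auto simp: H_def)
  have dpos: "0 < d l i" for l i unfolding d_def by (rule jacobi_dn_pos[OF m(1)])
  define p q r r' where "p = (\<Prod>i<k. [:- d k i, 1:])" and "q = (\<Prod>i<k. [:d k i, 1:])"
    and "r = (\<Prod>i<2 * k. [:- d (2 * k) i, 1:])" and "r' = (\<Prod>i<2 * k. [:d (2 * k) i, 1:])"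
  have qpos: "0 < poly q x" if "0 \<le> x" for x
    unfolding q_def poly_prod by (rule prod_pos) (use dpos that in \<open>auto intro: add_pos_nonneg\<close>)
  have z: "zolotarev m k x = poly p x / poly q x" for x
    by (simp add: zolotarev_def p_def q_def poly_prod prod_dividef d_def add.commute)
  have z2: "zolotarev m (2 * k) x = poly r x / poly r' x" for x
    by (simp add: zolotarev_def r_def r'_def poly_prod prod_dividef d_def add.commute)
  have deg: "degree p = k" "degree q = k" "degree r = 2 * k"
    and lc: "lead_coeff p = 1" "lead_coeff q = 1" "lead_coeff r = 1"
    unfolding p_def q_def r_def by (rule degree_prod_linear)+
  \<comment> \<open>Both sides have degree at most \<open>2 * k\<close> and coefficient
    \<open>1 - H\<close> there, and they agree at the \<open>2 * k\<close> distinct zeros of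
    \<open>r\<close>, because \<open>(p / q)\<^sup>2 = H\<close> at these points.\<close>
  have id: "p\<^sup>2 - smult H (q\<^sup>2) = smult (1 - H) r"
  proof (rule poly_eqI_degree_lead_coeff[where n = "2 * k" and A = "d (2 * k) ` {..<2 * k}"])
    have "p \<noteq> 0" "q \<noteq> 0" using lc by auto
    then have "degree (p\<^sup>2) = 2 * k" "degree (q\<^sup>2) = 2 * k" by (simp_all add: degree_power_eq deg)
    then have "coeff (p\<^sup>2) (2 * k) = 1" "coeff (q\<^sup>2) (2 * k) = 1"
      using lead_coeff_power[of p 2] lead_coeff_power[of q 2] lc by simp_all
    then show "coeff (p\<^sup>2 - smult H (q\<^sup>2)) (2 * k) = coeff (smult (1 - H) r) (2 * k)"
      using lc deg by simp
    show "2 * k \<le> card (d (2 * k) ` {..<2 * k})"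
      using card_image[OF dn_node_inj[OF m, of "2 * k"]] by (simp add: d_def)
    have "degree (p\<^sup>2) \<le> 2 * k" "degree (q\<^sup>2) \<le> 2 * k"
      using degree_power_le[of p 2] degree_power_le[of q 2] deg by (simp_all add: mult.commute)
    then show "degree (p\<^sup>2 - smult H (q\<^sup>2)) \<le> 2 * k"
      by (intro degree_diff_le order.trans[OF degree_smult_le])
    show "degree (smult (1 - H) r) \<le> 2 * k" using deg by (intro order.trans[OF degree_smult_le]) simp
    fix x assume "x \<in> d (2 * k) ` {..<2 * k}"
    then obtain j where j: "j < 2 * k" "x = d (2 * k) j" by auto
    have "\<bar>zolotarev m k x\<bar>\<^sup>2 = H"
      using zolotarev_dn[OF m k, of "node m (2 * k) j"] shift_prod_double_node[OF m k, of j]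
      by (simp add: j d_def H_def)
    then have "(poly p x)\<^sup>2 = H * (poly q x)\<^sup>2"
      using qpos[of x] dpos[of "2 * k" j] by (simp add: z j power_divide divide_simps)
    moreover have "poly r x = 0" using j by (auto simp: r_def poly_prod)
    ultimately show "poly (p\<^sup>2 - smult H (q\<^sup>2)) x = poly (smult (1 - H) r) x" by simp
  qed
  \<comment> \<open>Reflection exchanges numerators and denominators up to sign, so evaluating
    \<open>id\<close> at \<open>- 1\<close> gives the counterpart for the denominator
    \<open>r'\<close> at 1.\<close>
  have minus: "(poly p (- 1))\<^sup>2 = (poly q 1)\<^sup>2" "(poly q (- 1))\<^sup>2 = (poly p 1)\<^sup>2" "poly r (- 1) = poly r' 1"
  proof -
    have "\<bar>poly p (- 1)\<bar> = \<bar>poly q 1\<bar>" "\<bar>poly q (- 1)\<bar> = \<bar>poly p 1\<bar>"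
      unfolding p_def q_def poly_prod abs_prod by (auto intro!: prod.cong)
    then show "(poly p (- 1))\<^sup>2 = (poly q 1)\<^sup>2" "(poly q (- 1))\<^sup>2 = (poly p 1)\<^sup>2"
      by (metis power2_abs)+
    have "poly r (- 1) = (\<Prod>i<2 * k. (- 1) * (1 + d (2 * k) i))"
      unfolding r_def poly_prod by (intro prod.cong) auto
    also have "\<dots> = poly r' 1"
      unfolding prod.distrib r'_def poly_prod by (simp add: add.commute)
    finally show "poly r (- 1) = poly r' 1" .
  qed
  have r'pos: "0 < poly r' 1"
    unfolding r'_def poly_prod by (rule prod_pos) (use dpos in \<open>auto intro: add_pos_nonneg\<close>)
  define P Q where "P = (poly p 1)\<^sup>2" and "Q = (poly q 1)\<^sup>2"
  have Q: "0 < Q" using qpos[of 1] by (simp add: Q_def)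
  have P0: "0 \<le> P" by (simp add: P_def)
  have e1: "P - H * Q = (1 - H) * poly r 1"
    using arg_cong[OF id, of "\<lambda>p. poly p 1"] by (simp add: P_def Q_def)
  have e2: "Q - H * P = (1 - H) * poly r' 1"
    using arg_cong[OF id, of "\<lambda>p. poly p (- 1)"] minus by (simp add: P_def Q_def)
  have "\<bar>poly r 1 / poly r' 1\<bar> = H"
    using zolotarev_dn[OF m, of "2 * k" 0] k jacobi_dn_0[OF m(1)] by (simp add: z2[symmetric] H_def)
  then have "\<bar>poly r 1\<bar> = H * poly r' 1" using r'pos by (simp add: field_simps)
  then have "\<bar>(1 - H) * poly r 1\<bar> = H * ((1 - H) * poly r' 1)" using H by (simp add: abs_mult)
  then have "P - H * Q \<le> H * (Q - H * P)" by (simp only: e1[symmetric] e2[symmetric])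
  also have "\<dots> \<le> H * Q" using H P0 by (intro mult_left_mono) auto
  finally have "P / Q \<le> 2 * H" using Q by (simp add: divide_le_eq)
  moreover have "(shift_prod m k 0)\<^sup>2 = P / Q"
  proof -
    have "\<bar>shift_prod m k 0\<bar> = \<bar>poly p 1 / poly q 1\<bar>"
      using zolotarev_dn[OF m k, of 0] jacobi_dn_0[OF m(1)] by (simp add: z)
    then show ?thesis by (metis P_def Q_def power2_abs power_divide)
  qed
  ultimately show ?thesis by (simp add: H_def)
qed

subsection \<open>The logarithmic integral of dn\<close>

lemma has_integral_real_deriv:
  fixes f :: "real \<Rightarrow> real"
  assumes "a \<le> b" "\<And>x. a \<le> x \<Longrightarrow> x \<le> b \<Longrightarrow> (f has_real_derivative f' x) (at x)"
  shows "(f' has_integral f b - f a) {a..b}"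
  by (rule fundamental_theorem_of_calculus)
     (use assms in \<open>auto simp flip: has_real_derivative_iff_has_vector_derivative
       intro: has_field_derivative_at_within\<close>)

lemma cos_sin_form_pos:
  fixes a b :: real
  assumes "0 < a" "0 < b"
  shows "0 < a * (cos x)\<^sup>2 + b * (sin x)\<^sup>2"
proof (cases "sin x = 0")
  case True
  then have "(cos x)\<^sup>2 = 1" using sin_cos_squared_add[of x] by simp
  then show ?thesis using True assms by simp
next
  case False
  then have "0 < b * (sin x)\<^sup>2" using assms by simp
  moreover have "0 \<le> a * (cos x)\<^sup>2" using assms by simp
  ultimately show ?thesis by linarith
qed

text \<open>A smooth form of \<open>arctan (b / a * tan x)\<close>, which continues through the poles of the tangent.\<close>

definition scaled_angle :: "real \<Rightarrow> real \<Rightarrow> real \<Rightarrow> real" where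
  "scaled_angle a b x = x - arctan ((a - b) * sin x * cos x / (a * (cos x)\<^sup>2 + b * (sin x)\<^sup>2))"

text \<open>Gives the hypotenuse for the arctangent in \<open>scaled_angle\<close>, needed for its
  derivative and for its cosine and sine.\<close>

lemma cos_sin_form_sq:
  fixes a b :: real
  shows "(a * (cos x)\<^sup>2 + b * (sin x)\<^sup>2)\<^sup>2 + ((a - b) * sin x * cos x)\<^sup>2
    = a\<^sup>2 * (cos x)\<^sup>2 + b\<^sup>2 * (sin x)\<^sup>2"
proof -
  define C S where "C = (cos x)\<^sup>2" and "S = (sin x)\<^sup>2"
  have CS: "C = 1 - S" by (simp add: C_def S_def cos_squared_eq)
  have "(a * C + b * S)\<^sup>2 + (a - b)\<^sup>2 * S * C = a\<^sup>2 * C + b\<^sup>2 * S"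
    unfolding CS by algebra
  then show ?thesis by (simp add: C_def S_def power_mult_distrib)
qed

lemma scaled_angle_deriv:
  assumes ab: "0 < a" "0 < b"
  shows "(scaled_angle a b has_real_derivative
    a * b / (a\<^sup>2 * (cos x)\<^sup>2 + b\<^sup>2 * (sin x)\<^sup>2)) (at x)"
proof -
  define C S where "C = cos x" and "S = sin x"
  define D E where "D = a * C\<^sup>2 + b * S\<^sup>2" and "E = a\<^sup>2 * C\<^sup>2 + b\<^sup>2 * S\<^sup>2"
  have D: "0 < D" using cos_sin_form_pos[OF ab] by (simp add: D_def C_def S_def)
  have E: "0 < E" using cos_sin_form_pos[of "a\<^sup>2" "b\<^sup>2"] ab by (simp add: E_def C_def S_def)
  have DE: "D\<^sup>2 + ((a - b) * S * C)\<^sup>2 = E" using cos_sin_form_sq by (simp add: D_def E_def C_def S_def)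
  have CS: "C\<^sup>2 = 1 - S\<^sup>2" by (simp add: C_def S_def cos_squared_eq)
  have "((\<lambda>x. (a - b) * sin x * cos x / (a * (cos x)\<^sup>2 + b * (sin x)\<^sup>2)) has_real_derivative
     (((a - b) * C * C - (a - b) * S * S) * D - (a - b) * S * C * (a * (2 * C * (- S)) + b * (2 * S * C))) / (D * D)) (at x)"
    by (rule derivative_eq_intros refl)+ (use D in \<open>simp add: D_def C_def S_def\<close>, simp add: D_def C_def S_def, algebra)
  also have "(((a - b) * C * C - (a - b) * S * S) * D - (a - b) * S * C * (a * (2 * C * (- S)) + b * (2 * S * C)))
     = (a - b) * (C\<^sup>2 + S\<^sup>2) * (a * C\<^sup>2 - b * S\<^sup>2)"
    unfolding D_def by algebra
  also have "\<dots> = (a - b) * (a * C\<^sup>2 - b * S\<^sup>2)" by (simp add: CS)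
  finally have w: "((\<lambda>x. (a - b) * sin x * cos x / (a * (cos x)\<^sup>2 + b * (sin x)\<^sup>2)) has_real_derivative
     (a - b) * (a * C\<^sup>2 - b * S\<^sup>2) / (D * D)) (at x)" .
  have "1 + ((a - b) * S * C / D)\<^sup>2 = E / D\<^sup>2"
    using DE D by (simp add: power_divide divide_simps add.commute)
  then have "inverse (1 + ((a - b) * sin x * cos x / (a * (cos x)\<^sup>2 + b * (sin x)\<^sup>2))\<^sup>2) = D\<^sup>2 / E"
    by (simp add: D_def C_def S_def)
  from DERIV_chain'[OF w DERIV_arctan, unfolded this]
  have "((\<lambda>x. arctan ((a - b) * sin x * cos x / (a * (cos x)\<^sup>2 + b * (sin x)\<^sup>2))) has_real_derivative
     (a - b) * (a * C\<^sup>2 - b * S\<^sup>2) / E) (at x)"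
    using D by (simp add: power2_eq_square)
  then have "(scaled_angle a b has_real_derivative 1 - (a - b) * (a * C\<^sup>2 - b * S\<^sup>2) / E) (at x)"
    unfolding scaled_angle_def[abs_def] by (intro DERIV_diff DERIV_ident)
  moreover have "E - (a - b) * (a * C\<^sup>2 - b * S\<^sup>2) = a * b"
    unfolding E_def CS by algebra
  then have "1 - (a - b) * (a * C\<^sup>2 - b * S\<^sup>2) / E = a * b / E"
    using E by (simp add: field_simps)
  ultimately show ?thesis by (simp add: E_def C_def S_def)
qed

lemma scaled_angle_pi_half: "scaled_angle a b (pi / 2) = pi / 2" "scaled_angle a b 0 = 0"
  by (simp_all add: scaled_angle_def)

lemma has_integral_cos_sin_form:
  assumes ab: "0 < a" "0 < b"
  shows "((\<lambda>x. 1 / (a\<^sup>2 * (cos x)\<^sup>2 + b\<^sup>2 * (sin x)\<^sup>2)) has_integral pi / (2 * a * b)) {0..pi / 2}"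
proof -
  have "((\<lambda>x. 1 / (a * b) * (a * b / (a\<^sup>2 * (cos x)\<^sup>2 + b\<^sup>2 * (sin x)\<^sup>2))) has_integral
     1 / (a * b) * (scaled_angle a b (pi / 2) - scaled_angle a b 0)) {0..pi / 2}"
    by (intro has_integral_mult_right has_integral_real_deriv scaled_angle_deriv ab) simp
  then show ?thesis using ab by (simp add: scaled_angle_pi_half mult_ac)
qed

text \<open>This is the artanh integral in an angular variable. For \<open>x = dn\<close> its
  denominator is a quadratic form in the cosine and sine of the amplitude, so that integrating over
  the amplitude first becomes elementary.\<close>

lemma has_integral_log_quotient:
  assumes x: "0 < x" "x \<le> 1" and \<alpha>: "0 \<le> \<alpha>" "\<alpha> < pi / 2"
  shows "((\<lambda>\<psi>. 2 * cos \<psi> / (1 - x\<^sup>2 * (sin \<psi>)\<^sup>2)) has_integral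
    ln ((1 + x * sin \<alpha>) / (1 - x * sin \<alpha>)) / x) {0..\<alpha>}"
proof -
  have s: "0 \<le> x * sin \<psi> \<and> x * sin \<psi> < 1" if "0 \<le> \<psi>" "\<psi> \<le> \<alpha>" for \<psi>
  proof -
    have "0 \<le> sin \<psi>" using that \<alpha> by (intro sin_ge_zero) auto
    moreover have "sin \<psi> < sin (pi / 2)" using that \<alpha> by (subst sin_mono_less_eq) auto
    ultimately show ?thesis using x mult_le_less_imp_less[of x 1 "sin \<psi>" 1] by auto
  qed
  have "((\<lambda>\<psi>. (ln (1 + x * sin \<psi>) - ln (1 - x * sin \<psi>)) / x) has_real_derivative
      2 * cos \<psi> / (1 - x\<^sup>2 * (sin \<psi>)\<^sup>2)) (at \<psi>)" if "0 \<le> \<psi>" "\<psi> \<le> \<alpha>" for \<psi>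
  proof -
    have p: "0 < 1 + x * sin \<psi>" "0 < 1 - x * sin \<psi>" using s[OF that] by auto
    have *: "1 - x\<^sup>2 * (sin \<psi>)\<^sup>2 = (1 + x * sin \<psi>) * (1 - x * sin \<psi>)" by algebra
    have "((\<lambda>\<psi>. 1 + x * sin \<psi>) has_real_derivative x * cos \<psi>) (at \<psi>)"
      "((\<lambda>\<psi>. 1 - x * sin \<psi>) has_real_derivative - (x * cos \<psi>)) (at \<psi>)"
      by (auto intro!: derivative_eq_intros)
    note d = DERIV_chain'[OF this(1) DERIV_ln_divide[OF p(1)]] DERIV_chain'[OF this(2) DERIV_ln_divide[OF p(2)]]
    have "(1 / (1 + x * sin \<psi>) * (x * cos \<psi>) - 1 / (1 - x * sin \<psi>) * - (x * cos \<psi>)) / x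
        = 2 * cos \<psi> / ((1 + x * sin \<psi>) * (1 - x * sin \<psi>))"
      using p x by (simp add: divide_simps) (simp add: algebra_simps)
    with DERIV_cdivide[OF DERIV_diff[OF d], of x] show ?thesis unfolding * by simp
  qed
  then have "((\<lambda>\<psi>. 2 * cos \<psi> / (1 - x\<^sup>2 * (sin \<psi>)\<^sup>2)) has_integral
     (ln (1 + x * sin \<alpha>) - ln (1 - x * sin \<alpha>)) / x - (ln (1 + x * sin 0) - ln (1 - x * sin 0)) / x) {0..\<alpha>}"
    using \<alpha> by (intro has_integral_real_deriv)
  then show ?thesis using s[of \<alpha>] \<alpha> by (simp add: ln_div)
qed

lemma jacobi_dn_ellF: "\<bar>m\<bar> < 1 \<Longrightarrow> jacobi_dn (ellF \<phi> m) m = sqrt (1 - m\<^sup>2 * (sin \<phi>)\<^sup>2)"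
  by (simp add: jacobi_dn_def jacobi_am_ellF)

lemma jacobi_dn_continuous_on: "\<bar>m\<bar> < 1 \<Longrightarrow> continuous_on X (\<lambda>u. jacobi_dn u m)"
  by (intro continuous_at_imp_continuous_on ballI DERIV_isCont[OF jacobi_dn_deriv])

text \<open>The factor \<open>sin \<alpha>\<close> keeps the logarithm finite at
  \<open>u = 0\<close>, so the exchange of integrations concerns a continuous function on a
  rectangle. As \<open>\<alpha>\<close> tends to \<open>pi / 2\<close> the right-hand side becomes
  \<open>pi\<close> times the complete integral of the complementary modulus.\<close>

lemma has_integral_log_dn:
  assumes m: "0 < m" "m < 1" and \<alpha>: "0 \<le> \<alpha>" "\<alpha> < pi / 2"
  defines "f \<equiv> \<lambda>u. ln ((1 + jacobi_dn u m * sin \<alpha>) / (1 - jacobi_dn u m * sin \<alpha>))"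
  shows "(f has_integral pi * ellF \<alpha> (sqrt (1 - m\<^sup>2))) {0..ellK m}"
proof -
  have m1: "\<bar>m\<bar> < 1" using m by simp
  define \<delta> where "\<delta> = sqrt (1 - m\<^sup>2)"
  have m2: "m\<^sup>2 < 1" using m by (simp add: abs_square_less_1)
  have \<delta>2: "\<delta>\<^sup>2 = 1 - m\<^sup>2" using m2 by (simp add: \<delta>_def)
  have \<delta>: "\<bar>\<delta>\<bar> < 1" using m m2 by (simp add: \<delta>_def)
  define x where "x = (\<lambda>\<theta>. sqrt (1 - m\<^sup>2 * (sin \<theta>)\<^sup>2))"
  have x: "0 < x \<theta>" "x \<theta> \<le> 1" "(x \<theta>)\<^sup>2 = 1 - m\<^sup>2 * (sin \<theta>)\<^sup>2" for \<theta>
    using ell_arg_pos[OF m1, of \<theta>] by (auto simp: x_def)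
  have s: "0 \<le> sin \<psi>" "sin \<psi> < 1" "0 < cos \<psi>" if "0 \<le> \<psi>" "\<psi> \<le> \<alpha>" for \<psi>
  proof -
    show "0 \<le> sin \<psi>" using that \<alpha> by (intro sin_ge_zero) auto
    have "sin \<psi> < sin (pi / 2)" using that \<alpha> by (subst sin_mono_less_eq) auto
    then show "sin \<psi> < 1" by simp
    show "0 < cos \<psi>" using that \<alpha> by (intro cos_gt_zero_pi) auto
  qed
  have dns: "0 \<le> jacobi_dn u m * sin \<alpha>" "jacobi_dn u m * sin \<alpha> < 1" for u
  proof -
    show "0 \<le> jacobi_dn u m * sin \<alpha>" using s[of \<alpha>] \<alpha> jacobi_dn_pos[OF m1, of u] by simp
    have "jacobi_dn u m * sin \<alpha> \<le> 1 * sin \<alpha>"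
      using s[of \<alpha>] \<alpha> jacobi_dn_le_1[of u m] by (intro mult_right_mono) auto
    then show "jacobi_dn u m * sin \<alpha> < 1" using s[of \<alpha>] \<alpha> by simp
  qed
  have fcont: "continuous_on X f" for X
    unfolding f_def using dns
    by (intro continuous_intros jacobi_dn_continuous_on m1)
       (auto simp: less_imp_neq[symmetric] add_nonneg_pos intro!: divide_pos_pos less_imp_neq[symmetric] add_pos_nonneg)
  \<comment> \<open>Substituting the amplitude \<open>\<theta>\<close> for \<open>u\<close> turns
    \<open>dn\<close> into \<open>x \<theta>\<close>; the Jacobian \<open>1 / x \<theta>\<close> is
    the divisor in \<open>has_integral_log_quotient\<close>.\<close>
  have "((\<lambda>\<theta>. (1 / x \<theta>) *\<^sub>R f (ellF \<theta> m)) has_integral (integral {ellF 0 m..ellF (pi / 2) m} f)) {0..pi / 2}"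
  proof (rule has_integral_substitution[where c = 0 and d = "ellK m"])
    show "ellF 0 m \<le> ellF (pi / 2) m" using ellK_pos[OF m1] by (simp add: ellK_def)
    show "(\<lambda>\<phi>. ellF \<phi> m) ` {0..pi / 2} \<subseteq> {0..ellK m}"
      using strict_mono_less_eq[OF ellF_strict_mono[OF m1], of 0]
        strict_mono_less_eq[OF ellF_strict_mono[OF m1], of _ "pi / 2"] by (auto simp: ellK_def)
    show "((\<lambda>\<phi>. ellF \<phi> m) has_real_derivative 1 / x \<theta>) (at \<theta> within {0..pi / 2})" for \<theta>
      unfolding x_def by (rule has_field_derivative_at_within[OF ellF_deriv[OF m1]])
  qed (auto intro: fcont)
  then have "integral {0..ellK m} f = integral {0..pi / 2} (\<lambda>\<theta>. 1 / x \<theta> * f (ellF \<theta> m))"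
    by (simp add: ellK_def integral_unique)
  also have "\<dots> = integral {0..pi / 2} (\<lambda>\<theta>. integral {0..\<alpha>} (\<lambda>\<psi>. 2 * cos \<psi> / (1 - (x \<theta>)\<^sup>2 * (sin \<psi>)\<^sup>2)))"
  proof (rule integral_cong)
    fix \<theta>
    have "jacobi_dn (ellF \<theta> m) m = x \<theta>" by (simp add: jacobi_dn_ellF m1 x_def)
    then show "1 / x \<theta> * f (ellF \<theta> m) = integral {0..\<alpha>} (\<lambda>\<psi>. 2 * cos \<psi> / (1 - (x \<theta>)\<^sup>2 * (sin \<psi>)\<^sup>2))"
      by (simp add: f_def integral_unique[OF has_integral_log_quotient[OF x(1,2) \<alpha>]])
  qed
  also have "\<dots> = integral {0..\<alpha>} (\<lambda>\<psi>. integral {0..pi / 2} (\<lambda>\<theta>. 2 * cos \<psi> / (1 - (x \<theta>)\<^sup>2 * (sin \<psi>)\<^sup>2)))"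
  proof -
    have "(x (fst p))\<^sup>2 * (sin (snd p))\<^sup>2 \<noteq> 1" if "p \<in> cbox (0, 0) (pi / 2, \<alpha>)" for p
    proof -
      have "0 \<le> snd p" "snd p \<le> \<alpha>" using that by (auto simp: mem_box Basis_prod_def cbox_Pair_eq)
      then have "0 \<le> sin (snd p)" "sin (snd p) < 1" using s by blast+
      then have "(sin (snd p))\<^sup>2 < 1" by (simp add: abs_square_less_1)
      moreover have "(x (fst p))\<^sup>2 * (sin (snd p))\<^sup>2 \<le> 1 * (sin (snd p))\<^sup>2"
        using x[of "fst p"] by (intro mult_right_mono) (auto simp: abs_square_le_1)
      ultimately show ?thesis by linarith
    qed
    then have "continuous_on (cbox (0, 0) (pi / 2, \<alpha>)) (\<lambda>p. 2 * cos (snd p) / (1 - (x (fst p))\<^sup>2 * (sin (snd p))\<^sup>2))"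
      unfolding x_def by (intro continuous_intros) (auto simp: x_def)
    then show ?thesis
      using integral_swap_continuous[of 0 0 "pi / 2" \<alpha> "\<lambda>\<theta> \<psi>. 2 * cos \<psi> / (1 - (x \<theta>)\<^sup>2 * (sin \<psi>)\<^sup>2)"]
      by (simp add: case_prod_unfold)
  qed
  also have "\<dots> = integral {0..\<alpha>} (\<lambda>\<psi>. pi * (1 / sqrt (1 - \<delta>\<^sup>2 * (sin \<psi>)\<^sup>2)))"
  proof (rule integral_cong)
    fix \<psi> assume \<psi>: "\<psi> \<in> {0..\<alpha>}"
    define a b where "a = cos \<psi>" and "b = sqrt (1 - \<delta>\<^sup>2 * (sin \<psi>)\<^sup>2)"
    have a: "0 < a" using s \<psi> by (simp add: a_def)
    have b: "0 < b" using ell_arg_pos[OF \<delta>] by (simp add: b_def)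
    have b2: "b\<^sup>2 = 1 - \<delta>\<^sup>2 * (sin \<psi>)\<^sup>2" using ell_arg_pos[OF \<delta>, of \<psi>] by (simp add: b_def)
    \<comment> \<open>The integral of the reciprocal is \<open>pi / (2 * a * b)\<close>. The
      numerator \<open>2 * cos \<psi>\<close> cancels \<open>2 * a\<close> and leaves
      \<open>pi / b\<close>, where \<open>1 / b\<close> is the integrand of \<open>ellF\<close> for
      the complementary modulus.\<close>
    have *: "1 - (x \<theta>)\<^sup>2 * (sin \<psi>)\<^sup>2 = a\<^sup>2 * (cos \<theta>)\<^sup>2 + b\<^sup>2 * (sin \<theta>)\<^sup>2" for \<theta>
      unfolding x(3) b2 \<delta>2 a_def cos_squared_eq by algebra
    have "((\<lambda>\<theta>. 2 * a * (1 / (a\<^sup>2 * (cos \<theta>)\<^sup>2 + b\<^sup>2 * (sin \<theta>)\<^sup>2))) has_integral 2 * a * (pi / (2 * a * b))) {0..pi / 2}"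
      by (intro has_integral_mult_right has_integral_cos_sin_form a b)
    then have "integral {0..pi / 2} (\<lambda>\<theta>. 2 * a / (a\<^sup>2 * (cos \<theta>)\<^sup>2 + b\<^sup>2 * (sin \<theta>)\<^sup>2)) = pi * (1 / b)"
      using a by (simp add: integral_unique)
    then show "integral {0..pi / 2} (\<lambda>\<theta>. 2 * cos \<psi> / (1 - (x \<theta>)\<^sup>2 * (sin \<psi>)\<^sup>2)) = pi * (1 / sqrt (1 - \<delta>\<^sup>2 * (sin \<psi>)\<^sup>2))"
      by (simp only: * a_def[symmetric] b_def[symmetric])
  qed
  also have "\<dots> = pi * ellF \<alpha> \<delta>"
  proof -
    have "((\<lambda>\<psi>. 1 / sqrt (1 - \<delta>\<^sup>2 * (sin \<psi>)\<^sup>2)) has_integral ellF \<alpha> \<delta> - ellF 0 \<delta>) {0..\<alpha>}"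
      by (intro has_integral_real_deriv ellF_deriv \<delta> \<alpha>)
    from has_integral_mult_right[OF this, of pi] show ?thesis by (simp add: integral_unique)
  qed
  finally have "integral {0..ellK m} f = pi * ellF \<alpha> \<delta>" .
  moreover have "f integrable_on {0..ellK m}" by (rule integrable_continuous_interval[OF fcont])
  ultimately show ?thesis unfolding \<delta>_def by (metis integrable_integral)
qed

text \<open>The left-endpoint sum bounds the integral of a decreasing function. Every left endpoint
  but the first lies beyond the preceding midpoint, so replacing endpoints by midpoints costs only
  the extra term \<open>g 0\<close>.\<close>

lemma integral_le_midpoint_sum:
  fixes g :: "real \<Rightarrow> real"
  assumes m: "\<bar>m\<bar> < 1" and N: "0 < N"
    and anti: "\<And>u v. 0 \<le> u \<Longrightarrow> u \<le> v \<Longrightarrow> v \<le> ellK m \<Longrightarrow> g v \<le> g u"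
    and nonneg: "\<And>u. 0 \<le> u \<Longrightarrow> u \<le> ellK m \<Longrightarrow> 0 \<le> g u"
    and int: "g integrable_on {0..ellK m}"
  shows "integral {0..ellK m} g \<le> ellK m / real N * (g 0 + (\<Sum>i<N. g (node m N i)))"
proof -
  define w where "w = ellK m / real N"
  have w: "0 < w" using ellK_pos[OF m] N by (simp add: w_def)
  have Nw: "real N * w = ellK m" using N by (simp add: w_def)
  have le: "real n * w \<le> ellK m" if "n \<le> N" for n
    unfolding Nw[symmetric] using that w by (intro mult_right_mono) auto
  have sub: "g integrable_on {a..b}" if "0 \<le> a" "b \<le> ellK m" for a b
    by (rule integrable_subinterval_real[OF int]) (use that in auto)
  have step: "integral {0..real n * w} g \<le> (\<Sum>i<n. w * g (real i * w))" if "n \<le> N" for n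
    using that
  proof (induction n)
    case (Suc n)
    have n0: "0 \<le> real n * w" "real n * w \<le> real (Suc n) * w" using w by (auto intro: mult_right_mono)
    have "integral {0..real (Suc n) * w} g = integral {0..real n * w} g + integral {real n * w..real (Suc n) * w} g"
      using n0 le[OF Suc.prems] by (intro Henstock_Kurzweil_Integration.integral_combine[symmetric] sub) auto
    also have "integral {real n * w..real (Suc n) * w} g \<le> integral {real n * w..real (Suc n) * w} (\<lambda>_. g (real n * w))"
      using n0 le[OF Suc.prems] by (intro integral_le sub anti) auto
    also have "\<dots> = w * g (real n * w)" using w n0 by (simp add: algebra_simps)
    finally show ?case using Suc by simp
  qed simp
  obtain n where n: "N = Suc n" using N by (cases N) auto
  have "integral {0..ellK m} g \<le> (\<Sum>i<N. w * g (real i * w))" using step[of N] by (simp add: Nw)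
  also have "\<dots> = w * (g 0 + (\<Sum>i<n. g (real (Suc i) * w)))"
    unfolding n by (simp only: sum.lessThan_Suc_shift sum_distrib_left[symmetric]) simp
  also have "\<dots> \<le> w * (g 0 + (\<Sum>i<N. g (node m N i)))"
  proof (intro mult_left_mono add_left_mono)
    have "(\<Sum>i<n. g (real (Suc i) * w)) \<le> (\<Sum>i<n. g (node m N i))"
    proof (rule sum_mono)
      fix i assume "i \<in> {..<n}"
      then have i: "Suc i \<le> N" "i < N" by (auto simp: n)
      have "node m N i \<le> real (Suc i) * w"
        unfolding node_def w_def using ellK_pos[OF m] N by (simp add: field_simps)
      then show "g (real (Suc i) * w) \<le> g (node m N i)"
        using le[OF i(1)] node_bounds(3)[OF m i(2)] by (intro anti) auto
    qed
    also have "\<dots> \<le> (\<Sum>i<N. g (node m N i))"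
      using node_bounds[OF m, of n N] nonneg[of "node m N n"] by (simp add: n)
    finally show "(\<Sum>i<n. g (real (Suc i) * w)) \<le> (\<Sum>i<N. g (node m N i))" .
  qed (use w in auto)
  finally show ?thesis by (simp add: w_def)
qed

text \<open>The product at 0 is a midpoint sum for the undamped logarithm, and damping by
  \<open>sin \<alpha>\<close> only lowers that logarithm. The error term is \<open>g 0\<close>,
  which does not depend on \<open>N\<close>.\<close>

lemma ln_shift_prod_le:
  assumes m: "0 < m" "m < 1" and N: "0 < N" and \<alpha>: "0 \<le> \<alpha>" "\<alpha> < pi / 2"
  shows "ln \<bar>shift_prod m N 0\<bar> \<le> ln ((1 + sin \<alpha>) / (1 - sin \<alpha>))
    - real N / ellK m * (pi * ellF \<alpha> (sqrt (1 - m\<^sup>2)))"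
proof -
  have m1: "\<bar>m\<bar> < 1" "m \<noteq> 0" using m by auto
  have K: "0 < ellK m" using ellK_pos m1 by blast
  define g where "g = (\<lambda>u. ln ((1 + jacobi_dn u m * sin \<alpha>) / (1 - jacobi_dn u m * sin \<alpha>)))"
  define c where "c = sin \<alpha>"
  have "0 \<le> c" unfolding c_def using \<alpha> by (intro sin_ge_zero) auto
  moreover have "sin \<alpha> < sin (pi / 2)" using \<alpha> by (subst sin_mono_less_eq) auto
  ultimately have c: "0 \<le> c" "c < 1" by (auto simp: c_def)
  have dc: "0 \<le> jacobi_dn u m * c" "jacobi_dn u m * c < 1" for u
    using c jacobi_dn_pos[OF m1(1), of u] jacobi_dn_le_1[of u m] mult_right_mono[of "jacobi_dn u m" 1 c] by auto
  have lnmono: "ln ((1 + x) / (1 - x)) \<le> ln ((1 + y) / (1 - y))" if "0 \<le> x" "x \<le> y" "y < 1" for x y :: real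
    using that by (intro ln_mono frac_le) (auto intro!: divide_pos_pos)
  have "integral {0..ellK m} g \<le> ellK m / real N * (g 0 + (\<Sum>i<N. g (node m N i)))"
  proof (rule integral_le_midpoint_sum[OF m1(1) N])
    show "g integrable_on {0..ellK m}"
      using has_integral_log_dn[OF m \<alpha>] unfolding g_def by blast
    show "0 \<le> g u" for u
      using lnmono[of 0 "jacobi_dn u m * c"] dc[of u] by (simp add: g_def c_def)
    show "g v \<le> g u" if "0 \<le> u" "u \<le> v" "v \<le> ellK m" for u v
      using lnmono[of "jacobi_dn v m * c" "jacobi_dn u m * c"] dc[of u] dc[of v] c
        mult_right_mono[OF jacobi_dn_antimono[OF m1 that], of c] by (simp add: g_def c_def)
  qed
  moreover have "integral {0..ellK m} g = pi * ellF \<alpha> (sqrt (1 - m\<^sup>2))"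
    using has_integral_log_dn[OF m \<alpha>] unfolding g_def by (rule integral_unique)
  ultimately have 1: "real N / ellK m * (pi * ellF \<alpha> (sqrt (1 - m\<^sup>2))) \<le> g 0 + (\<Sum>i<N. g (node m N i))"
    using K N by (simp add: field_simps)
  have pos: "0 < (landen_fun m (node m N i))\<^sup>2" and le: "ln ((landen_fun m (node m N i))\<^sup>2) \<le> - g (node m N i)"
    if "i < N" for i
  proof -
    define d where "d = jacobi_dn (node m N i) m"
    have d: "0 < d" "d < 1"
      using jacobi_dn_strict_antimono[OF m1, of 0 "node m N i"] node_bounds[OF m1(1) that]
        jacobi_dn_0[OF m1(1)] jacobi_dn_pos[OF m1(1), of "node m N i"] by (auto simp: d_def)
    have y: "(landen_fun m (node m N i))\<^sup>2 = (1 - d) / (1 + d)" by (simp add: landen_fun_sq m1 d_def)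
    then show "0 < (landen_fun m (node m N i))\<^sup>2" using d by simp
    have "d * c \<le> d * 1" using c d by (intro mult_left_mono) auto
    then have "g (node m N i) \<le> ln ((1 + d) / (1 - d))"
      using lnmono[of "d * c" d] dc[of "node m N i"] d by (simp add: g_def d_def c_def)
    also have "\<dots> = - ln ((landen_fun m (node m N i))\<^sup>2)" unfolding y using d by (simp add: ln_div)
    finally show "ln ((landen_fun m (node m N i))\<^sup>2) \<le> - g (node m N i)" by simp
  qed
  have "ln \<bar>shift_prod m N 0\<bar> = (\<Sum>i<N. ln ((landen_fun m (node m N i))\<^sup>2))"
    unfolding abs_shift_prod[OF m1 N]
    by (subst ln_prod[symmetric]) (use pos in \<open>auto simp: landen_fun_def[of m 0] m1\<close>)
  also have "\<dots> \<le> (\<Sum>i<N. - g (node m N i))" by (rule sum_mono) (use le in auto)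
  also have "\<dots> \<le> g 0 - real N / ellK m * (pi * ellF \<alpha> (sqrt (1 - m\<^sup>2)))" using 1 by (simp add: sum_negf)
  finally show ?thesis by (simp add: g_def jacobi_dn_0 m1)
qed

text \<open>Subtracting \<open>ln 2\<close> makes the doubling inequality homogeneous, so no
  constants accumulate.\<close>

lemma shift_prod_iterate:
  assumes m: "\<bar>m\<bar> < 1" "m \<noteq> 0" and k: "0 < k"
  shows "ln \<bar>shift_prod m k 0\<bar> - ln 2 \<le> (ln \<bar>shift_prod m (2 ^ n * k) 0\<bar> - ln 2) / 2 ^ n"
proof (induction n)
  case (Suc n)
  define a b where "a = \<bar>shift_prod m (2 ^ n * k) 0\<bar>" and "b = \<bar>shift_prod m (2 ^ Suc n * k) 0\<bar>"
  have pos: "0 < a" "0 < b"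
    unfolding a_def b_def by (rule shift_prod_0_pos_less_1[OF m], use k in simp)+
  have "a\<^sup>2 \<le> 2 * b"
    using shift_prod_sq_le_double[OF m, of "2 ^ n * k"] k by (simp add: a_def b_def mult.assoc)
  then have "ln (a\<^sup>2) \<le> ln (2 * b)" using pos by (intro ln_mono) auto
  then have "2 * ln a \<le> ln 2 + ln b"
    using pos by (simp add: ln_mult_pos ln_realpow)
  then have "(ln a - ln 2) / 2 ^ n \<le> ((ln b - ln 2) / 2) / 2 ^ n"
    by (intro divide_right_mono) auto
  also have "\<dots> = (ln b - ln 2) / 2 ^ Suc n" by simp
  finally show ?case using Suc unfolding a_def b_def by linarith
qed simp

text \<open>Two limits are taken in this order: \<open>n\<close> to infinity for fixed
  \<open>\<alpha>\<close>, which removes the error term \<open>?c\<close>, then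
  \<open>\<alpha>\<close> to \<open>pi / 2\<close>, which completes the integral.\<close>

lemma shift_prod_bound:
  assumes m: "0 < m" "m < 1" and k: "0 < k"
  shows "\<bar>shift_prod m k 0\<bar> \<le> 2 * exp (- (pi * ellK (sqrt (1 - m\<^sup>2)) / ellK m) * real k)"
proof -
  have m1: "\<bar>m\<bar> < 1" "m \<noteq> 0" using m by auto
  define \<delta> where "\<delta> = sqrt (1 - m\<^sup>2)"
  have m2: "m\<^sup>2 < 1" using m by (simp add: abs_square_less_1)
  have \<delta>: "\<bar>\<delta>\<bar> < 1" using m m2 by (simp add: \<delta>_def)
  let ?L = "ln \<bar>shift_prod m k 0\<bar> - ln 2"
  have step: "?L \<le> - (real k / ellK m * (pi * ellF \<alpha> \<delta>))" if \<alpha>: "0 \<le> \<alpha>" "\<alpha> < pi / 2" for \<alpha>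
  proof (rule tendsto_lowerbound)
    let ?c = "ln ((1 + sin \<alpha>) / (1 - sin \<alpha>))"
    have "(\<lambda>n. ?c / 2 ^ n - real k / ellK m * (pi * ellF \<alpha> \<delta>)) \<longlonglongrightarrow> 0 - real k / ellK m * (pi * ellF \<alpha> \<delta>)"
      by (intro tendsto_intros LIMSEQ_divide_realpow_zero) auto
    then show "(\<lambda>n. ?c / 2 ^ n - real k / ellK m * (pi * ellF \<alpha> \<delta>)) \<longlonglongrightarrow> - (real k / ellK m * (pi * ellF \<alpha> \<delta>))"
      by simp
    have "?L \<le> ?c / 2 ^ n - real k / ellK m * (pi * ellF \<alpha> \<delta>)" for n
    proof -
      have "?L \<le> (ln \<bar>shift_prod m (2 ^ n * k) 0\<bar> - ln 2) / 2 ^ n" by (rule shift_prod_iterate[OF m1 k])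
      also have "\<dots> \<le> (?c - real (2 ^ n * k) / ellK m * (pi * ellF \<alpha> \<delta>)) / 2 ^ n"
        using ln_shift_prod_le[OF m _ \<alpha>, of "2 ^ n * k"] k
        by (intro divide_right_mono) (auto simp: \<delta>_def intro: order.trans[rotated])
      also have "\<dots> = ?c / 2 ^ n - real k / ellK m * (pi * ellF \<alpha> \<delta>)"
        by (simp add: diff_divide_distrib)
      finally show ?thesis .
    qed
    then show "eventually (\<lambda>n. ?L \<le> ?c / 2 ^ n - real k / ellK m * (pi * ellF \<alpha> \<delta>)) sequentially" by simp
  qed simp
  have "?L \<le> - (real k / ellK m * (pi * ellK \<delta>))"
  proof (rule tendsto_lowerbound)
    have "((\<lambda>\<alpha>. ellF \<alpha> \<delta>) \<longlongrightarrow> ellF (pi / 2) \<delta>) (at_left (pi / 2))"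
      using ellF_continuous[OF \<delta>, of "pi / 2"] unfolding isCont_def by (rule filterlim_at_split[THEN iffD1, THEN conjunct1])
    then show "((\<lambda>\<alpha>. - (real k / ellK m * (pi * ellF \<alpha> \<delta>))) \<longlongrightarrow> - (real k / ellK m * (pi * ellK \<delta>))) (at_left (pi / 2))"
      unfolding ellK_def by (intro tendsto_intros)
    show "eventually (\<lambda>\<alpha>. ?L \<le> - (real k / ellK m * (pi * ellF \<alpha> \<delta>))) (at_left (pi / 2))"
      using eventually_at_left_real[OF pi_half_gt_zero] by eventually_elim (rule step, auto)
  qed simp
  then have "ln \<bar>shift_prod m k 0\<bar> \<le> ln (2 * exp (- (pi * ellK \<delta> / ellK m) * real k))"
    by (simp add: ln_mult_pos mult_ac)
  then show ?thesis
    using shift_prod_0_pos_less_1[OF m1 k] unfolding \<delta>_def by (subst (asm) ln_le_cancel_iff) auto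
qed

subsection \<open>Landen transformation\<close>

text \<open>The integral of \<open>1 / sqrt (a\<^sup>2 cos\<^sup>2 + b\<^sup>2 sin\<^sup>2)\<close> over \<open>[0, \<pi> / 2]\<close>, for \<open>0 < b \<le> a\<close>.\<close>

definition complete_ell :: "real \<Rightarrow> real \<Rightarrow> real" where
  "complete_ell a b = ellK (sqrt (1 - (b / a)\<^sup>2)) / a"

lemma cos_sin_scaled_angle:
  assumes ab: "0 < a" "0 < b"
  defines "\<Delta> \<equiv> \<lambda>x. sqrt (a\<^sup>2 * (cos x)\<^sup>2 + b\<^sup>2 * (sin x)\<^sup>2)"
  shows "cos (scaled_angle a b x) = a * cos x / \<Delta> x" "sin (scaled_angle a b x) = b * sin x / \<Delta> x"
proof -
  define D where "D = a * (cos x)\<^sup>2 + b * (sin x)\<^sup>2"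
  define w where "w = (a - b) * sin x * cos x / D"
  have D: "0 < D" unfolding D_def by (rule cos_sin_form_pos[OF ab])
  have "0 < a\<^sup>2 * (cos x)\<^sup>2 + b\<^sup>2 * (sin x)\<^sup>2" using ab by (intro cos_sin_form_pos) auto
  then have \<Delta>: "0 < \<Delta> x" "(\<Delta> x)\<^sup>2 = a\<^sup>2 * (cos x)\<^sup>2 + b\<^sup>2 * (sin x)\<^sup>2" by (auto simp: \<Delta>_def)
  have "1 + w\<^sup>2 = (\<Delta> x / D)\<^sup>2"
    using cos_sin_form_sq[of a x b] D \<Delta> by (simp add: w_def D_def power_divide divide_simps add.commute)
  then have sq: "sqrt (1 + w\<^sup>2) = \<Delta> x / D" using D \<Delta> by (simp add: real_sqrt_abs)
  have s: "scaled_angle a b x = x - arctan w" by (simp add: scaled_angle_def w_def D_def)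
  have CS: "(cos x)\<^sup>2 = 1 - (sin x)\<^sup>2" by (rule cos_squared_eq)
  have "cos (scaled_angle a b x) = (cos x * D + sin x * ((a - b) * sin x * cos x)) / \<Delta> x"
    unfolding s cos_diff cos_arctan sin_arctan sq using D \<Delta> by (simp add: w_def field_simps)
  also have "cos x * D + sin x * ((a - b) * sin x * cos x) = cos x * (a * ((cos x)\<^sup>2 + (sin x)\<^sup>2))"
    unfolding D_def by algebra
  finally show "cos (scaled_angle a b x) = a * cos x / \<Delta> x" by (simp add: mult.commute)
  have "sin (scaled_angle a b x) = (sin x * D - cos x * ((a - b) * sin x * cos x)) / \<Delta> x"
    unfolding s sin_diff cos_arctan sin_arctan sq using D \<Delta> by (simp add: w_def field_simps)
  also have "sin x * D - cos x * ((a - b) * sin x * cos x) = sin x * (b * ((cos x)\<^sup>2 + (sin x)\<^sup>2))"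
    unfolding D_def by algebra
  finally show "sin (scaled_angle a b x) = b * sin x / \<Delta> x" by (simp add: mult.commute)
qed

lemma complementary_modulus_less_1:
  fixes a b :: real
  assumes "0 < b" "b \<le> a"
  shows "\<bar>sqrt (1 - (b / a)\<^sup>2)\<bar> < 1" "(sqrt (1 - (b / a)\<^sup>2))\<^sup>2 = 1 - (b / a)\<^sup>2"
proof -
  have "0 < b / a" "b / a \<le> 1" using assms by auto
  then have "0 < (b / a)\<^sup>2" "(b / a)\<^sup>2 \<le> 1" by (auto simp del: zero_less_divide_iff divide_le_eq_1 intro: power_le_one)
  then show "\<bar>sqrt (1 - (b / a)\<^sup>2)\<bar> < 1" "(sqrt (1 - (b / a)\<^sup>2))\<^sup>2 = 1 - (b / a)\<^sup>2" by auto
qed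

lemma ellF_homogeneous_deriv:
  assumes "0 < b" "b \<le> a"
  shows "((\<lambda>x. ellF x (sqrt (1 - (b / a)\<^sup>2)) / a) has_real_derivative
    1 / sqrt (a\<^sup>2 * (cos x)\<^sup>2 + b\<^sup>2 * (sin x)\<^sup>2)) (at x)"
proof -
  have a: "0 < a" using assms by simp
  have "a\<^sup>2 * (cos x)\<^sup>2 + b\<^sup>2 * (sin x)\<^sup>2 = a\<^sup>2 * (1 - (1 - (b / a)\<^sup>2) * (sin x)\<^sup>2)"
    using a by (simp add: power_divide cos_squared_eq algebra_simps)
  then have "sqrt (a\<^sup>2 * (cos x)\<^sup>2 + b\<^sup>2 * (sin x)\<^sup>2) = a * sqrt (1 - (1 - (b / a)\<^sup>2) * (sin x)\<^sup>2)"
    using a by (simp add: real_sqrt_mult)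
  with DERIV_cdivide[OF ellF_deriv[OF complementary_modulus_less_1(1)[OF assms], of x], of a] show ?thesis
    unfolding complementary_modulus_less_1(2)[OF assms] by (simp add: mult.commute)
qed

text \<open>Landen's substitution \<open>tan (\<phi>\<^sub>1 - \<phi>) = b / a * tan \<phi>\<close>.\<close>

lemma complete_ell_agm:
  assumes b: "0 < b" "b \<le> a"
  shows "complete_ell ((a + b) / 2) (sqrt (a * b)) = complete_ell a b"
proof -
  have a: "0 < a" using b by simp
  define a1 b1 where "a1 = (a + b) / 2" and "b1 = sqrt (a * b)"
  have b12: "b1\<^sup>2 = a * b" using a b by (simp add: b1_def)
  have ab1: "0 < b1" "b1 \<le> a1" unfolding a1_def b1_def using arith_geo_mean_sqrt[of a b] a b by auto
  define m m1 where "m = sqrt (1 - (b / a)\<^sup>2)" and "m1 = sqrt (1 - (b1 / a1)\<^sup>2)"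
  have m1: "\<bar>m1\<bar> < 1" unfolding m1_def by (rule complementary_modulus_less_1[OF ab1])
  define p where "p = (\<lambda>x. x + scaled_angle a b x)"
  \<comment> \<open>\<open>p\<close> maps 0 to 0 and \<open>pi / 2\<close> to \<open>pi\<close>, so
    \<open>ellF (p x) m1\<close> ends at twice a complete integral; the factor 2 on the other term
    matches this.\<close>
  have "((\<lambda>x. ellF (p x) m1 / a1 - 2 * (ellF x m / a)) has_real_derivative 0) (at x)" for x
  proof -
    define C S where "C = cos x" and "S = sin x"
    define D where "D = a * C\<^sup>2 + b * S\<^sup>2"
    define E where "E = sqrt (a\<^sup>2 * C\<^sup>2 + b\<^sup>2 * S\<^sup>2)"
    have CS: "C\<^sup>2 + S\<^sup>2 = 1" by (simp add: C_def S_def)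
    have D: "0 < D" unfolding D_def C_def S_def by (rule cos_sin_form_pos[OF a b(1)])
    have "0 < a\<^sup>2 * C\<^sup>2 + b\<^sup>2 * S\<^sup>2" unfolding C_def S_def using a b by (intro cos_sin_form_pos) auto
    then have E: "0 < E" "E\<^sup>2 = a\<^sup>2 * C\<^sup>2 + b\<^sup>2 * S\<^sup>2" by (auto simp: E_def)
    have c: "cos (p x) = (a * C\<^sup>2 - b * S\<^sup>2) / E" and s: "sin (p x) = (a + b) * S * C / E"
      unfolding p_def cos_add sin_add cos_sin_scaled_angle[OF a b(1)]
      by (simp_all add: C_def S_def E_def power2_eq_square diff_divide_distrib add_divide_distrib algebra_simps)
    have "a1\<^sup>2 * (cos (p x))\<^sup>2 + b1\<^sup>2 * (sin (p x))\<^sup>2 = (a1\<^sup>2 * (a * C\<^sup>2 - b * S\<^sup>2)\<^sup>2 + a * b * ((a + b) * S * C)\<^sup>2) / E\<^sup>2"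
      unfolding c s b12 by (simp add: power_divide add_divide_distrib)
    also have "a1\<^sup>2 * (a * C\<^sup>2 - b * S\<^sup>2)\<^sup>2 + a * b * ((a + b) * S * C)\<^sup>2 = (a1 * D)\<^sup>2"
      unfolding a1_def D_def by (simp add: field_simps power2_eq_square)
    finally have "a1\<^sup>2 * (cos (p x))\<^sup>2 + b1\<^sup>2 * (sin (p x))\<^sup>2 = (a1 * D / E)\<^sup>2" by (simp add: power_divide)
    then have sq: "sqrt (a1\<^sup>2 * (cos (p x))\<^sup>2 + b1\<^sup>2 * (sin (p x))\<^sup>2) = a1 * D / E"
      using ab1 D E by (simp add: real_sqrt_abs)
    have "1 + a * b / E\<^sup>2 = (E\<^sup>2 + a * b * (C\<^sup>2 + S\<^sup>2)) / E\<^sup>2" using E(1) CS by (simp add: field_simps)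
    also have "E\<^sup>2 + a * b * (C\<^sup>2 + S\<^sup>2) = 2 * a1 * D" unfolding E(2) a1_def D_def by algebra
    finally have p': "1 + a * b / E\<^sup>2 = 2 * a1 * D / E\<^sup>2" .
    have "(p has_real_derivative 1 + a * b / E\<^sup>2) (at x)"
      unfolding p_def E(2) C_def S_def by (intro DERIV_add DERIV_ident scaled_angle_deriv a b)
    from DERIV_chain'[OF this[unfolded p'] ellF_homogeneous_deriv[OF ab1]]
    have "((\<lambda>x. ellF (p x) m1 / a1) has_real_derivative 1 / (a1 * D / E) * (2 * a1 * D / E\<^sup>2)) (at x)"
      by (simp add: sq m1_def)
    also have "1 / (a1 * D / E) * (2 * a1 * D / E\<^sup>2) = 2 * (1 / E)"
      using E(1) D ab1 by (simp add: power2_eq_square field_simps)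
    finally show ?thesis
      using DERIV_diff[OF _ DERIV_cmult[OF ellF_homogeneous_deriv[OF b, of x], of 2]]
      by (force simp: m_def E_def C_def S_def)
  qed
  from const_of_zero_deriv[of "\<lambda>x. ellF (p x) m1 / a1 - 2 * (ellF x m / a)", OF this, of "pi / 2" 0]
  have "ellF pi m1 / a1 = 2 * (ellK m / a)"
    by (simp add: p_def scaled_angle_pi_half ellK_def)
  moreover have "ellF pi m1 = 2 * ellK m1" using ellF_multiple[OF m1, of 1] by simp
  ultimately show ?thesis by (simp add: complete_ell_def a1_def[symmetric] b1_def[symmetric] m_def m1_def)
qed

text \<open>Two steps of the arithmetic-geometric mean from \<open>(1, \<delta>)\<close> reach a
  pair with modulus \<open>\<mu>\<close>. Two steps from
  \<open>((1 + r)\<^sup>2, (1 - r)\<^sup>2)\<close>, whose modulus is complementary to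
  \<open>\<mu>\<close>, reach \<open>(1, sqrt (1 - \<delta>\<^sup>2))\<close> with modulus
  \<open>\<delta>\<close>. The scale factors \<open>(1 + r)\<^sup>2\<close> cancel in the quotient
  and 4 remains.\<close>

lemma ellK_quotient:
  assumes \<delta>: "0 < \<delta>" "\<delta> < 1"
    and \<mu>: "\<mu> = ((1 - sqrt \<delta>) / (1 + sqrt \<delta>))\<^sup>2"
  shows "ellK (sqrt (1 - \<mu>\<^sup>2)) / ellK \<mu> = 4 * (ellK \<delta> / ellK (sqrt (1 - \<delta>\<^sup>2)))"
proof -
  define r where "r = sqrt \<delta>"
  have r: "0 < r" "r < 1" "\<delta> = r\<^sup>2" using \<delta> by (auto simp: r_def)
  have r2: "r\<^sup>2 < 1" "0 < r\<^sup>2" using \<delta> r by auto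
  have \<delta>2: "\<delta>\<^sup>2 < 1" using \<delta> by (simp add: abs_square_less_1)
  have \<mu>r: "\<mu> = (1 - r)\<^sup>2 / (1 + r)\<^sup>2" by (simp add: \<mu> r_def power_divide)
  have \<mu>0: "0 < \<mu>" unfolding \<mu>r using r by simp
  have "(1 - r)\<^sup>2 < (1 + r)\<^sup>2" using r by (intro power_strict_mono) auto
  then have \<mu>1: "\<mu> < 1" unfolding \<mu>r using r by simp
  have "ellK (sqrt (1 - \<delta>\<^sup>2)) = complete_ell 1 \<delta>" by (simp add: complete_ell_def)
  also have "\<dots> = complete_ell ((1 + r\<^sup>2) / 2) r"
    using complete_ell_agm[of \<delta> 1] \<delta> r by simp
  also have "\<dots> = complete_ell (((1 + r\<^sup>2) / 2 + r) / 2) (sqrt ((1 + r\<^sup>2) / 2 * r))"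
    using r zero_le_power2[of "1 - r"] by (intro complete_ell_agm[symmetric]) (auto simp: power2_eq_square algebra_simps)
  also have "((1 + r\<^sup>2) / 2 + r) / 2 = (1 + r)\<^sup>2 / 4" by (simp add: power2_eq_square field_simps)
  also have "complete_ell ((1 + r)\<^sup>2 / 4) (sqrt ((1 + r\<^sup>2) / 2 * r)) = ellK \<mu> * 4 / (1 + r)\<^sup>2"
  proof -
    have "(sqrt ((1 + r\<^sup>2) / 2 * r) / ((1 + r)\<^sup>2 / 4))\<^sup>2 = ((1 + r\<^sup>2) / 2 * r) * 16 / ((1 + r)\<^sup>2)\<^sup>2"
      using r by (simp add: power_divide)
    also have "\<dots> = 1 - \<mu>\<^sup>2"
    proof -
      have n: "((1 + r)\<^sup>2)\<^sup>2 \<noteq> 0" using r by auto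
      have "1 - \<mu>\<^sup>2 = (((1 + r)\<^sup>2)\<^sup>2 - ((1 - r)\<^sup>2)\<^sup>2) / ((1 + r)\<^sup>2)\<^sup>2"
        unfolding \<mu>r power_divide using n by (simp add: diff_divide_distrib)
      also have "((1 + r)\<^sup>2)\<^sup>2 - ((1 - r)\<^sup>2)\<^sup>2 = ((1 + r\<^sup>2) / 2 * r) * 16"
        by (simp add: power2_eq_square algebra_simps)
      finally show ?thesis by simp
    qed
    finally show ?thesis unfolding complete_ell_def using \<mu>0 by simp
  qed
  finally have 1: "ellK (sqrt (1 - \<delta>\<^sup>2)) = ellK \<mu> * 4 / (1 + r)\<^sup>2" .
  have "ellK (sqrt (1 - \<mu>\<^sup>2)) / (1 + r)\<^sup>2 = complete_ell ((1 + r)\<^sup>2) ((1 - r)\<^sup>2)"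
    by (simp add: complete_ell_def \<mu>r)
  also have "\<dots> = complete_ell (((1 + r)\<^sup>2 + (1 - r)\<^sup>2) / 2) (sqrt ((1 + r)\<^sup>2 * (1 - r)\<^sup>2))"
    using r \<open>(1 - r)\<^sup>2 < (1 + r)\<^sup>2\<close> by (intro complete_ell_agm[symmetric]) auto
  also have "((1 + r)\<^sup>2 + (1 - r)\<^sup>2) / 2 = 1 + \<delta>" by (simp add: r power2_eq_square algebra_simps)
  also have "sqrt ((1 + r)\<^sup>2 * (1 - r)\<^sup>2) = 1 - \<delta>"
    using r by (simp add: real_sqrt_mult) (simp add: power2_eq_square algebra_simps)
  also have "complete_ell (1 + \<delta>) (1 - \<delta>) = complete_ell ((1 + \<delta> + (1 - \<delta>)) / 2) (sqrt ((1 + \<delta>) * (1 - \<delta>)))"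
    using \<delta> by (intro complete_ell_agm[symmetric]) auto
  also have "\<dots> = complete_ell 1 (sqrt (1 - \<delta>\<^sup>2))" by (simp add: power2_eq_square algebra_simps)
  also have "\<dots> = ellK \<delta>" using \<delta> \<delta>2 by (simp add: complete_ell_def)
  finally have 2: "ellK (sqrt (1 - \<mu>\<^sup>2)) = ellK \<delta> * (1 + r)\<^sup>2" using r by (simp add: field_simps)
  have "0 < ellK \<mu>" using \<mu>0 \<mu>1 by (intro ellK_pos) auto
  then show ?thesis unfolding 1 2 using r by (simp add: field_simps)
qed

lemma zolotarev_bound:
  assumes \<delta>: "0 < \<delta>" "\<delta> < 1"
    and \<mu>: "\<mu> = ((1 - sqrt \<delta>) / (1 + sqrt \<delta>))\<^sup>2"
    and k: "0 < k" and x: "\<delta> \<le> x" "x \<le> 1"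
  shows "\<bar>zolotarev (sqrt (1 - \<delta>\<^sup>2)) k x\<bar>
    \<le> 2 * exp (- (pi * ellK (sqrt (1 - \<mu>\<^sup>2)) / (4 * ellK \<mu>)) * real k)"
proof -
  define m where "m = sqrt (1 - \<delta>\<^sup>2)"
  have \<delta>2: "0 < \<delta>\<^sup>2" "\<delta>\<^sup>2 < 1" using \<delta> by (auto simp: abs_square_less_1)
  have m: "0 < m" "m < 1" "m\<^sup>2 = 1 - \<delta>\<^sup>2" using \<delta>2 by (auto simp: m_def)
  have m1: "\<bar>m\<bar> < 1" "m \<noteq> 0" using m by auto
  have \<delta>m: "sqrt (1 - m\<^sup>2) = \<delta>" using m \<delta> by simp
  \<comment> \<open>\<open>y\<close> is the sine of the amplitude at which \<open>dn\<close> takes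
    the value \<open>x\<close>, by \<open>x\<^sup>2 = 1 - m\<^sup>2 * y\<^sup>2\<close>;
    \<open>\<delta> \<le> x\<close> is what makes \<open>y \<le> 1\<close>.\<close>
  define y where "y = sqrt (1 - x\<^sup>2) / m"
  have x2: "x\<^sup>2 \<le> 1" "\<delta>\<^sup>2 \<le> x\<^sup>2" using x \<delta> by (auto intro: power_le_one power_mono)
  have y: "0 \<le> y" "y \<le> 1" unfolding y_def m_def using x2 m(1) \<delta>2 by (auto simp: m_def)
  define u where "u = ellF (arcsin y) m"
  have "ellF 0 m \<le> ellF (arcsin y) m"
    using strict_mono_less_eq[OF ellF_strict_mono[OF m1(1)], of 0 "arcsin y"] y
      arcsin_le_arcsin[of 0 y] by simp
  then have u: "0 \<le> u" by (simp add: u_def)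
  have "m\<^sup>2 * y\<^sup>2 = 1 - x\<^sup>2" using m1 x2 by (simp add: y_def power_divide)
  then have "jacobi_dn u m = x"
    using y x \<delta> by (simp add: u_def jacobi_dn_ellF[OF m1(1)])
  then have "\<bar>zolotarev m k x\<bar> = \<bar>shift_prod m k u\<bar>" using zolotarev_dn[OF m1 k] by metis
  also have "\<dots> \<le> \<bar>shift_prod m k 0\<bar>" by (rule shift_prod_max[OF m1 k u])
  also have "\<dots> \<le> 2 * exp (- (pi * ellK \<delta> / ellK m) * real k)"
    using shift_prod_bound[OF m(1,2) k] by (simp only: \<delta>m)
  also have "pi * ellK \<delta> / ellK m = pi * ellK (sqrt (1 - \<mu>\<^sup>2)) / (4 * ellK \<mu>)"
  proof -
    have "pi * ellK (sqrt (1 - \<mu>\<^sup>2)) / (4 * ellK \<mu>) = pi / 4 * (ellK (sqrt (1 - \<mu>\<^sup>2)) / ellK \<mu>)" by simp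
    also have "\<dots> = pi * ellK \<delta> / ellK m" unfolding ellK_quotient[OF \<delta> \<mu>] m_def by simp
    finally show ?thesis ..
  qed
  finally show ?thesis by (simp add: m_def)
qed

subsection \<open>Rational approximation of powers\<close>

text \<open>The density of \<open>t\<^sup>-\<^sup>s / (t + x) dt\<close> under \<open>t = exp y\<close>, which turns scaling of \<open>x\<close> into translation.\<close>

definition stieltjes_kernel :: "real \<Rightarrow> real \<Rightarrow> real \<Rightarrow> real" where
  "stieltjes_kernel s x y = exp ((1 - s) * y) / (exp y + x)"

lemma integrable_exp_decay:
  fixes a :: real
  assumes a: "0 < a"
  shows "integrable lborel (\<lambda>y. exp (- a * y) * indicator {0..} y :: real)"
proof (rule integrableI_nn_integral_finite)
  have "(\<integral>\<^sup>+y. ennreal (exp (- a * y)) * indicator {0..} y \<partial>lborel) = ennreal (0 - - exp (- a * 0) / a)"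
  proof (rule nn_integral_FTC_atLeast)
    show "((\<lambda>y. - exp (- a * y) / a) has_real_derivative exp (- a * y)) (at y)" for y
      using a by (auto intro!: derivative_eq_intros)
    have "filterlim (\<lambda>y. a * y) at_top at_top"
      by (rule filterlim_tendsto_pos_mult_at_top[OF tendsto_const a filterlim_ident])
    then have "((\<lambda>y. exp (- (a * y))) \<longlongrightarrow> 0) at_top"
      by (intro filterlim_compose[OF exp_at_bot]) (simp add: filterlim_uminus_at_bot)
    then have "((\<lambda>y. - exp (- (a * y)) / a) \<longlongrightarrow> - 0 / a) at_top" by (intro tendsto_intros) (use a in auto)
    then show "((\<lambda>y. - exp (- a * y) / a) \<longlongrightarrow> 0) at_top" by simp
  qed auto
  moreover have "(\<integral>\<^sup>+y. ennreal (exp (- a * y)) * indicator {0..} y \<partial>lborel) =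
     (\<integral>\<^sup>+y. ennreal (exp (- a * y) * indicator {0..} y) \<partial>lborel)"
    by (intro nn_integral_cong) (auto simp: indicator_def)
  ultimately show "(\<integral>\<^sup>+y. ennreal (exp (- a * y) * indicator {0..} y) \<partial>lborel) = ennreal (1 / a)" by simp
qed auto

text \<open>The kernel decays at rate \<open>s\<close> to the right and at rate \<open>1 - s\<close>
  to the left, so both bounds on \<open>s\<close> enter. The form \<open>0 + - 1 * y\<close> is the
  reflection written as an affine change of variables.\<close>

lemma stieltjes_kernel_integrable_1:
  assumes s: "0 < s" "s < 1"
  shows "integrable lborel (stieltjes_kernel s 1)"
proof (rule Bochner_Integration.integrable_bound)
  have "integrable lborel (\<lambda>y. exp (- (1 - s) * (0 + - 1 * y)) * indicator {0..} (0 + - 1 * y) :: real)"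
    by (rule lborel_integrable_real_affine[OF integrable_exp_decay]) (use s in auto)
  then show "integrable lborel (\<lambda>y. exp (- s * y) * indicator {0..} y +
      exp (- (1 - s) * (0 + - 1 * y)) * indicator {0..} (0 + - 1 * y) :: real)"
    by (intro Bochner_Integration.integrable_add integrable_exp_decay s)
  show "stieltjes_kernel s 1 \<in> borel_measurable lborel"
    unfolding stieltjes_kernel_def[abs_def] by measurable
  show "AE y in lborel. norm (stieltjes_kernel s 1 y) \<le> norm (exp (- s * y) * indicator {0..} y +
      exp (- (1 - s) * (0 + - 1 * y)) * indicator {0..} (0 + - 1 * y) :: real)"
  proof (rule AE_I2)
    fix y :: real
    have n: "0 < exp y + 1" by (simp add: add_pos_pos)
    have "stieltjes_kernel s 1 y \<le> exp ((1 - s) * y) / exp y"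
      unfolding stieltjes_kernel_def by (intro frac_le) auto
    also have "\<dots> = exp (- s * y)" by (simp add: exp_diff[symmetric] algebra_simps)
    finally have 1: "stieltjes_kernel s 1 y \<le> exp (- s * y)" .
    have 2: "stieltjes_kernel s 1 y \<le> exp ((1 - s) * y)"
      unfolding stieltjes_kernel_def using n by (simp add: divide_le_eq mult_le_cancel_left1)
    have 0: "0 \<le> stieltjes_kernel s 1 y" unfolding stieltjes_kernel_def using n by simp
    show "norm (stieltjes_kernel s 1 y) \<le> norm (exp (- s * y) * indicator {0..} y +
      exp (- (1 - s) * (0 + - 1 * y)) * indicator {0..} (0 + - 1 * y) :: real)"
      using 0 1 2 by (cases "0 \<le> y"; cases "y = 0") (auto simp: indicator_def algebra_simps)
  qed
qed

lemma stieltjes_kernel_integral: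
  assumes s: "0 < s" "s < 1" and x: "0 < x"
  shows "integrable lborel (stieltjes_kernel s x)"
    "(LINT y|lborel. stieltjes_kernel s x y) = x powr (- s) * (LINT y|lborel. stieltjes_kernel s 1 y)"
proof -
  have sc: "stieltjes_kernel s x (ln x + 1 * y) = x powr (- s) * stieltjes_kernel s 1 y" for y
  proof -
    have "exp ((1 - s) * (ln x + y)) = x * x powr (- s) * exp ((1 - s) * y)"
      using x by (simp add: powr_def exp_add[symmetric] exp_diff algebra_simps)
         (simp add: exp_add exp_diff exp_minus field_simps)
    moreover have "exp (ln x + y) + x = x * (exp y + 1)" using x by (simp add: exp_add algebra_simps)
    ultimately show ?thesis using x by (simp add: stieltjes_kernel_def)
  qed
  have sc': "stieltjes_kernel s x y = x powr (- s) * stieltjes_kernel s 1 (- ln x + 1 * y)" for y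
    using sc[of "y - ln x"] by simp
  show "integrable lborel (stieltjes_kernel s x)"
    unfolding sc'[abs_def]
    by (intro integrable_mult_right lborel_integrable_real_affine stieltjes_kernel_integrable_1 s) simp
  show "(LINT y|lborel. stieltjes_kernel s x y) = x powr (- s) * (LINT y|lborel. stieltjes_kernel s 1 y)"
    by (subst lborel_integral_real_affine[where c = 1 and t = "ln x"]) (simp_all add: sc[simplified])
qed

lemma stieltjes_constant_pos:
  assumes s: "0 < s" "s < 1"
  shows "0 < (LINT y|lborel. stieltjes_kernel s 1 y)"
proof -
  have "0 < (LINT y|lborel. 1 / (exp 1 + 1) * indicator {0..1::real} y :: real)"
    by (simp add: add_pos_pos)
  also have "\<dots> \<le> (LINT y|lborel. stieltjes_kernel s 1 y)"
  proof (rule integral_mono)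
    fix y :: real
    show "1 / (exp 1 + 1) * indicator {0..1} y \<le> stieltjes_kernel s 1 y"
    proof (cases "y \<in> {0..1}")
      case True
      then have "1 / (exp 1 + 1) \<le> exp ((1 - s) * y) / (exp y + 1)"
        using s by (intro frac_le) (auto intro: add_pos_pos)
      then show ?thesis using True by (simp add: stieltjes_kernel_def)
    next
      case False
      have "0 < exp y + 1" by (simp add: add_pos_pos)
      then show ?thesis using False by (simp add: stieltjes_kernel_def)
    qed
  qed (auto intro: stieltjes_kernel_integrable_1 s)
  finally show ?thesis .
qed

section \<open>Expansion in Blaschke products with prescribed poles\<close>

definition blaschke :: "(nat \<Rightarrow> real) \<Rightarrow> nat \<Rightarrow> real \<Rightarrow> real" where
  "blaschke T n z = (\<Prod>i<n. (z - T i) / (z + T i))"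

text \<open>The Malmquist--Takenaka expansion of the resolvent in the poles \<open>- T i\<close>.\<close>

lemma blaschke_resolvent:
  assumes T: "\<And>i. i < n \<Longrightarrow> 0 < T i" and t: "0 < t" and z: "0 < z"
  shows "(1 - blaschke T n z * blaschke T n t) / (t + z) =
    (\<Sum>j<n. 2 * T j * blaschke T j t / (t + T j) * (blaschke T j z / (z + T j)))"
  using T
proof (induction n)
  case (Suc n)
  define b c where "b = blaschke T n z" and "c = blaschke T n t"
  have T: "0 < T n" using Suc.prems by simp
  have "1 - (z - T n) / (z + T n) * ((t - T n) / (t + T n)) = 2 * T n * (t + z) / ((z + T n) * (t + T n))"
    using T t z by (simp add: divide_simps) (simp add: algebra_simps)
  then have e: "(z - T n) / (z + T n) * ((t - T n) / (t + T n)) = 1 - 2 * T n * (t + z) / ((z + T n) * (t + T n))"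
    by simp
  have "1 - blaschke T (Suc n) z * blaschke T (Suc n) t =
      1 - b * c * ((z - T n) / (z + T n) * ((t - T n) / (t + T n)))"
    by (simp add: blaschke_def b_def c_def)
  also have "\<dots> = (1 - b * c) + b * c * (2 * T n * (t + z) / ((z + T n) * (t + T n)))"
    unfolding e by (simp add: algebra_simps)
  finally have "(1 - blaschke T (Suc n) z * blaschke T (Suc n) t) / (t + z)
    = (1 - b * c) / (t + z) + b * c * (2 * T n * (t + z) / ((z + T n) * (t + T n))) / (t + z)"
    by (simp only: add_divide_distrib)
  also have "b * c * (2 * T n * (t + z) / ((z + T n) * (t + T n))) / (t + z)
    = 2 * T n * c / (t + T n) * (b / (z + T n))"
    using T t z by (simp, simp add: mult_ac)
  finally show ?case using Suc by (simp add: b_def c_def)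
qed (simp add: blaschke_def)

text \<open>Turns the terms of the expansion, which have several poles each, into combinations of
  the simple resolvents that the snapshots provide. The condition \<open>n \<le> l\<close> keeps
  \<open>- T l\<close> out of the poles of the product, and distinct points keep all poles
  simple.\<close>

lemma blaschke_partial_fractions:
  assumes T: "\<And>i. i < k \<Longrightarrow> 0 < T i" and inj: "inj_on T {..<k}" and l: "n \<le> l" "l < k"
  shows "\<exists>c. \<forall>z>0. blaschke T n z / (z + T l) = (\<Sum>i<k. c i / (z + T i))"
  using l
proof (induction n arbitrary: l)
  case 0
  have "blaschke T 0 z / (z + T l) = (\<Sum>i<k. (if i = l then 1 else 0) / (z + T i))" for z
    using 0 by (simp add: blaschke_def if_distrib[of "\<lambda>x. x / _"] sum.delta cong: if_cong)
  then show ?case by (intro exI[of _ "\<lambda>i. if i = l then 1 else 0"]) blast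
next
  case (Suc n)
  obtain c where c: "\<And>z. 0 < z \<Longrightarrow> blaschke T n z / (z + T l) = (\<Sum>i<k. c i / (z + T i))"
    using Suc.IH[of l] Suc.prems by auto
  obtain d where d: "\<And>z. 0 < z \<Longrightarrow> blaschke T n z / (z + T n) = (\<Sum>i<k. d i / (z + T i))"
    using Suc.IH[of n] Suc.prems by auto
  have ne: "T l \<noteq> T n" using inj_onD[OF inj, of l n] Suc.prems by auto
  \<comment> \<open>For the new factor divided by \<open>z + T l\<close>, the residue is
    \<open>1 + \<beta>\<close> at \<open>- T l\<close> and \<open>- \<beta>\<close> at
    \<open>- T n\<close>.\<close>
  define \<beta> where "\<beta> = 2 * T n / (T l - T n)"
  have "blaschke T (Suc n) z / (z + T l) = (\<Sum>i<k. ((1 + \<beta>) * c i - \<beta> * d i) / (z + T i))" if z: "0 < z" for z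
  proof -
    have p: "0 < z + T n" "0 < z + T l" using z T[of n] T[of l] Suc.prems by auto
    have "(z - T n) / (z + T n) / (z + T l) = (1 + \<beta>) * (1 / (z + T l)) - \<beta> * (1 / (z + T n))"
      using p ne unfolding \<beta>_def by (simp add: divide_simps) (simp add: algebra_simps)
    then have "blaschke T n z * ((z - T n) / (z + T n) / (z + T l)) =
       blaschke T n z * ((1 + \<beta>) * (1 / (z + T l)) - \<beta> * (1 / (z + T n)))" by simp
    then have "blaschke T (Suc n) z / (z + T l) =
       (1 + \<beta>) * (blaschke T n z / (z + T l)) - \<beta> * (blaschke T n z / (z + T n))"
      by (simp add: blaschke_def algebra_simps)
    also have "\<dots> = (\<Sum>i<k. ((1 + \<beta>) * c i - \<beta> * d i) / (z + T i))"
      unfolding c[OF z] d[OF z]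
      by (simp add: sum_distrib_left sum_subtractf[symmetric] diff_divide_distrib)
    finally show ?thesis .
  qed
  then show ?case by (intro exI[of _ "\<lambda>i. (1 + \<beta>) * c i - \<beta> * d i"]) blast
qed

lemma abs_blaschke_le_1:
  assumes "\<And>i. i < n \<Longrightarrow> 0 < T i" "0 < t"
  shows "\<bar>blaschke T n t\<bar> \<le> 1"
  unfolding blaschke_def abs_prod
proof (rule prod_le_1)
  fix i assume "i \<in> {..<n}"
  then have "0 < T i" using assms by simp
  then show "0 \<le> \<bar>(t - T i) / (t + T i)\<bar> \<and> \<bar>(t - T i) / (t + T i)\<bar> \<le> 1" using assms by simp
qed

text \<open>Integrating the resolvent expansion over \<open>t\<close> gives coefficients independent
  of \<open>x\<close>. The remainder is \<open>blaschke T k x\<close> times a Stieltjes integral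
  weighted by \<open>blaschke T k t\<close>; as the weight is at most 1 in modulus for all
  \<open>t > 0\<close>, only the first factor has to be small.\<close>

lemma powr_rational_approx:
  fixes T :: "nat \<Rightarrow> real"
  assumes T: "\<And>i. i < k \<Longrightarrow> 0 < T i" and inj: "inj_on T {..<k}"
    and s: "0 < s" "s < 1" and l: "0 < l" and X: "\<And>x. x \<in> X \<Longrightarrow> l \<le> x"
    and h: "\<And>x. x \<in> X \<Longrightarrow> \<bar>blaschke T k x\<bar> \<le> e"
  shows "\<exists>c. \<forall>x\<in>X. \<bar>x powr (- s) - (\<Sum>i<k. c i / (x + T i))\<bar> \<le> e * l powr (- s)"
proof -
  \<comment> \<open>\<open>K\<close> is \<open>pi / sin (pi * s)\<close>, the normalising constant
    of the Stieltjes representation of \<open>x powr (- s)\<close>.\<close>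
  define K where "K = (LINT y|lborel. stieltjes_kernel s 1 y)"
  have K: "0 < K" unfolding K_def by (rule stieltjes_constant_pos[OF s])
  have "\<forall>j. \<exists>c. j < k \<longrightarrow> (\<forall>z>0. blaschke T j z / (z + T j) = (\<Sum>i<k. c i / (z + T i)))"
    using blaschke_partial_fractions[OF T inj order.refl] by blast
  then obtain c where c: "\<And>j z. j < k \<Longrightarrow> 0 < z \<Longrightarrow> blaschke T j z / (z + T j) = (\<Sum>i<k. c j i / (z + T i))"
    by metis
  define w where "w = (\<lambda>j y. exp ((1 - s) * y) * (2 * T j * blaschke T j (exp y) / (exp y + T j)))"
  have meas: "(\<lambda>y. blaschke T j (exp y)) \<in> borel_measurable lborel" for j
    unfolding blaschke_def by measurable
  have w: "integrable lborel (w j)" if j: "j < k" for j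
  proof (rule Bochner_Integration.integrable_bound)
    show "integrable lborel (\<lambda>y. 2 * T j * stieltjes_kernel s (T j) y)"
      by (intro integrable_mult_right stieltjes_kernel_integral s T j)
    show "w j \<in> borel_measurable lborel" unfolding w_def using meas[of j] by measurable
    show "AE y in lborel. norm (w j y) \<le> norm (2 * T j * stieltjes_kernel s (T j) y)"
    proof (rule AE_I2)
      fix y :: real
      have "\<bar>blaschke T j (exp y)\<bar> \<le> 1" using T j by (intro abs_blaschke_le_1) auto
      then have "\<bar>2 * T j * stieltjes_kernel s (T j) y\<bar> * \<bar>blaschke T j (exp y)\<bar> \<le> \<bar>2 * T j * stieltjes_kernel s (T j) y\<bar> * 1"
        by (intro mult_left_mono) auto
      moreover have "w j y = 2 * T j * stieltjes_kernel s (T j) y * blaschke T j (exp y)"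
        by (simp add: w_def stieltjes_kernel_def)
      ultimately show "norm (w j y) \<le> norm (2 * T j * stieltjes_kernel s (T j) y)"
        by (simp add: abs_mult)
    qed
  qed
  define A where "A = (\<lambda>j. (LINT y|lborel. w j y) / K)"
  show ?thesis
  proof (intro exI[of _ "\<lambda>i. \<Sum>j<k. A j * c j i"] ballI)
    fix x assume x: "x \<in> X"
    then have x0: "0 < x" using X l by fastforce
    define r where "r = (\<Sum>j<k. A j * (blaschke T j x / (x + T j)))"
    have "r = (\<Sum>j<k. A j * (\<Sum>i<k. c j i / (x + T i)))"
      unfolding r_def by (intro sum.cong) (use c x0 in auto)
    also have "\<dots> = (\<Sum>j<k. \<Sum>i<k. A j * c j i / (x + T i))" by (simp add: sum_distrib_left)
    also have "\<dots> = (\<Sum>i<k. \<Sum>j<k. A j * c j i / (x + T i))" by (rule sum.swap)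
    also have "\<dots> = (\<Sum>i<k. (\<Sum>j<k. A j * c j i) / (x + T i))" by (simp add: sum_divide_distrib)
    finally have r: "(\<Sum>i<k. (\<Sum>j<k. A j * c j i) / (x + T i)) = r" ..
    define S where "S = stieltjes_kernel s x"
    have S: "integrable lborel S" "(LINT y|lborel. S y) = x powr (- s) * K"
      unfolding S_def K_def by (rule stieltjes_kernel_integral[OF s x0])+
    have Kr: "K * r = (LINT y|lborel. (\<Sum>j<k. w j y * (blaschke T j x / (x + T j))))"
      by (subst Bochner_Integration.integral_sum)
         (use w K in \<open>auto simp: r_def A_def sum_distrib_left\<close>)
    have id: "(\<Sum>j<k. w j y * (blaschke T j x / (x + T j))) = S y - blaschke T k x * (blaschke T k (exp y) * S y)" for y
    proof -
      have "(\<Sum>j<k. w j y * (blaschke T j x / (x + T j))) =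
        exp ((1 - s) * y) * (\<Sum>j<k. 2 * T j * blaschke T j (exp y) / (exp y + T j) * (blaschke T j x / (x + T j)))"
        by (simp add: w_def sum_distrib_left mult.assoc)
      also have "\<dots> = exp ((1 - s) * y) * ((1 - blaschke T k x * blaschke T k (exp y)) / (exp y + x))"
        by (subst blaschke_resolvent) (use T x0 in auto)
      also have "\<dots> = S y - blaschke T k x * (blaschke T k (exp y) * S y)"
        by (simp add: S_def stieltjes_kernel_def algebra_simps diff_divide_distrib)
      finally show ?thesis .
    qed
    have S0: "0 \<le> S y" for y using x0 by (auto simp: S_def stieltjes_kernel_def)
    have bS: "\<bar>blaschke T k (exp y) * S y\<bar> \<le> S y" for y
      using mult_right_mono[OF abs_blaschke_le_1[of k T "exp y"] S0[of y]] T S0[of y] by (simp add: abs_mult)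
    have B: "integrable lborel (\<lambda>y. blaschke T k (exp y) * S y)"
      by (rule Bochner_Integration.integrable_bound[OF S(1)])
         (use bS S0 meas borel_measurable_integrable[OF S(1)] in \<open>auto intro!: borel_measurable_times\<close>)
    have "K * r = x powr (- s) * K - blaschke T k x * (LINT y|lborel. blaschke T k (exp y) * S y)"
      unfolding Kr id using S B by simp
    then have "K * (x powr (- s) - r) = blaschke T k x * (LINT y|lborel. blaschke T k (exp y) * S y)"
      by (simp add: algebra_simps)
    then have "K * \<bar>x powr (- s) - r\<bar> = \<bar>blaschke T k x\<bar> * \<bar>LINT y|lborel. blaschke T k (exp y) * S y\<bar>"
      using K by (metis abs_mult abs_of_pos)
    also have "\<dots> \<le> e * (K * l powr (- s))"
    proof (rule mult_mono[OF h[OF x]])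
      have "\<bar>LINT y|lborel. blaschke T k (exp y) * S y\<bar> \<le> (LINT y|lborel. \<bar>blaschke T k (exp y) * S y\<bar>)"
        by (rule integral_abs_bound)
      also have "\<dots> \<le> (LINT y|lborel. S y)"
        by (intro integral_mono) (use bS B S in auto)
      also have "\<dots> \<le> K * l powr (- s)"
        unfolding S(2) using X[OF x] l s K by (simp add: powr_mono2')
      finally show "\<bar>LINT y|lborel. blaschke T k (exp y) * S y\<bar> \<le> K * l powr (- s)" .
      show "0 \<le> e" using h[OF x] by linarith
    qed auto
    finally have "K * \<bar>x powr (- s) - r\<bar> \<le> K * (e * l powr (- s))" by (simp add: mult_ac)
    then show "\<bar>x powr (- s) - (\<Sum>i<k. (\<Sum>j<k. A j * c j i) / (x + T i))\<bar> \<le> e * l powr (- s)"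
      unfolding r using K by simp
  qed
qed

subsection \<open>Spectral theory of symmetric matrices\<close>

lemma symmetric_inner:
  fixes A :: "real^'n^'n"
  assumes "transpose A = A"
  shows "x \<bullet> (A *v y) = (A *v x) \<bullet> y"
  using dot_lmul_matrix[of x A y] transpose_matrix_vector[of A x] assms by simp

lemma spd_symmetric: "spd A \<Longrightarrow> transpose A = A"
  and spd_pos: "spd A \<Longrightarrow> x \<noteq> 0 \<Longrightarrow> 0 < x \<bullet> (A *v x)"
  by (auto simp: spd_def)

lemma spd_invertible:
  assumes "spd A"
  shows "invertible A"
  unfolding invertible_left_inverse matrix_left_invertible_ker
  using spd_pos[OF assms] by (metis inner_zero_right less_irrefl)

lemma matrix_inv_vector:
  fixes A :: "'a::field^'n^'n"
  assumes "invertible A"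
  shows "A *v (matrix_inv A *v x) = x" "matrix_inv A *v (A *v x) = x"
proof -
  have "A ** matrix_inv A = mat 1" "matrix_inv A ** A = mat 1"
    using someI_ex[OF assms[unfolded invertible_def]] by (auto simp: matrix_inv_def)
  then show "A *v (matrix_inv A *v x) = x" "matrix_inv A *v (A *v x) = x"
    by (simp_all add: matrix_vector_mul_assoc)
qed

lemma mat_mult_vector: "mat c *v x = c *s (x :: 'a::comm_semiring_1^'n)"
  by (simp add: vec_eq_iff matrix_vector_mult_def mat_def if_distrib[of "\<lambda>a. a * _"] cong: if_cong)

text \<open>The first-order condition at an extremum, without derivatives. The witness
  \<open>t\<close> minimises the quadratic in which \<open>b\<close> is replaced by the positive
  bound \<open>\<bar>b\<bar> + 1\<close>.\<close>

lemma linear_term_zero: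
  fixes a b :: real
  assumes "\<And>t. 0 \<le> 2 * t * a + t\<^sup>2 * b"
  shows "a = 0"
proof (rule ccontr)
  assume "a \<noteq> 0"
  define t where "t = - a / (\<bar>b\<bar> + 1)"
  have p: "0 < \<bar>b\<bar> + 1" by simp
  have "2 * t * a + t\<^sup>2 * b \<le> 2 * t * a + t\<^sup>2 * (\<bar>b\<bar> + 1)" by (intro add_left_mono mult_left_mono) auto
  also have "\<dots> = - (a\<^sup>2 / (\<bar>b\<bar> + 1))"
    using p unfolding t_def by (simp add: power_divide power2_eq_square divide_simps)
  also have "\<dots> < 0" using p \<open>a \<noteq> 0\<close> by simp
  finally show False using assms[of t] by simp
qed

text \<open>A maximiser of the generalized Rayleigh quotient on the unit sphere of \<open>U\<close>
  is a critical point. The equation is tested against \<open>U\<close> only, since \<open>U\<close>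
  need not be invariant under \<open>A\<close>.\<close>

lemma rayleigh_eigenvector:
  fixes A M :: "real^'n^'n"
  assumes A: "transpose A = A" and M: "spd M" and U: "subspace U" "x0 \<in> U" "x0 \<noteq> 0"
  shows "\<exists>v\<in>U. \<exists>c. v \<noteq> 0 \<and> (\<forall>y\<in>U. y \<bullet> (A *v v) = c * (y \<bullet> (M *v v)))"
proof -
  let ?K = "sphere 0 1 \<inter> U"
  define R where "R = (\<lambda>x. x \<bullet> (A *v x) / (x \<bullet> (M *v x)))"
  have Mpos: "0 < x \<bullet> (M *v x)" if "x \<noteq> 0" for x using spd_pos[OF M that] .
  have "compact ?K" by (intro compact_Int_closed compact_sphere closed_subspace U)
  moreover have "inverse (norm x0) *\<^sub>R x0 \<in> ?K" using U by (auto intro: subspace_scale)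
  then have "?K \<noteq> {}" by blast
  moreover have "continuous_on ?K R"
    unfolding R_def by (intro continuous_intros linear_continuous_on matrix_vector_mul_bounded_linear)
      (metis IntD1 Mpos less_irrefl mem_sphere_0 norm_zero zero_neq_one)
  ultimately obtain v where v: "v \<in> ?K" "\<And>x. x \<in> ?K \<Longrightarrow> R x \<le> R v"
    using continuous_attains_sup by meson
  have v0: "v \<noteq> 0" "v \<in> U" using v by auto
  define c where "c = R v"
  define q where "q = (\<lambda>x y. c * (x \<bullet> (M *v y)) - x \<bullet> (A *v y))"
  have q0: "0 \<le> q x x" if x: "x \<in> U" for x
  proof (cases "x = 0")
    case False
    let ?y = "inverse (norm x) *\<^sub>R x"
    have "?y \<in> ?K" using x False U by (auto intro: subspace_scale)
    then have "R ?y \<le> c" unfolding c_def by (rule v(2))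
    moreover have "R ?y = R x" using False by (simp add: R_def matrix_vector_mult_scaleR)
    ultimately show ?thesis using Mpos[OF False] by (simp add: R_def q_def divide_le_eq)
  qed (simp add: q_def)
  have qv: "q v v = 0" using Mpos[OF v0(1)] by (simp add: q_def c_def R_def)
  have "x \<bullet> (A *v y) = y \<bullet> (A *v x)" "x \<bullet> (M *v y) = y \<bullet> (M *v x)" for x y
    using symmetric_inner[OF A, of x y] symmetric_inner[OF spd_symmetric[OF M], of x y]
    by (simp_all only: inner_commute[of _ y])
  then have qs: "q x y = q y x" for x y unfolding q_def by simp
  have "q y v = 0" if y: "y \<in> U" for y
  proof (rule linear_term_zero[where b = "q y y"])
    fix t :: real
    have "0 \<le> q (v + t *\<^sub>R y) (v + t *\<^sub>R y)" using y v0 U by (intro q0 subspace_add subspace_scale)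
    also have "\<dots> = q v v + t * (q v y + q y v) + t\<^sup>2 * q y y"
      by (simp add: q_def matrix_vector_right_distrib matrix_vector_mult_scaleR inner_add_left inner_add_right
          power2_eq_square algebra_simps)
    finally show "0 \<le> 2 * t * q y v + t\<^sup>2 * q y y" by (simp add: qv qs[of v y])
  qed
  then show ?thesis using v0 by (intro bexI[of _ v] exI[of _ c]) (auto simp: q_def)
qed

text \<open>Eigenvectors for different eigenvalues are orthogonal in the inner product of
  \<open>M\<close>. One eigenvector per eigenvalue therefore gives an independent set, which is
  finite; this makes \<open>Min\<close> and \<open>Max\<close> of the spectrum meaningful.\<close>

lemma generalized_eigenvalues:
  fixes S M :: "real^'n^'n"
  assumes S: "spd S" and M: "spd M"
  defines "L \<equiv> matrix_inv M ** S"
  shows "finite (eigenvalues L)" "eigenvalues L \<noteq> {}" "\<And>z. z \<in> eigenvalues L \<Longrightarrow> 0 < z"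
proof -
  note sym = symmetric_inner[OF spd_symmetric[OF M]] symmetric_inner[OF spd_symmetric[OF S]]
  have L: "L *v x = matrix_inv M *v (S *v x)" for x by (simp add: L_def matrix_vector_mul_assoc)
  have eig: "L *v v = z *s v \<longleftrightarrow> S *v v = z *\<^sub>R (M *v v)" for v z
    unfolding L using matrix_inv_vector[OF spd_invertible[OF M]]
    by (metis matrix_vector_mult_scaleR scalar_mult_eq_scaleR)
  show "0 < z" if z: "z \<in> eigenvalues L" for z
  proof -
    obtain v where v: "v \<noteq> 0" "S *v v = z *\<^sub>R (M *v v)" using z by (auto simp: eigenvalues_def eig)
    then have "v \<bullet> (S *v v) = z * (v \<bullet> (M *v v))" by simp
    then show ?thesis using spd_pos[OF S v(1)] spd_pos[OF M v(1)] by (simp add: zero_less_mult_iff)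
  qed
  obtain v c where "v \<noteq> 0" and vc: "\<And>y. y \<bullet> (S *v v) = c * (y \<bullet> (M *v v))"
    using rayleigh_eigenvector[OF spd_symmetric[OF S] M subspace_UNIV, of "axis undefined 1"] by auto
  have "S *v v = c *\<^sub>R (M *v v)"
    by (rule vector_eq_ldot[THEN iffD1]) (simp add: vc)
  with \<open>v \<noteq> 0\<close> show "eigenvalues L \<noteq> {}" using eig by (auto simp: eigenvalues_def)
  define f where "f = (\<lambda>z. SOME v. v \<noteq> 0 \<and> L *v v = z *s v)"
  have f: "f z \<noteq> 0 \<and> L *v f z = z *s f z" if "z \<in> eigenvalues L" for z
    unfolding f_def by (rule someI_ex) (use that in \<open>simp add: eigenvalues_def\<close>)
  have inj: "inj_on f (eigenvalues L)"
    by (rule inj_onI) (metis f vector_mul_rcancel)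
  have orth: "f z \<bullet> (M *v f w) = 0" if "z \<in> eigenvalues L" "w \<in> eigenvalues L" "z \<noteq> w" for z w
  proof -
    have "w * (f z \<bullet> (M *v f w)) = f z \<bullet> (S *v f w)" using f[OF that(2)] by (simp add: eig)
    also have "\<dots> = (S *v f z) \<bullet> f w" by (rule sym)
    also have "\<dots> = z * (f z \<bullet> (M *v f w))" using f[OF that(1)] by (simp add: eig sym(1))
    finally show ?thesis using that by simp
  qed
  have "independent (f ` eigenvalues L)"
    unfolding dependent_def
  proof safe
    fix z assume z: "z \<in> eigenvalues L" and sp: "f z \<in> span (f ` eigenvalues L - {f z})"
    have "f z \<bullet> (M *v x) = 0" if "x \<in> span (f ` eigenvalues L - {f z})" for x
      using that
    proof (induction rule: span_induct)
      case base show ?case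
        by (auto simp: subspace_def matrix_vector_right_distrib matrix_vector_mult_scaleR inner_add_right)
    next
      case (step x)
      then obtain w where "w \<in> eigenvalues L" "x = f w" "w \<noteq> z" by auto
      then show ?case using orth z by auto
    qed
    from this[OF sp] show False using spd_pos[OF M, of "f z"] f[OF z] by auto
  qed
  then have "finite (f ` eigenvalues L)" using independent_bound by blast
  then show "finite (eigenvalues L)" using inj by (simp add: finite_image_iff)
qed

definition orthonormal_eigenbasis :: "real^'n^'n \<Rightarrow> (real^'n) set \<Rightarrow> (real^'n \<Rightarrow> real) \<Rightarrow> bool" where
  "orthonormal_eigenbasis A B \<nu> \<longleftrightarrow> finite B \<and> pairwise orthogonal B \<and> (\<forall>v\<in>B. norm v = 1) \<and>
     span B = UNIV \<and> (\<forall>v\<in>B. A *v v = \<nu> v *\<^sub>R v)"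

lemma spd_mat_1: "spd (mat 1 :: real^'n^'n)"
  by (simp add: spd_def)

text \<open>An orthonormal set of eigenvectors of largest size spans the space: otherwise its
  orthogonal complement, which \<open>A\<close> maps into itself, would contain a further
  eigenvector.\<close>

lemma spectral_theorem:
  fixes A :: "real^'n^'n"
  assumes A: "transpose A = A"
  obtains B \<nu> where "orthonormal_eigenbasis A B \<nu>"
proof -
  define P where "P = (\<lambda>B. pairwise orthogonal B \<and> (\<forall>v\<in>B. norm v = 1) \<and> (\<forall>v\<in>B. \<exists>c. A *v v = c *\<^sub>R v))"
  have ind: "independent B" if "P B" for B
    using that by (intro pairwise_orthogonal_independent) (auto simp: P_def)
  have "P {}" by (simp add: P_def)
  moreover have "\<forall>B. P B \<longrightarrow> card B < Suc DIM(real^'n)"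
    using ind independent_bound[where 'a = "real^'n"] by (auto simp: less_Suc_eq_le)
  ultimately obtain B where B: "P B" "\<And>B'. P B' \<Longrightarrow> card B' \<le> card B"
    using ex_has_greatest_nat[of P "{}" card] by blast
  have fin: "finite B" using ind[OF B(1)] independent_bound[where 'a = "real^'n"] by blast
  define U where "U = {y. \<forall>x\<in>B. orthogonal x y}"
  have U: "subspace U" unfolding U_def by (rule subspace_orthogonal_to_vectors)
  have "span B = UNIV"
  proof (rule ccontr)
    assume "span B \<noteq> UNIV"
    then obtain x0 where x0: "x0 \<noteq> 0" "x0 \<in> U"
      using span_not_univ_subset_hyperplane[of B] span_superset[of B]
      by (fastforce simp: U_def orthogonal_def inner_commute)
    obtain v c where v: "v \<in> U" "v \<noteq> 0" and vc: "\<And>y. y \<in> U \<Longrightarrow> y \<bullet> (A *v v) = c * (y \<bullet> v)"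
      using rayleigh_eigenvector[OF A spd_mat_1 U x0(2,1)] by auto
    have "A *v v \<in> U"
      unfolding U_def
    proof (intro CollectI ballI)
      fix x assume x: "x \<in> B"
      then obtain d where "A *v x = d *\<^sub>R x" using B(1) by (auto simp: P_def)
      then have "x \<bullet> (A *v v) = d * (x \<bullet> v)" by (simp add: symmetric_inner[OF A])
      then show "orthogonal x (A *v v)" using v(1) x by (auto simp: U_def orthogonal_def)
    qed
    then have w: "A *v v - c *\<^sub>R v \<in> U" using v(1) U by (intro subspace_diff subspace_scale)
    have "(A *v v - c *\<^sub>R v) \<bullet> (A *v v - c *\<^sub>R v) = 0"
      using vc[OF w] by (simp add: inner_diff_right)
    then have ev: "A *v v = c *\<^sub>R v" by simp
    define e where "e = inverse (norm v) *\<^sub>R v"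
    have e: "norm e = 1" "A *v e = c *\<^sub>R e" "e \<in> U"
      using v U by (auto simp: e_def ev matrix_vector_mult_scaleR intro: subspace_scale)
    have "e \<notin> B" using e by (auto simp: U_def orthogonal_def norm_eq_1)
    moreover have "P (insert e B)"
      using B(1) e by (auto simp: P_def pairwise_insert U_def orthogonal_commute)
    ultimately show False using B(2)[of "insert e B"] fin by simp
  qed
  moreover obtain \<nu> where "\<forall>v\<in>B. A *v v = \<nu> v *\<^sub>R v" using B(1) unfolding P_def by metis
  ultimately show thesis using that[of B \<nu>] fin B(1) by (simp add: orthonormal_eigenbasis_def P_def)
qed

section \<open>Functions of a symmetric matrix in an eigenbasis\<close>

definition spectral_apply :: "(real^'n) set \<Rightarrow> (real^'n \<Rightarrow> real) \<Rightarrow> (real \<Rightarrow> real) \<Rightarrow> real^'n \<Rightarrow> real^'n" where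
  "spectral_apply B \<nu> g x = (\<Sum>v\<in>B. (g (\<nu> v) * (v \<bullet> x)) *\<^sub>R v)"

lemma eigenbasis_expand:
  assumes "orthonormal_eigenbasis A B \<nu>"
  shows "(\<Sum>v\<in>B. (v \<bullet> x) *\<^sub>R v) = x"
  using orthonormal_basis_expand[of B x] assms by (simp add: orthonormal_eigenbasis_def inner_commute)

lemma norm_eigenbasis_sum:
  assumes "orthonormal_eigenbasis A B \<nu>"
  shows "(norm (\<Sum>v\<in>B. c v *\<^sub>R v))\<^sup>2 = (\<Sum>v\<in>B. (c v)\<^sup>2)"
proof -
  have "(norm (\<Sum>v\<in>B. c v *\<^sub>R v))\<^sup>2 = (\<Sum>v\<in>B. (norm (c v *\<^sub>R v))\<^sup>2)"
    using assms by (intro norm_sum_Pythagorean)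
      (auto simp: orthonormal_eigenbasis_def pairwise_def orthogonal_def)
  then show ?thesis using assms by (simp add: orthonormal_eigenbasis_def)
qed

lemma norm_spectral_apply_le:
  assumes B: "orthonormal_eigenbasis A B \<nu>" and g: "\<And>v. v \<in> B \<Longrightarrow> \<bar>g (\<nu> v)\<bar> \<le> e" and e: "0 \<le> e"
  shows "norm (spectral_apply B \<nu> g x) \<le> e * norm x"
proof (rule power2_le_imp_le)
  have "(norm (spectral_apply B \<nu> g x))\<^sup>2 = (\<Sum>v\<in>B. (g (\<nu> v) * (v \<bullet> x))\<^sup>2)"
    unfolding spectral_apply_def by (rule norm_eigenbasis_sum[OF B])
  also have "\<dots> \<le> (\<Sum>v\<in>B. e\<^sup>2 * (v \<bullet> x)\<^sup>2)"
    using g e by (intro sum_mono) (auto simp: power_mult_distrib abs_le_square_iff[symmetric] intro!: mult_right_mono)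
  also have "\<dots> = e\<^sup>2 * (norm x)\<^sup>2"
    using norm_eigenbasis_sum[OF B, of "\<lambda>v. v \<bullet> x"] by (simp add: eigenbasis_expand[OF B] sum_distrib_left)
  finally show "(norm (spectral_apply B \<nu> g x))\<^sup>2 \<le> (e * norm x)\<^sup>2" by (simp add: power_mult_distrib)
qed (use e in auto)

lemma spectral_apply_diff:
  "spectral_apply B \<nu> (\<lambda>z. g z - h z) x = spectral_apply B \<nu> g x - spectral_apply B \<nu> h x"
  by (simp add: spectral_apply_def sum_subtractf[symmetric] left_diff_distrib scaleR_left_diff_distrib)

lemma spectral_apply_sum:
  "spectral_apply B \<nu> (\<lambda>z. \<Sum>i\<in>I. c i * g i z) x = (\<Sum>i\<in>I. c i *\<^sub>R spectral_apply B \<nu> (g i) x)"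
proof -
  have "spectral_apply B \<nu> (\<lambda>z. \<Sum>i\<in>I. c i * g i z) x = (\<Sum>v\<in>B. \<Sum>i\<in>I. (c i * (g i (\<nu> v) * (v \<bullet> x))) *\<^sub>R v)"
    by (simp add: spectral_apply_def sum_distrib_right scaleR_sum_left mult.assoc)
  also have "\<dots> = (\<Sum>i\<in>I. \<Sum>v\<in>B. (c i * (g i (\<nu> v) * (v \<bullet> x))) *\<^sub>R v)" by (rule sum.swap)
  finally show ?thesis by (simp add: spectral_apply_def scaleR_sum_right)
qed

lemma spectral_apply_resolvent:
  assumes A: "transpose A = A" and B: "orthonormal_eigenbasis A B \<nu>"
    and t: "\<And>v. v \<in> B \<Longrightarrow> \<nu> v + t \<noteq> 0" and y: "(mat t + A) *v y = x"
  shows "spectral_apply B \<nu> (\<lambda>z. 1 / (z + t)) x = y"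
proof -
  have "1 / (\<nu> v + t) * (v \<bullet> x) = v \<bullet> y" if v: "v \<in> B" for v
  proof -
    have "v \<bullet> x = t * (v \<bullet> y) + v \<bullet> (A *v y)"
      by (simp add: y[symmetric] matrix_vector_mult_add_rdistrib mat_mult_vector scalar_mult_eq_scaleR inner_add_right)
    also have "v \<bullet> (A *v y) = \<nu> v * (v \<bullet> y)"
      using B v by (simp add: symmetric_inner[OF A] orthonormal_eigenbasis_def)
    finally have "v \<bullet> x = (\<nu> v + t) * (v \<bullet> y)" by (simp add: algebra_simps)
    then show ?thesis using t[OF v] by simp
  qed
  then have "spectral_apply B \<nu> (\<lambda>z. 1 / (z + t)) x = (\<Sum>v\<in>B. (v \<bullet> y) *\<^sub>R v)"
    unfolding spectral_apply_def by (intro sum.cong) auto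
  then show ?thesis by (simp add: eigenbasis_expand[OF B])
qed

lemma eigenbasis_rayleigh:
  assumes A: "transpose A = A" and B: "orthonormal_eigenbasis A B \<nu>"
    and ab: "\<And>v. v \<in> B \<Longrightarrow> a \<le> \<nu> v \<and> \<nu> v \<le> b"
  shows "a * (x \<bullet> x) \<le> x \<bullet> (A *v x)" "x \<bullet> (A *v x) \<le> b * (x \<bullet> x)"
proof -
  have 1: "x \<bullet> x = (\<Sum>v\<in>B. (v \<bullet> x)\<^sup>2)"
    using norm_eigenbasis_sum[OF B, of "\<lambda>v. v \<bullet> x"] by (simp add: eigenbasis_expand[OF B] power2_norm_eq_inner)
  have "x \<bullet> (A *v x) = (A *v x) \<bullet> (\<Sum>v\<in>B. (v \<bullet> x) *\<^sub>R v)" by (simp add: eigenbasis_expand[OF B] inner_commute)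
  also have "\<dots> = (\<Sum>v\<in>B. (v \<bullet> x) * (x \<bullet> (A *v v)))"
    by (simp add: inner_sum_right symmetric_inner[OF A])
  also have "\<dots> = (\<Sum>v\<in>B. \<nu> v * (v \<bullet> x)\<^sup>2)"
    using B by (intro sum.cong) (auto simp: orthonormal_eigenbasis_def power2_eq_square inner_commute)
  finally have 2: "x \<bullet> (A *v x) = (\<Sum>v\<in>B. \<nu> v * (v \<bullet> x)\<^sup>2)" .
  show "a * (x \<bullet> x) \<le> x \<bullet> (A *v x)" "x \<bullet> (A *v x) \<le> b * (x \<bullet> x)"
    unfolding 1 2 sum_distrib_left using ab by (auto intro!: sum_mono mult_right_mono)
qed

section \<open>Orthonormal columns and Galerkin projection\<close>

lemma span_columns_eq_range:
  fixes V :: "real^'m^'n"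
  shows "span (columns V) = range ((*v) V)"
proof
  show "range ((*v) V) \<subseteq> span (columns V)" using matrix_vector_mult_in_columnspace by blast
  have "subspace (range ((*v) V))" by (intro linear_subspace_image subspace_UNIV) auto
  moreover have "columns V \<subseteq> range ((*v) V)"
    by (auto simp: columns_def matrix_vector_mult_basis[symmetric])
  ultimately show "span (columns V) \<subseteq> range ((*v) V)" by (rule span_minimal[rotated])
qed

lemma orthonormal_columns:
  fixes V :: "real^'m^'n"
  assumes V: "transpose V ** V = mat 1"
  shows "transpose V *v (V *v x) = x" "(V *v x) \<bullet> (V *v y) = x \<bullet> y" "norm (V *v x) = norm x"
    "norm (transpose V *v z) \<le> norm z" "dim (span (columns V)) = CARD('m)"
proof -
  show 1: "transpose V *v (V *v x) = x" for x by (simp only: matrix_vector_mul_assoc V matrix_vector_mul_lid)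
  show 2: "(V *v x) \<bullet> (V *v y) = x \<bullet> y" for x y
    using dot_lmul_matrix[of "V *v x" V y] 1[of x] transpose_matrix_vector[of V "V *v x"] by simp
  then show 3: "norm (V *v x) = norm x" for x by (simp add: norm_eq_sqrt_inner)
  show "norm (transpose V *v z) \<le> norm z"
  proof (cases "transpose V *v z = 0")
    case False
    have "(norm (transpose V *v z))\<^sup>2 = z \<bullet> (V *v (transpose V *v z))"
      using dot_lmul_matrix[of z V "transpose V *v z"] by (simp add: power2_norm_eq_inner)
    also have "\<dots> \<le> norm z * norm (transpose V *v z)" using norm_cauchy_schwarz[of z] 3 by metis
    finally show ?thesis using False by (simp add: power2_eq_square)
  qed simp
  have "inj ((*v) V)" by (rule injI) (metis 1)
  then show "dim (span (columns V)) = CARD('m)"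
    by (simp add: full_rank_injective[symmetric] column_rank_def)
qed

text \<open>A resolvent equation whose solution lies in the range of \<open>V\<close> is solved
  exactly by the compressed matrix.\<close>

lemma galerkin_resolvent:
  fixes V :: "real^'m^'n"
  assumes V: "transpose V ** V = mat 1" and y: "(mat t + L) *v (V *v y) = b"
  shows "(mat t + transpose V ** L ** V) *v y = transpose V *v b"
proof -
  have "transpose V *v b = transpose V *v (t *\<^sub>R (V *v y)) + transpose V *v (L *v (V *v y))"
    by (simp only: y[symmetric] matrix_vector_mult_add_rdistrib mat_mult_vector scalar_mult_eq_scaleR matrix_vector_right_distrib)
  also have "\<dots> = t *\<^sub>R y + (transpose V ** L ** V) *v y"
    by (simp only: matrix_vector_mult_scaleR matrix_vector_mul_assoc matrix_mul_assoc V matrix_vector_mul_lid)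
  finally show ?thesis by (simp only: matrix_vector_mult_add_rdistrib mat_mult_vector scalar_mult_eq_scaleR)
qed

text \<open>Distinctness of the snapshot points is forced by the \<open>k + 1\<close> orthonormal
  columns. Monotonicity of \<open>dn\<close> would not cover \<open>\<delta> = 1\<close>, where all
  finite points coincide.\<close>

lemma span_snapshots_card:
  assumes V: "orthonormal_basis_of (V :: real^'m^'n) (reduced_space L b t k)" and m: "CARD('m) = k + 1"
  shows "inj_on t {0..k}" "dim (reduced_space L b t k) = k + 1"
proof -
  show d: "dim (reduced_space L b t k) = k + 1"
    using V orthonormal_columns(5)[of V] m by (auto simp: orthonormal_basis_of_def)
  have "k + 1 \<le> card ((\<lambda>j. snapshot L b (t j)) ` {0..k})"
    using d dim_le_card'[of "(\<lambda>j. snapshot L b (t j)) ` {0..k}"] by (simp add: reduced_space_def)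
  then have "inj_on (\<lambda>j. snapshot L b (t j)) {0..k}"
    using card_image_le[of "{0..k}" "\<lambda>j. snapshot L b (t j)"] by (intro eq_card_imp_inj_on) auto
  then show "inj_on t {0..k}" by (auto simp: inj_on_def)
qed

subsection \<open>Matrix functions\<close>

text \<open>Each derivative lowers the multiplicity of the root by one; characteristic zero keeps a
  nonzero cofactor nonzero.\<close>

lemma higher_pderiv_linear_power:
  fixes u :: "'a::field_char_0 poly"
  shows "\<exists>u'. (pderiv ^^ i) ([:- a, 1:] ^ (n + i) * u) = [:- a, 1:] ^ n * u' \<and> (poly u a \<noteq> 0 \<longrightarrow> poly u' a \<noteq> 0)"
proof (induction i arbitrary: u)
  case (Suc i)
  define v where "v = smult (of_nat (Suc (n + i))) u + [:- a, 1:] * pderiv u"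
  have "pderiv ([:- a, 1:] ^ (n + Suc i) * u) = [:- a, 1:] ^ (n + i) * v"
    by (simp add: pderiv_mult pderiv_power_Suc v_def pderiv_pCons algebra_simps del: power_Suc)
       (simp add: algebra_simps)
  moreover have "poly v a \<noteq> 0" if "poly u a \<noteq> 0"
    using that by (simp add: v_def del: of_nat_Suc)
  ultimately show ?case using Suc.IH[of v] by (auto simp: funpow_Suc_right simp del: funpow.simps)
qed auto

text \<open>Ensures that the description in \<open>mat_fun\<close> is satisfiable. At a new point
  \<open>a\<close> the orders are treated one by one: the correction \<open>r * w\<close> vanishes
  to order \<open>N\<close> at the old points and to order exactly \<open>n\<close> at
  \<open>a\<close>, so it adjusts the derivative of order \<open>n\<close> and preserves the
  conditions already met.\<close>

lemma hermite_interpolation: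
  fixes c :: "'a::field_char_0 \<Rightarrow> nat \<Rightarrow> 'a"
  assumes "finite Z"
  shows "\<exists>p. \<forall>z\<in>Z. \<forall>i<N. poly ((pderiv ^^ i) p) z = c z i"
  using assms
proof (induction Z)
  case (insert a Z)
  obtain p where p: "\<forall>z\<in>Z. \<forall>i<N. poly ((pderiv ^^ i) p) z = c z i" using insert.IH by blast
  define w where "w = (\<Prod>z\<in>Z. [:- z, 1:] ^ N)"
  have wa: "poly w a \<noteq> 0" using insert.hyps by (auto simp: w_def poly_prod)
  have wz: "poly ((pderiv ^^ i) (r * w)) z = 0" if "z \<in> Z" "i < N" for z i r
  proof -
    have "w = [:- z, 1:] ^ ((N - i) + i) * (\<Prod>z\<in>Z - {z}. [:- z, 1:] ^ N)"
      using that insert.hyps by (simp add: w_def prod.remove)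
    then have "r * w = [:- z, 1:] ^ ((N - i) + i) * (r * (\<Prod>z\<in>Z - {z}. [:- z, 1:] ^ N))"
      by (simp only: mult_ac)
    then obtain u where "(pderiv ^^ i) (r * w) = [:- z, 1:] ^ (N - i) * u"
      using higher_pderiv_linear_power[of i z "N - i"] by metis
    then show ?thesis using that by simp
  qed
  have "\<exists>q. (\<forall>z\<in>Z. \<forall>i<N. poly ((pderiv ^^ i) q) z = c z i) \<and> (\<forall>i<n. poly ((pderiv ^^ i) q) a = c a i)" for n
  proof (induction n)
    case 0
    show ?case using p by auto
  next
    case (Suc n)
    then obtain q where q: "\<forall>z\<in>Z. \<forall>i<N. poly ((pderiv ^^ i) q) z = c z i"
      "\<forall>i<n. poly ((pderiv ^^ i) q) a = c a i" by blast
    define r where "r = [:- a, 1:] ^ n"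
    have low: "poly ((pderiv ^^ i) (r * w)) a = 0" if "i < n" for i
    proof -
      obtain u where "(pderiv ^^ i) ([:- a, 1:] ^ ((n - i) + i) * w) = [:- a, 1:] ^ (n - i) * u"
        using higher_pderiv_linear_power[of i a "n - i" w] by blast
      then show ?thesis using that by (simp add: r_def)
    qed
    obtain u where "(pderiv ^^ n) ([:- a, 1:] ^ (0 + n) * w) = [:- a, 1:] ^ 0 * u" "poly u a \<noteq> 0"
      using higher_pderiv_linear_power[of n a 0 w] wa by blast
    then have top: "poly ((pderiv ^^ n) (r * w)) a \<noteq> 0" by (simp add: r_def)
    define \<beta> where "\<beta> = (c a n - poly ((pderiv ^^ n) q) a) / poly ((pderiv ^^ n) (r * w)) a"
    have "poly ((pderiv ^^ i) (q + smult \<beta> (r * w))) x =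
       poly ((pderiv ^^ i) q) x + \<beta> * poly ((pderiv ^^ i) (r * w)) x" for i x
      by (simp add: higher_pderiv_add higher_pderiv_smult)
    then show ?case using q wz low top
      by (intro exI[of _ "q + smult \<beta> (r * w)"]) (auto simp: \<beta>_def less_Suc_eq)
  qed
  from this[of N] show ?case by blast
qed auto

section \<open>Polynomials in a matrix and \<open>mat_fun\<close>\<close>

lemma sum_matrix_vector: "(\<Sum>i\<in>I. M i) *v x = (\<Sum>i\<in>I. M i *v x)"
  by (induction I rule: infinite_finite_induct) (auto simp: matrix_vector_mult_add_rdistrib)

lemma matpow_simps [simp]: "matpow A 0 = mat 1" "matpow A (Suc i) = A ** matpow A i"
  by (simp_all add: matpow_def)

lemma poly_mat_vector:
  assumes "degree p \<le> n"
  shows "poly_mat p A *v x = (\<Sum>i\<le>n. coeff p i *s (matpow A i *v x))"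
proof -
  have "poly_mat p A *v x = (\<Sum>i\<le>degree p. coeff p i *s (matpow A i *v x))"
    by (simp add: poly_mat_def sum_matrix_vector matrix_vector_mul_assoc[symmetric] mat_mult_vector)
  also have "\<dots> = (\<Sum>i\<le>n. coeff p i *s (matpow A i *v x))"
    using assms by (intro sum.mono_neutral_left) (auto simp: coeff_eq_0)
  finally show ?thesis .
qed

lemma poly_mat_eigenvector:
  fixes A :: "'a::field^'n^'n"
  assumes "A *v w = z *s w"
  shows "poly_mat p A *v w = poly p z *s w"
proof -
  have "matpow A i *v w = z ^ i *s w" for i
    by (induction i)
       (simp_all add: matrix_vector_mul_assoc[symmetric] vector_scalar_commute assms vector_smult_assoc mult.commute)
  then have "poly_mat p A *v w = (\<Sum>i\<le>degree p. (coeff p i * z ^ i) *s w)"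
    by (simp add: poly_mat_vector[OF order.refl] vector_smult_assoc)
  also have "\<dots> = poly p z *s w"
    by (simp add: poly_altdef vec_eq_iff sum_distrib_right)
  finally show ?thesis .
qed

lemma cvec_scaleR: "cvec (c *\<^sub>R x) = complex_of_real c *s cvec x"
  and cvec_sum: "cvec (\<Sum>i\<in>I. f i) = (\<Sum>i\<in>I. cvec (f i))"
  and cvec_diff: "cvec (x - y) = cvec x - cvec y"
  and cmat_cvec: "cmat A *v cvec x = cvec (A *v x)"
  and norm_cvec: "norm (cvec x) = norm x"
  by (simp_all add: cvec_def cmat_def vec_eq_iff matrix_vector_mult_def map_matrix_def norm_vec_def)

lemma matrix_eq_on_cvec:
  assumes "\<And>x. M *v cvec x = N *v cvec x"
  shows "M = N"
proof -
  have "(M *v cvec (axis j 1)) $ i = M $ i $ j" for M :: "complex^'n^'m" and i j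
    by (simp add: matrix_vector_mult_def cvec_def axis_def if_distrib[of complex_of_real] if_distrib[of "\<lambda>x. _ * x"] cong: if_cong)
  then show ?thesis using assms by (metis (no_types) vec_eq_iff)
qed

text \<open>On an eigenbasis a polynomial in \<open>A\<close> is determined by its values at the
  eigenvalues, so all interpolating polynomials give the same matrix and \<open>THE\<close> is well
  defined.\<close>

lemma mat_fun_symmetric:
  fixes A :: "real^'n^'n"
  assumes B: "orthonormal_eigenbasis A B \<nu>"
    and g: "\<And>v. v \<in> B \<Longrightarrow> g (complex_of_real (\<nu> v)) = complex_of_real (h (\<nu> v))"
  shows "mat_fun g (cmat A) *v cvec x = cvec (spectral_apply B \<nu> h x)"
proof -
  have evec: "cmat A *v cvec v = complex_of_real (\<nu> v) *s cvec v" if "v \<in> B" for v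
    using B that by (simp add: cmat_cvec orthonormal_eigenbasis_def cvec_scaleR)
  have act: "poly_mat p (cmat A) *v cvec x = (\<Sum>v\<in>B. (complex_of_real (v \<bullet> x) * poly p (complex_of_real (\<nu> v))) *s cvec v)" for p x
  proof -
    have "poly_mat p (cmat A) *v cvec x = poly_mat p (cmat A) *v cvec (\<Sum>v\<in>B. (v \<bullet> x) *\<^sub>R v)"
      by (simp only: eigenbasis_expand[OF B])
    also have "\<dots> = (\<Sum>v\<in>B. complex_of_real (v \<bullet> x) *s (poly_mat p (cmat A) *v cvec v))"
      by (simp add: cvec_sum cvec_scaleR vec.linear_sum vector_scalar_commute linear_sum[OF matrix_vector_mul_linear])
    also have "\<dots> = (\<Sum>v\<in>B. (complex_of_real (v \<bullet> x) * poly p (complex_of_real (\<nu> v))) *s cvec v)"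
      by (intro sum.cong) (auto simp: poly_mat_eigenvector[OF evec] vector_smult_assoc)
    finally show ?thesis .
  qed
  have fin: "finite B" using B by (simp add: orthonormal_eigenbasis_def)
  have sub: "eigenvalues (cmat A) \<subseteq> complex_of_real ` \<nu> ` B"
  proof
    fix z assume "z \<in> eigenvalues (cmat A)"
    then obtain w where w: "w \<noteq> 0" "cmat A *v w = z *s w" by (auto simp: eigenvalues_def)
    \<comment> \<open>This polynomial annihilates the matrix, so every complex eigenvalue is a root
      of it and hence one of the real \<open>\<nu> v\<close>.\<close>
    define p where "p = (\<Prod>v\<in>B. [:- complex_of_real (\<nu> v), 1:])"
    have "poly p (complex_of_real (\<nu> v)) = 0" if "v \<in> B" for v
      using that fin by (auto simp: p_def poly_prod)
    then have "poly_mat p (cmat A) = 0"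
      by (intro matrix_eq_on_cvec) (simp add: act)
    then have "poly p z *s w = 0" using poly_mat_eigenvector[OF w(2), of p] by simp
    then have "poly p z = 0" using w(1) by (simp add: vec_eq_iff) metis
    then show "z \<in> complex_of_real ` \<nu> ` B" using fin by (auto simp: p_def poly_prod)
  qed
  have mem: "complex_of_real (\<nu> v) \<in> eigenvalues (cmat A)" if "v \<in> B" for v
  proof -
    have "norm (cvec v) = 1" using B that by (simp add: norm_cvec orthonormal_eigenbasis_def)
    then show ?thesis using evec[OF that] by (auto simp: eigenvalues_def intro!: exI[of _ "cvec v"])
  qed
  let ?H = "\<lambda>p. \<forall>z\<in>eigenvalues (cmat A). \<forall>i<CARD('n). poly ((pderiv ^^ i) p) z = (deriv ^^ i) g z"
  have val: "poly_mat p (cmat A) *v cvec x = cvec (spectral_apply B \<nu> h x)" if p: "?H p" for p x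
  proof -
    have "poly p (complex_of_real (\<nu> v)) = complex_of_real (h (\<nu> v))" if "v \<in> B" for v
      using p mem[OF that] g[OF that] zero_less_card_finite[where 'a = 'n] by force
    then show ?thesis
      unfolding act spectral_apply_def cvec_sum cvec_scaleR
      by (intro sum.cong) (auto simp: mult.commute)
  qed
  obtain p where p: "?H p"
    using hermite_interpolation[OF finite_subset[OF sub], of "CARD('n)" "\<lambda>z i. (deriv ^^ i) g z"] fin by auto
  have "mat_fun g (cmat A) = poly_mat p (cmat A)"
    unfolding mat_fun_def
  proof (rule the_equality)
    show "\<exists>q. poly_mat p (cmat A) = poly_mat q (cmat A) \<and> ?H q" using p by blast
    fix M assume "\<exists>q. M = poly_mat q (cmat A) \<and> ?H q"
    then obtain q where q: "M = poly_mat q (cmat A)" "?H q" by blast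
    show "M = poly_mat p (cmat A)"
      unfolding q(1) by (rule matrix_eq_on_cvec) (simp only: val[OF p] val[OF q(2)])
  qed
  then show ?thesis using val[OF p] by simp
qed

subsection \<open>Rational Krylov spaces\<close>

lemma matpow_commute: "matpow A i ** A = A ** matpow A i"
  by (induction i) (simp_all add: matrix_mul_assoc[symmetric])

lemma poly_mat_linear_factor:
  fixes A :: "'a::field^'n^'n"
  shows "poly_mat ([:t, 1:] * p) A *v x = poly_mat p A *v ((mat t + A) *v x)"
proof -
  define n where "n = degree p"
  have d: "degree ([:t, 1:] * p) \<le> Suc n"
    using degree_mult_le[of "[:t, 1:]" p] by (simp add: n_def)
  have c: "coeff ([:t, 1:] * p) i = t * coeff p i + coeff (pCons 0 p) i" for i by simp
  have "poly_mat ([:t, 1:] * p) A *v x =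
      (\<Sum>i\<le>Suc n. t *s (coeff p i *s (matpow A i *v x))) + (\<Sum>i\<le>Suc n. coeff (pCons 0 p) i *s (matpow A i *v x))"
    unfolding poly_mat_vector[OF d] c by (simp only: vector_sadd_rdistrib vector_smult_assoc sum.distrib)
  also have "(\<Sum>i\<le>Suc n. coeff (pCons 0 p) i *s (matpow A i *v x)) = (\<Sum>i\<le>n. coeff p i *s (matpow A (Suc i) *v x))"
    by (simp only: sum.atMost_Suc_shift coeff_pCons_0 coeff_pCons_Suc vector_smult_lzero add_0)
  also have "\<dots> = poly_mat p A *v (A *v x)"
  proof -
    have "matpow A i *v (A *v x) = matpow A (Suc i) *v x" for i
      by (simp only: matrix_vector_mul_assoc matpow_commute matpow_simps)
    then show ?thesis by (simp only: poly_mat_vector[OF order.refl] n_def)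
  qed
  also have "(\<Sum>i\<le>Suc n. t *s (coeff p i *s (matpow A i *v x))) = poly_mat p A *v (t *s x)"
    unfolding vector_scalar_commute vec.scale_sum_right[symmetric]
    by (subst poly_mat_vector[of p "Suc n"]) (simp_all add: n_def)
  finally show ?thesis
    by (simp add: matrix_vector_mult_add_rdistrib mat_mult_vector matrix_vector_right_distrib)
qed

lemma poly_mat_prod_injective:
  fixes L :: "real^'n^'n"
  assumes "finite J" "\<And>j v. j \<in> J \<Longrightarrow> (mat (\<tau> j) + L) *v v = 0 \<Longrightarrow> v = 0"
    and "poly_mat (\<Prod>j\<in>J. [:\<tau> j, 1:]) L *v x = 0"
  shows "x = 0"
  using assms
proof (induction J arbitrary: x)
  case empty
  then show ?case by (simp add: poly_mat_vector[of 1 0])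
next
  case (insert j J)
  have *: "poly_mat (\<Prod>j\<in>J. [:\<tau> j, 1:]) L *v ((mat (\<tau> j) + L) *v x) = 0"
    using insert.prems(2) by (simp only: prod.insert[OF insert.hyps] poly_mat_linear_factor)
  have "(mat (\<tau> j) + L) *v x = 0"
    by (rule insert.IH[OF _ *], rule insert.prems(1)[OF insertI2])
  then show ?case by (rule insert.prems(1)[OF insertI1])
qed

lemma poly_mat_in_krylov:
  fixes L :: "real^'n^'n"
  assumes "degree p \<le> k"
  shows "poly_mat p L *v b \<in> span ((\<lambda>i. matpow L i *v b) ` {0..k})"
  unfolding poly_mat_vector[OF assms] scalar_mult_eq_scaleR
  by (intro span_sum span_scale span_base) auto

lemma degree_prod_linear_set:
  fixes \<tau> :: "'b \<Rightarrow> 'a::idom"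
  shows "finite J \<Longrightarrow> degree (\<Prod>j\<in>J. [:\<tau> j, 1:]) = card J"
  by (subst degree_prod_sum_eq) auto

text \<open>Both spaces contain the snapshots; equality is forced by the dimension \<open>k + 1\<close>.\<close>

lemma reduced_space_eq_krylov_space:
  fixes L :: "real^'n^'n" and V :: "real^'m^'n"
  assumes V: "orthonormal_basis_of V (reduced_space L b t k)" and m: "CARD('m) = k + 1"
    and t0: "t 0 = \<infinity>" and t: "\<And>j. 1 \<le> j \<Longrightarrow> j \<le> k \<Longrightarrow> t j = ereal (\<tau> j)"
    and inj: "\<And>j v. 1 \<le> j \<Longrightarrow> j \<le> k \<Longrightarrow> (mat (\<tau> j) + L) *v v = 0 \<Longrightarrow> v = 0"
  shows "pole_poly (\<lambda>j. - t j) k = (\<Prod>j\<in>{1..k}. [:\<tau> j, 1:])"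
    and "reduced_space L b t k = krylov_space L b (\<lambda>j. - t j) k"
proof -
  define q where "q = (\<Prod>j\<in>{1..k}. [:\<tau> j, 1:])"
  \<comment> \<open>The snapshot at infinity contributes no factor, so \<open>q\<close> has degree
    \<open>k\<close> although there are \<open>k + 1\<close> snapshots.\<close>
  have J: "{j. j \<le> k \<and> - t j \<noteq> - \<infinity>} = {1..k}"
  proof -
    have "- t j \<noteq> - \<infinity> \<longleftrightarrow> 1 \<le> j" if "j \<le> k" for j
      using t0 t[of j] that by (cases "j = 0") auto
    then have "j \<in> {j. j \<le> k \<and> - t j \<noteq> - \<infinity>} \<longleftrightarrow> j \<in> {1..k}" for j
      by (cases "j \<le> k") simp_all
    then show ?thesis by blast
  qed
  show q: "pole_poly (\<lambda>j. - t j) k = q"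
    unfolding pole_poly_def q_def J by (rule prod.cong[OF refl]) (simp add: t)
  define Q where "Q = poly_mat q L"
  define X where "X = span ((\<lambda>i. matpow L i *v b) ` {0..k})"
  have inj': "v = 0" if "j \<in> {1..k}" "(mat (\<tau> j) + L) *v v = 0" for j v
    by (rule inj[OF _ _ that(2)]) (use that(1) in simp_all)
  have "invertible Q"
    unfolding invertible_left_inverse matrix_left_invertible_ker Q_def q_def
  proof (intro allI impI)
    fix x assume "poly_mat (\<Prod>j\<in>{1..k}. [:\<tau> j, 1:]) L *v x = 0"
    then show "x = 0" by (rule poly_mat_prod_injective[OF finite_atLeastAtMost, rotated]) (rule inj')
  qed
  note Qinv = matrix_inv_vector[OF this]
  have K: "krylov_space L b (\<lambda>j. - t j) k = (\<lambda>x. matrix_inv Q *v x) ` X"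
    by (simp add: krylov_space_def q Q_def X_def)
  have mem: "w \<in> krylov_space L b (\<lambda>j. - t j) k" if "Q *v w \<in> X" for w
    unfolding K using that Qinv(2)[of w] by (metis image_eqI)
  have "snapshot L b (t j) \<in> krylov_space L b (\<lambda>j. - t j) k" if j: "j \<le> k" for j
  proof (rule mem, cases "j = 0")
    case True
    have "degree q \<le> k" by (simp add: q_def degree_prod_linear_set)
    moreover have "Q *v snapshot L b (t j) = poly_mat q L *v b"
      by (simp add: True t0 snapshot_def Q_def)
    ultimately show "Q *v snapshot L b (t j) \<in> X" by (simp only: X_def poly_mat_in_krylov)
  next
    case False
    then have j1: "1 \<le> j" by simp
    define w where "w = snapshot L b (t j)"
    have inv: "invertible (mat (\<tau> j) + L)"
      unfolding invertible_left_inverse matrix_left_invertible_ker using inj[OF j1 j] by blast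
    have "w = matrix_inv (mat (\<tau> j) + L) *v b"
      by (simp add: w_def snapshot_def t[OF j1 j])
    then have w: "(mat (\<tau> j) + L) *v w = b" by (simp only: matrix_inv_vector(1)[OF inv])
    \<comment> \<open>The factor of \<open>q\<close> for the index \<open>j\<close> undoes the
      resolvent in the snapshot and leaves a polynomial in \<open>L\<close> applied to
      \<open>b\<close>.\<close>
    have "q = [:\<tau> j, 1:] * (\<Prod>j\<in>{1..k} - {j}. [:\<tau> j, 1:])"
      unfolding q_def using j1 j by (intro prod.remove) auto
    then have "Q *v w = poly_mat (\<Prod>j\<in>{1..k} - {j}. [:\<tau> j, 1:]) L *v b"
      unfolding Q_def by (simp only: poly_mat_linear_factor w)
    moreover have "degree (\<Prod>j\<in>{1..k} - {j}. [:\<tau> j, 1:]) \<le> k"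
      using card_Diff1_le[of "{1..k}" j] by (simp add: degree_prod_linear_set)
    ultimately show "Q *v snapshot L b (t j) \<in> X"
      unfolding w_def[symmetric] X_def by (simp only: poly_mat_in_krylov)
  qed
  moreover have sub: "subspace (krylov_space L b (\<lambda>j. - t j) k)"
    unfolding K X_def by (intro linear_subspace_image subspace_span) auto
  ultimately have "reduced_space L b t k \<subseteq> krylov_space L b (\<lambda>j. - t j) k"
    unfolding reduced_space_def by (intro span_minimal) auto
  moreover have "dim (krylov_space L b (\<lambda>j. - t j) k) \<le> dim (reduced_space L b t k)"
  proof -
    have "dim (krylov_space L b (\<lambda>j. - t j) k) \<le> dim X"
      unfolding K by (rule dim_image_le) auto
    also have "\<dots> \<le> card ((\<lambda>i. matpow L i *v b) ` {0..k})"
      unfolding X_def dim_span by (rule dim_le_card') simp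
    also have "\<dots> \<le> k + 1" using card_image_le[of "{0..k}"] by simp
    finally show ?thesis using span_snapshots_card[OF V m] by simp
  qed
  ultimately show "reduced_space L b t k = krylov_space L b (\<lambda>j. - t j) k"
    using sub by (intro subspace_dim_equal) (auto simp: reduced_space_def)
qed

subsection \<open>The error bound\<close>

text \<open>\<open>Suc i\<close> is the index \<open>j\<close> of the theorem, whose points run
  through the nodes backwards, scaled by \<open>a\<close>.\<close>

lemma blaschke_zolotarev:
  assumes a: "0 < a" and k: "0 < k"
  shows "blaschke (\<lambda>i. a * jacobi_dn ((2 * (real k - real (Suc i)) + 1) / (2 * real k) * ellK m) m) k x
    = zolotarev m k (x / a)"
proof -
  let ?g = "\<lambda>i. (x / a - jacobi_dn (node m k i) m) / (x / a + jacobi_dn (node m k i) m)"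
  have "zolotarev m k (x / a) = (\<Prod>i<k. ?g (k - Suc i))"
    unfolding zolotarev_def by (simp only: prod.nat_diff_reindex[of ?g k])
  also have "\<dots> = blaschke (\<lambda>i. a * jacobi_dn ((2 * (real k - real (Suc i)) + 1) / (2 * real k) * ellK m) m) k x"
    unfolding blaschke_def
  proof (rule prod.cong[OF refl])
    fix i assume "i \<in> {..<k}"
    then have "real (k - Suc i) = real k - real (Suc i)" by (intro of_nat_diff) auto
    then have "node m k (k - Suc i) = (2 * (real k - real (Suc i)) + 1) / (2 * real k) * ellK m"
      by (simp add: node_def)
    moreover have "(x / a - d) / (x / a + d) = (x - a * d) / (x + a * d)" for d
    proof -
      have "x / a - d = (x - a * d) / a" "x / a + d = (x + a * d) / a" using a by (simp_all add: field_simps)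
      then show ?thesis using a by simp
    qed
    ultimately show "?g (k - Suc i) =
      (x - a * jacobi_dn ((2 * (real k - real (Suc i)) + 1) / (2 * real k) * ellK m) m) /
      (x + a * jacobi_dn ((2 * (real k - real (Suc i)) + 1) / (2 * real k) * ellK m) m)" by simp
  qed
  finally show ?thesis ..
qed

lemma powr_complex_of_real:
  "0 < x \<Longrightarrow> complex_of_real x powr (- complex_of_real s) = complex_of_real (x powr (- s))"
  using powr_of_real[of x "- s"] by simp

text \<open>Resolvents at the snapshot points are reproduced exactly by the Galerkin projection, so only
  the part of \<open>p\<close> outside the span of these resolvents contributes, once for \<open>L\<close> and once for
  \<open>V\<^sup>T L V\<close>.\<close>

lemma galerkin_error_symmetric:
  fixes L :: "real^'n^'n" and V :: "real^'m^'n"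
  assumes L: "transpose L = L" and V: "transpose V ** V = mat 1"
    and a: "0 < a" and spec: "\<And>z. z \<in> eigenvalues L \<Longrightarrow> a \<le> z \<and> z \<le> b"
    and T: "\<And>i. i < k \<Longrightarrow> 0 < T i"
    and y: "\<And>i. i < k \<Longrightarrow> (mat (T i) + L) *v (V *v y i) = x"
    and approx: "\<And>z. z \<in> {a..b} \<Longrightarrow> \<bar>p z - (\<Sum>i<k. c i / (z + T i))\<bar> \<le> e"
    and g: "\<And>z. z \<in> {a..b} \<Longrightarrow> g (complex_of_real z) = complex_of_real (p z)" and e: "0 \<le> e"
  shows "norm (mat_fun g (cmat L) *v cvec x - galerkin_fun g V L x) \<le> 2 * norm x * e"
proof -
  define H where "H = transpose V ** L ** V"
  have H: "transpose H = H"
    by (simp add: H_def matrix_transpose_mul L transpose_transpose matrix_mul_assoc)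
  obtain B \<nu> where B: "orthonormal_eigenbasis L B \<nu>" using spectral_theorem[OF L] .
  obtain B' \<nu>' where B': "orthonormal_eigenbasis H B' \<nu>'" using spectral_theorem[OF H] .
  have \<nu>: "\<nu> v \<in> {a..b}" if "v \<in> B" for v
  proof -
    have "v \<noteq> 0" "L *v v = \<nu> v *s v"
      using B that by (auto simp: orthonormal_eigenbasis_def scalar_mult_eq_scaleR)
    then show ?thesis using spec by (auto simp: eigenvalues_def)
  qed
  \<comment> \<open>Rayleigh quotients of the compressed matrix are Rayleigh quotients of
    \<open>L\<close>, so its spectrum stays in the same interval.\<close>
  have \<nu>': "\<nu>' w \<in> {a..b}" if w: "w \<in> B'" for w
  proof -
    have w1: "w \<bullet> w = 1" "H *v w = \<nu>' w *\<^sub>R w"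
      using B' w by (auto simp: orthonormal_eigenbasis_def norm_eq_1)
    have "\<nu>' w = w \<bullet> (H *v w)" using w1 by simp
    also have "\<dots> = (V *v w) \<bullet> (L *v (V *v w))"
      using dot_lmul_matrix[of "L *v (V *v w)" V w] transpose_matrix_vector[of V "L *v (V *v w)"]
      by (simp add: H_def matrix_vector_mul_assoc[symmetric] inner_commute)
    finally show ?thesis
      using eigenbasis_rayleigh[OF L B, of a b "V *v w"] \<nu> w1(1) orthonormal_columns(2)[OF V, of w w] by auto
  qed
  define r where "r = (\<lambda>z. \<Sum>i<k. c i * (1 / (z + T i)))"
  have approx': "\<bar>p z - r z\<bar> \<le> e" if "z \<in> {a..b}" for z using approx[OF that] by (simp add: r_def)
  have rL: "spectral_apply B \<nu> (\<lambda>z. 1 / (z + T i)) x = V *v y i" if "i < k" for i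
    by (rule spectral_apply_resolvent[OF L B _ y[OF that]]) (use \<nu> a T[OF that] in force)
  have rH: "spectral_apply B' \<nu>' (\<lambda>z. 1 / (z + T i)) (transpose V *v x) = y i" if "i < k" for i
    by (rule spectral_apply_resolvent[OF H B' _ galerkin_resolvent[OF V y[OF that], folded H_def]])
       (use \<nu>' a T[OF that] in force)
  have exact: "V *v spectral_apply B' \<nu>' r (transpose V *v x) = spectral_apply B \<nu> r x"
  proof -
    have "V *v spectral_apply B' \<nu>' r (transpose V *v x) = V *v (\<Sum>i<k. c i *\<^sub>R y i)"
      unfolding r_def spectral_apply_sum using rH by (intro arg_cong[where f = "(*v) V"] sum.cong) auto
    also have "\<dots> = (\<Sum>i<k. c i *\<^sub>R (V *v y i))"
      by (simp add: linear_sum[OF matrix_vector_mul_linear] matrix_vector_mult_scaleR)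
    also have "\<dots> = spectral_apply B \<nu> r x"
      unfolding r_def spectral_apply_sum using rL by (intro sum.cong) auto
    finally show ?thesis .
  qed
  have fL: "mat_fun g (cmat L) *v cvec x = cvec (spectral_apply B \<nu> p x)"
    by (rule mat_fun_symmetric[OF B]) (rule g[OF \<nu>])
  have fH: "mat_fun g (cmat H) *v cvec z = cvec (spectral_apply B' \<nu>' p z)" for z
    by (rule mat_fun_symmetric[OF B']) (rule g[OF \<nu>'])
  have "mat_fun g (cmat L) *v cvec x - galerkin_fun g V L x =
     cvec (spectral_apply B \<nu> p x - V *v spectral_apply B' \<nu>' p (transpose V *v x))"
    by (simp only: galerkin_fun_def H_def[symmetric] fL fH cmat_cvec cvec_diff)
  also have "spectral_apply B \<nu> p x - V *v spectral_apply B' \<nu>' p (transpose V *v x) =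
     spectral_apply B \<nu> (\<lambda>z. p z - r z) x - V *v spectral_apply B' \<nu>' (\<lambda>z. p z - r z) (transpose V *v x)"
    by (simp only: spectral_apply_diff matrix_vector_mult_diff_distrib exact) simp
  also have "norm (cvec (spectral_apply B \<nu> (\<lambda>z. p z - r z) x - V *v spectral_apply B' \<nu>' (\<lambda>z. p z - r z) (transpose V *v x)))
     \<le> norm (spectral_apply B \<nu> (\<lambda>z. p z - r z) x) + norm (spectral_apply B' \<nu>' (\<lambda>z. p z - r z) (transpose V *v x))"
    unfolding norm_cvec by (rule order.trans[OF norm_triangle_ineq4]) (simp only: orthonormal_columns(3)[OF V] order.refl)
  also have "\<dots> \<le> e * norm x + e * norm (transpose V *v x)"
    by (intro add_mono norm_spectral_apply_le[OF B] norm_spectral_apply_le[OF B'])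
       (use approx' \<nu> \<nu>' e in auto)
  also have "\<dots> \<le> e * norm x + e * norm x"
    using e orthonormal_columns(4)[OF V] by (intro add_left_mono mult_left_mono) auto
  finally show ?thesis by (simp add: mult.commute)
qed

text \<open>The set \<open>\<Sigma>\<close> is chosen as the interval itself. The competitor
  \<open>P\<close> is the numerator of the partial fraction sum over the common denominator, which
  is the pole polynomial.\<close>

lemma galerkin_error_quasi_optimal:
  fixes L :: "real^'n^'n" and V :: "real^'m^'n"
  assumes qo: "quasi_optimal TYPE('m) L x k (complex_of_real ` {a..b}) C"
    and V: "orthonormal_basis_of V (krylov_space L x d k)"
    and d: "\<And>j. j \<le> k \<Longrightarrow> d j \<le> 0"
    and q: "pole_poly d k = (\<Prod>i<k. [:T i, 1:])"
    and a: "0 < a" and T: "\<And>i. i < k \<Longrightarrow> 0 < T i"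
    and approx: "\<And>z. z \<in> {a..b} \<Longrightarrow> \<bar>p z - (\<Sum>i<k. c i / (z + T i))\<bar> \<le> e"
    and g: "\<And>z. z \<in> {a..b} \<Longrightarrow> g (complex_of_real z) = complex_of_real (p z)"
    and ga: "g analytic_on complex_of_real ` {a..b}" and e: "0 \<le> e"
  shows "norm (mat_fun g (cmat L) *v cvec x - galerkin_fun g V L x) \<le> 2 * C * norm x * e"
proof -
  let ?q = "map_poly complex_of_real (pole_poly d k)" and ?E = "complex_of_real ` {a..b}"
  have C: "0 \<le> C" using qo by (simp add: quasi_optimal_def)
  have polyq: "poly ?q (complex_of_real z) = complex_of_real (\<Prod>i<k. z + T i)" for z
  proof -
    have "poly (map_poly complex_of_real p) (complex_of_real z) = complex_of_real (poly p z)" for p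
      by (simp add: poly_altdef degree_map_poly coeff_map_poly)
    then show ?thesis unfolding q by (simp only: poly_prod) (simp add: add.commute)
  qed
  have pos: "0 < (\<Prod>i<k. z + T i)" if "z \<in> {a..b}" for z
    by (rule prod_pos) (use that a T in \<open>force intro: add_pos_pos\<close>)
  have q0: "\<forall>z\<in>?E. poly ?q z \<noteq> 0"
  proof
    fix z assume "z \<in> ?E"
    then obtain w where w: "w \<in> {a..b}" "z = complex_of_real w" by auto
    show "poly ?q z \<noteq> 0" unfolding w(2) polyq using pos[OF w(1)] by (metis less_irrefl of_real_eq_0_iff)
  qed
  define P where "P = (\<Sum>i<k. smult (complex_of_real (c i)) (\<Prod>j\<in>{..<k} - {i}. [:complex_of_real (T j), 1:]))"
  have degP: "degree P \<le> k"
    unfolding P_def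
  proof (rule degree_sum_le)
    fix i assume "i \<in> {..<k}"
    have "degree (\<Prod>j\<in>{..<k} - {i}. [:complex_of_real (T j), 1:]) \<le> k"
      using card_Diff1_le[of "{..<k}" i] by (simp add: degree_prod_linear_set)
    then show "degree (smult (complex_of_real (c i)) (\<Prod>j\<in>{..<k} - {i}. [:complex_of_real (T j), 1:])) \<le> k"
      by (rule order.trans[OF degree_smult_le])
  qed auto
  have val: "g z - poly P z / poly ?q z = complex_of_real (p w - (\<Sum>i<k. c i / (w + T i)))"
    if w: "w \<in> {a..b}" "z = complex_of_real w" for w z
  proof -
    have ne: "w + T i \<noteq> 0" if "i < k" for i using w a T[OF that] by auto
    have "poly P z = complex_of_real (\<Sum>i<k. c i * (\<Prod>j\<in>{..<k} - {i}. w + T j))"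
      by (simp add: P_def poly_sum poly_prod w add.commute)
    also have "(\<Sum>i<k. c i * (\<Prod>j\<in>{..<k} - {i}. w + T j)) = (\<Sum>i<k. c i / (w + T i)) * (\<Prod>i<k. w + T i)"
      unfolding sum_distrib_right
    proof (rule sum.cong[OF refl])
      fix i assume i: "i \<in> {..<k}"
      have "(\<Prod>i<k. w + T i) = (w + T i) * (\<Prod>j\<in>{..<k} - {i}. w + T j)"
        by (rule prod.remove) (use i in auto)
      then show "c i * (\<Prod>j\<in>{..<k} - {i}. w + T j) = c i / (w + T i) * (\<Prod>i<k. w + T i)"
        using ne[of i] i by simp
    qed
    finally have "poly P z / poly ?q z = complex_of_real (\<Sum>i<k. c i / (w + T i))"
      using pos[OF w(1)] by (simp only: polyq w(2) of_real_mult) (simp add: less_imp_neq[symmetric] del: of_real_sum of_real_prod)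
    then show ?thesis using g[OF w(1)] w(2) by simp
  qed
  have "sup_norm ?E (\<lambda>z. g z - poly P z / poly ?q z) \<le> ennreal e"
    unfolding sup_norm_def
  proof (rule SUP_least)
    fix z assume "z \<in> ?E"
    then obtain w where w: "w \<in> {a..b}" "z = complex_of_real w" by auto
    show "ennreal (norm (g z - poly P z / poly ?q z)) \<le> ennreal e"
      unfolding val[OF w] norm_of_real using approx[OF w(1)] by (rule ennreal_leI)
  qed
  then have INF: "(INF p\<in>{p. degree p \<le> k}. sup_norm ?E (\<lambda>z. g z - poly p z / poly ?q z)) \<le> ennreal e"
    using degP by (intro INF_lower2[of P]) auto
  have "ennreal (norm (mat_fun g (cmat L) *v cvec x - galerkin_fun g V L x))
      \<le> ennreal (2 * C * norm x) * (INF p\<in>{p. degree p \<le> k}. sup_norm ?E (\<lambda>z. g z - poly p z / poly ?q z))"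
    using qo[unfolded quasi_optimal_def] d V ga q0 by blast
  also have "\<dots> \<le> ennreal (2 * C * norm x) * ennreal e" by (intro mult_left_mono INF) auto
  also have "\<dots> = ennreal (2 * C * norm x * e)" using C e by (intro ennreal_mult[symmetric]) auto
  finally show ?thesis using C e by (subst (asm) ennreal_le_iff) auto
qed

theorem theorem6:
  fixes S M L :: "real^'n^'n" and b :: "real^'n" and V :: "real^'m^'n"
    and t :: "nat \<Rightarrow> ereal" and k :: nat
    and s C C_star lam1 lamn \<delta> \<delta>' \<mu> \<mu>1 :: real
    and f :: "complex \<Rightarrow> complex" and u u_RB :: "complex^'n"
  assumes spd_S: "spd S" and spd_M: "spd M"
    and L: "L = matrix_inv M ** S"
    and lam1: "lam1 = Min (eigenvalues L)"
    and lamn: "lamn = Max (eigenvalues L)"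
    and delta: "\<delta> = lam1 / lamn"
    and delta': "\<delta>' = sqrt (1 - \<delta>\<^sup>2)"
    and t0: "t 0 = \<infinity>"
    and t: "\<And>j. 1 \<le> j \<Longrightarrow> j \<le> k \<Longrightarrow>
       t j = ereal (lamn * jacobi_dn ((2 * (real k - real j) + 1) / (2 * real k) * ellK \<delta>') \<delta>')"
    and card_m: "CARD('m) = k + 1"
    and V: "orthonormal_basis_of V (reduced_space L b t k)"
    and s: "0 < s" "s < 1"
    and f: "f = (\<lambda>z. z powr (- complex_of_real s))"
    and u: "u = mat_fun f (cmat L) *v cvec b"
    and u_RB: "u_RB = galerkin_fun f V L b"
    and C_le: "C \<le> 11.08"
    and C_selfadjoint: "transpose L = L \<Longrightarrow> C = 1"
    and C_bound: "transpose L \<noteq> L \<Longrightarrow>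
       quasi_optimal TYPE('m) L b k (numerical_range L) C"
    and C_spectral: "transpose L \<noteq> L \<Longrightarrow>
       quasi_optimal TYPE('m) L b k (complex_of_real ` {lam1..lamn}) C"
    and mu: "\<mu> = ((1 - sqrt \<delta>) / (1 + sqrt \<delta>))\<^sup>2"
    and mu1: "\<mu>1 = sqrt (1 - \<mu>\<^sup>2)"
    and C_star: "C_star = pi * ellK \<mu>1 / (4 * ellK \<mu>)"
  shows "norm (u - u_RB) \<le> 4 * C * lam1 powr (- s) * exp (- C_star * real k) * norm b"
proof -
  note eig = generalized_eigenvalues[OF spd_S spd_M, folded L]
  have l1: "0 < lam1" using eig by (auto simp: lam1)
  have spec: "lam1 \<le> z \<and> z \<le> lamn" if "z \<in> eigenvalues L" for z
    using eig that by (simp add: lam1 lamn)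
  then have l1n: "lam1 \<le> lamn" using eig(2) by force
  then have ln: "0 < lamn" using l1 by simp
  have \<delta>: "0 < \<delta>" "\<delta> \<le> 1" using l1 l1n ln by (simp_all add: delta)
  then have "0 < \<delta>\<^sup>2" "\<delta>\<^sup>2 \<le> 1" by (auto intro: power_le_one)
  then have \<delta>': "\<bar>\<delta>'\<bar> < 1" by (simp add: delta')
  define \<tau> where "\<tau> = (\<lambda>j. lamn * jacobi_dn ((2 * (real k - real j) + 1) / (2 * real k) * ellK \<delta>') \<delta>')"
  define T where "T = (\<lambda>i. \<tau> (Suc i))"
  have t\<tau>: "t j = ereal (\<tau> j)" if "1 \<le> j" "j \<le> k" for j using t[OF that] by (simp add: \<tau>_def)
  have \<tau>: "0 < \<tau> j" for j using ln jacobi_dn_pos[OF \<delta>'] by (simp add: \<tau>_def)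
  have T: "0 < T i" for i using \<tau> by (simp add: T_def)
  have injT: "inj_on T {..<k}"
  proof (rule inj_onI)
    fix i j assume ij: "i \<in> {..<k}" "j \<in> {..<k}" "T i = T j"
    then have "t (Suc i) = t (Suc j)" using t\<tau> by (simp add: T_def)
    then show "i = j" using inj_onD[OF span_snapshots_card(1)[OF V card_m], of "Suc i" "Suc j"] ij by auto
  qed
  have res_inj: "v = 0" if "(mat (\<tau> j) + L) *v v = 0" for j v
  proof (rule ccontr)
    assume "v \<noteq> 0"
    have "L *v v = (- \<tau> j) *s v"
      using that by (simp add: matrix_vector_mult_add_rdistrib mat_mult_vector eq_neg_iff_add_eq_0 add.commute)
    then have "- \<tau> j \<in> eigenvalues L" using \<open>v \<noteq> 0\<close> by (auto simp: eigenvalues_def)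
    then show False using eig(3)[of "- \<tau> j"] \<tau>[of j] by simp
  qed
  define \<epsilon> where "\<epsilon> = 2 * exp (- C_star * real k)"
  have "\<bar>blaschke T k x\<bar> \<le> \<epsilon>" if x: "x \<in> {lam1..lamn}" for x
  proof -
    \<comment> \<open>The elliptic estimate needs a nonzero modulus and at least one node. For
      \<open>k = 0\<close> the empty product 1 is below 2; for \<open>\<delta> = 1\<close> the
      interval is the single point \<open>lamn\<close>, which is a zero of the product.\<close>
    consider "k = 0" | "0 < k" "\<delta> = 1" | "0 < k" "\<delta> < 1" using \<delta>(2) by linarith
    then show ?thesis
    proof cases
      case 1
      then show ?thesis by (simp add: blaschke_def \<epsilon>_def)
    next
      case 2
      then have "x = lamn" using x ln by (simp add: delta)
      moreover have "T 0 = lamn" using 2 by (simp add: T_def \<tau>_def delta' jacobi_dn_def)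
      ultimately have "blaschke T k x = 0" using 2 by (auto simp: blaschke_def intro!: bexI[of _ 0])
      then show ?thesis by (simp add: \<epsilon>_def)
    next
      case 3
      have "blaschke T k x = zolotarev \<delta>' k (x / lamn)"
        using blaschke_zolotarev[OF ln 3(1), of \<delta>' x] by (simp add: T_def \<tau>_def)
      moreover have "\<delta> \<le> x / lamn" "x / lamn \<le> 1" using x ln by (auto simp: delta divide_right_mono)
      ultimately show ?thesis
        using zolotarev_bound[OF \<delta>(1) 3(2) mu 3(1), of "x / lamn"] by (simp add: \<epsilon>_def C_star mu1 delta')
    qed
  qed
  then have "\<exists>c. \<forall>x\<in>{lam1..lamn}. \<bar>x powr (- s) - (\<Sum>i<k. c i / (x + T i))\<bar> \<le> \<epsilon> * lam1 powr (- s)"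
    by (intro powr_rational_approx T injT s l1) auto
  then obtain c where c: "\<And>x. x \<in> {lam1..lamn} \<Longrightarrow>
      \<bar>x powr (- s) - (\<Sum>i<k. c i / (x + T i))\<bar> \<le> \<epsilon> * lam1 powr (- s)"
    by blast
  have \<epsilon>: "0 \<le> \<epsilon> * lam1 powr (- s)" by (simp add: \<epsilon>_def)
  have fr: "f (complex_of_real x) = complex_of_real (x powr (- s))" if "x \<in> {lam1..lamn}" for x
    using that l1 by (simp add: f powr_complex_of_real)
  have "norm (u - u_RB) \<le> 2 * C * norm b * (\<epsilon> * lam1 powr (- s))"
  \<comment> \<open>In the symmetric case the hypotheses fix \<open>C = 1\<close> without supplying
    an error estimate, so the estimate is proved directly.\<close>
  proof (cases "transpose L = L")
    case True
    have VV: "transpose V ** V = mat 1" and range: "reduced_space L b t k = range ((*v) V)"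
      using V by (auto simp: orthonormal_basis_of_def span_columns_eq_range)
    have "\<exists>y. (mat (T i) + L) *v (V *v y) = b" if i: "i < k" for i
    proof -
      have "snapshot L b (t (Suc i)) \<in> range ((*v) V)"
        unfolding range[symmetric] reduced_space_def by (rule span_base) (use i in auto)
      then obtain y where y: "V *v y = snapshot L b (t (Suc i))" by auto
      have "invertible (mat (T i) + L)"
        unfolding invertible_left_inverse matrix_left_invertible_ker T_def
        by (intro allI impI) (rule res_inj)
      then show ?thesis
        using matrix_inv_vector(1)[of "mat (T i) + L" b] t\<tau>[of "Suc i"] i
        by (intro exI[of _ y]) (simp add: y snapshot_def T_def)
    qed
    then obtain y where y: "\<And>i. i < k \<Longrightarrow> (mat (T i) + L) *v (V *v y i) = b" by metis
    have "norm (u - u_RB) \<le> 2 * norm b * (\<epsilon> * lam1 powr (- s))"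
      unfolding u u_RB by (rule galerkin_error_symmetric[OF True VV l1 spec T y c fr \<epsilon>])
    then show ?thesis using C_selfadjoint[OF True] by simp
  next
    case False
    have K: "pole_poly (\<lambda>j. - t j) k = (\<Prod>j\<in>{1..k}. [:\<tau> j, 1:])"
      "reduced_space L b t k = krylov_space L b (\<lambda>j. - t j) k"
      by (rule reduced_space_eq_krylov_space[OF V card_m t0, where \<tau> = \<tau>],
          rule t\<tau>, assumption+, rule res_inj, assumption)+
    have q: "pole_poly (\<lambda>j. - t j) k = (\<Prod>i<k. [:T i, 1:])"
      unfolding K(1) T_def by (rule prod.reindex_bij_witness[of _ Suc "\<lambda>j. j - 1"]) auto
    have d: "- t j \<le> 0" if "j \<le> k" for j
      using t0 t\<tau>[of j] \<tau>[of j] that by (cases "j = 0") auto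
    have an: "f analytic_on complex_of_real ` {lam1..lamn}"
      unfolding f by (intro analytic_intros) (use l1 in \<open>auto simp: complex_nonpos_Reals_iff\<close>)
    show ?thesis
      unfolding u u_RB
      by (rule galerkin_error_quasi_optimal[OF C_spectral[OF False] V[unfolded K(2)] d q l1 T c fr an \<epsilon>])
  qed
  then show ?thesis by (simp add: \<epsilon>_def mult_ac)
qed

end
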